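(* Let $n\ge1$ and $\beta\in(0,\infty]$. For $\lambda\in\mathcal Q$ let $S=\log\mathrm{vol}(\mathcal O_\lambda)$, regarded as a function $S(\sigma)$ of $\sigma=(\sigma^1,\dots,\sigma^n)$, where $\sigma^k>0$ is defined by $\tanh^2(\sigma^k/2)=\lambda_k$. There is a universal constant $c_n>0$ (depending only on $n$) such that $$S(\sigma)=\sum_{k=1}^n\log\sinh\sigma^k+\sum_{1\le k<l\le n}\log|\cosh\sigma^k-\cosh\sigma^l|+c_n .$$ Moreover, the It\^o stochastic differential equation $$\mathrm d\sigma^k_t=\frac12\Big(\coth\sigma^k_t+\sum_{l\ne k}\frac{\sinh\sigma^k_t}{\cosh\sigma^k_t-\cosh\sigma^l_t}\Big)\mathrm dt+\sqrt{\tfrac2\beta}\,\mathrm dW^k_t,\qquad k=1,\dots,n,$$ with $W_t$ a standard Wiener process in $\mathbb R^n$, is equivalent to the stochastic gradient ascent of Boltzmann entropy $$\mathrm d\sigma_t=\frac12\nabla S(\sigma_t)\,\mathrm dt+\sqrt{\tfrac2\beta}\,\mathrm dW_t ,$$ where $\nabla$ is the usual Euclidean gradient in $\sigma$.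
   Context: Notation: $\boldsymbol i=\sqrt{-1}$, $I_n$ is the $n\times n$ identity; $\sqrt{2/\beta}=0$ when $\beta=\infty$. The Siegel half-space is $\mathcal H=\{Z=X+\boldsymbol i Y : X=X^T,\ Y=Y^T \text{ real } n\times n \text{ matrices},\ Y\succ0\}$, with the Riemannian metric $g_{\mathcal H}=\mathrm{Tr}(Y^{-1}\mathrm dZ\,Y^{-1}\mathrm d\bar Z)$. Cross-ratio: $\mathfrak R(Z,Z_1)=(Z-Z_1)(Z-\bar Z_1)^{-1}(\bar Z-\bar Z_1)(\bar Z-Z_1)^{-1}$; the eigenvalues of $\mathfrak R(Z,\boldsymbol i I_n)$ lie in $[0,1)$. $\mathcal Q=\{\lambda\in(0,1)^n:\lambda_1<\dots<\lambda_n\}$. For $\lambda\in\mathcal Q$, $\mathcal O_\lambda=\{Z\in\mathcal H:\ \text{the eigenvalues of }\mathfrak R(Z,\boldsymbol i I_n)\text{ are }\lambda\}$, a smooth submanifold of dimension $n^2$, and $\mathrm{vol}(\mathcal O_\lambda)$ is its $n^2$-dimensional Riemannian volume for the metric induced by $g_{\mathcal H}$.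
   Formalization: The additive constant c_n is not claimed positive: c_n = log C_n with C_n > 0, since C_n = 2^{n²}π^{n(n+1)/2}/∏_{k<n}k! makes c_n negative for large n (c_100 ≈ -2905), so "c_n > 0" fails as stated; it is still a constant depending only on n. *)

theory Defs
  imports "HOL-Probability.Probability"
begin

section \<open>Riemannian volume of embedded submanifolds of a Euclidean space\<close>

text \<open>
  Submanifolds are subsets \<open>N\<close> of a Euclidean space, and \<open>g p v w\<close> is the inner product of the
  tangent vectors \<open>v\<close>, \<open>w\<close> at \<open>p\<close>. The dimension of \<open>N\<close> is the cardinality of the index
  type \<open>'m\<close> of the parameter domain; the first predicate describes its local
  parametrisations (inverses of \<open>C\<^sup>1\<close> charts).
\<close>

definition local_parametrisation ::
    "'a::euclidean_space set \<Rightarrow> (real^'m) set \<Rightarrow> (real^'m \<Rightarrow> 'a) \<Rightarrow> bool" where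
  "local_parametrisation N U \<phi> \<longleftrightarrow>
     open U \<and>
     openin (top_of_set N) (\<phi> ` U) \<and>
     (\<exists>\<psi>. homeomorphism U (\<phi> ` U) \<phi> \<psi>) \<and>
     (\<forall>u\<in>U. \<phi> differentiable (at u) \<and> inj (frechet_derivative \<phi> (at u))) \<and>
     (\<forall>h. continuous_on U (\<lambda>u. frechet_derivative \<phi> (at u) h))"

definition gram_matrix ::
    "('a::euclidean_space \<Rightarrow> 'a \<Rightarrow> 'a \<Rightarrow> real) \<Rightarrow> (real^'m \<Rightarrow> 'a) \<Rightarrow> real^'m \<Rightarrow> real^'m^'m" where
  "gram_matrix g \<phi> u =
     (\<chi> i j. g (\<phi> u) (frechet_derivative \<phi> (at u) (axis i 1)) (frechet_derivative \<phi> (at u) (axis j 1)))"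

text \<open>The type argument only carries the dimension \<open>CARD('m)\<close>.\<close>

definition is_riemannian_measure ::
    "('a::euclidean_space \<Rightarrow> 'a \<Rightarrow> 'a \<Rightarrow> real) \<Rightarrow> 'm::finite itself \<Rightarrow> 'a set \<Rightarrow> 'a measure \<Rightarrow> bool" where
  "is_riemannian_measure g _ N \<mu> \<longleftrightarrow>
     sets \<mu> = sets (restrict_space borel N) \<and>
     (\<forall>(U :: (real^'m) set) \<phi>. local_parametrisation N U \<phi> \<longrightarrow>
        (\<forall>B\<in>sets borel. B \<subseteq> U \<longrightarrow>
           emeasure \<mu> (\<phi> ` B) = (\<integral>\<^sup>+u\<in>B. ennreal (sqrt (det (gram_matrix g \<phi> u))) \<partial>lborel)))"

text \<open>
  On a submanifold of dimension \<open>CARD('m)\<close> there is exactly one such measure, since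
  countably many parametrised patches cover it.
\<close>

definition riemannian_volume ::
    "('a::euclidean_space \<Rightarrow> 'a \<Rightarrow> 'a \<Rightarrow> real) \<Rightarrow> 'm::finite itself \<Rightarrow> 'a set \<Rightarrow> ennreal" where
  "riemannian_volume g m N = emeasure (THE \<mu>. is_riemannian_measure g m N \<mu>) N"


section \<open>The Siegel half-space\<close>

definition Re_mat :: "complex^'n^'n \<Rightarrow> real^'n^'n" where
  "Re_mat Z = (\<chi> i j. Re (Z $ i $ j))"

definition Im_mat :: "complex^'n^'n \<Rightarrow> real^'n^'n" where
  "Im_mat Z = (\<chi> i j. Im (Z $ i $ j))"

definition cnj_mat :: "complex^'n^'n \<Rightarrow> complex^'n^'n" where
  "cnj_mat Z = (\<chi> i j. cnj (Z $ i $ j))"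

definition complex_mat :: "real^'n^'n \<Rightarrow> complex^'n^'n" where
  "complex_mat A = (\<chi> i j. complex_of_real (A $ i $ j))"

definition siegel_half_space :: "(complex^'n^'n) set" where
  "siegel_half_space =
     {Z. transpose (Re_mat Z) = Re_mat Z \<and> transpose (Im_mat Z) = Im_mat Z \<and>
         (\<forall>v. v \<noteq> 0 \<longrightarrow> 0 < v \<bullet> (Im_mat Z *v v))}"

text \<open>
  The symmetric bilinear form that polarises the quadratic form
  \<open>Tr (Y\<^sup>-\<^sup>1 V Y\<^sup>-\<^sup>1 cnj V)\<close>; that form is already real
  on symmetric \<open>V\<close>, i.e. on the tangent vectors of the half-space.
\<close>

definition siegel_metric :: "complex^'n^'n \<Rightarrow> complex^'n^'n \<Rightarrow> complex^'n^'n \<Rightarrow> real" where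
  "siegel_metric Z V W =
     (let Yinv = complex_mat (matrix_inv (Im_mat Z))
      in Re (trace (Yinv ** V ** Yinv ** cnj_mat W)))"

definition cross_ratio :: "complex^'n^'n \<Rightarrow> complex^'n^'n \<Rightarrow> complex^'n^'n" where
  "cross_ratio Z Z1 =
     (Z - Z1) ** matrix_inv (Z - cnj_mat Z1) ** (cnj_mat Z - cnj_mat Z1) ** matrix_inv (cnj_mat Z - Z1)"

definition eigenvalues :: "complex^'n^'n \<Rightarrow> complex set" where
  "eigenvalues A = {\<mu>. \<exists>v. v \<noteq> 0 \<and> A *v v = \<mu> *s v}"

definition eigenvalue_chamber :: "(real^'n::{finite,linorder}) set" where
  "eigenvalue_chamber =
     {l. (\<forall>k. 0 < l $ k \<and> l $ k < 1) \<and> (\<forall>j k. j < k \<longrightarrow> l $ j < l $ k)}"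

text \<open>
  Used only for \<open>l\<close> in the chamber: the \<open>n\<close> entries of \<open>l\<close> are then distinct, so equality of
  sets fixes the eigenvalues with multiplicity. Note that \<open>mat \<i>\<close> is \<open>\<i>\<close> times the identity.
\<close>

definition siegel_orbit :: "real^'n \<Rightarrow> (complex^'n^'n) set" where
  "siegel_orbit l =
     {Z \<in> siegel_half_space.
        eigenvalues (cross_ratio Z (mat \<i>)) = range (\<lambda>k. complex_of_real (l $ k))}"

text \<open>The index type \<open>'n \<times> 'n\<close> has cardinality \<open>n\<^sup>2\<close>, the dimension of the orbits.\<close>

definition orbit_volume :: "real^'n \<Rightarrow> ennreal" where
  "orbit_volume l = riemannian_volume siegel_metric TYPE('n \<times> 'n) (siegel_orbit l)"

definition lambda_of :: "real^'n \<Rightarrow> real^'n" where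
  "lambda_of \<sigma> = (\<chi> k. (tanh (\<sigma> $ k / 2))\<^sup>2)"

definition sigma_chamber :: "(real^'n::{finite,linorder}) set" where
  "sigma_chamber = {\<sigma>. (\<forall>k. 0 < \<sigma> $ k) \<and> lambda_of \<sigma> \<in> eigenvalue_chamber}"

definition boltzmann_entropy :: "real^'n \<Rightarrow> real" where
  "boltzmann_entropy \<sigma> = ln (enn2real (orbit_volume (lambda_of \<sigma>)))"


section \<open>Stochastic differential equations with additive noise\<close>

definition gradient :: "('a::real_inner \<Rightarrow> real) \<Rightarrow> 'a \<Rightarrow> 'a" where
  "gradient f x = (THE D. GDERIV f x :> D)"

text \<open>
  Time is \<open>{0..}\<close>; the filtration at negative times is irrelevant.
\<close>

locale wiener_process = prob_space M + filtration "space M" F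
  for M :: "'w measure" and F :: "real \<Rightarrow> 'w measure" +
  fixes W :: "real \<Rightarrow> 'w \<Rightarrow> real^'n"
  assumes subalg: "\<And>t. sets (F t) \<subseteq> sets M"
    and adapted: "\<And>t. 0 \<le> t \<Longrightarrow> W t \<in> borel_measurable (F t)"
    and start: "AE \<omega> in M. W 0 \<omega> = 0"
    and paths: "AE \<omega> in M. continuous_on {0..} (\<lambda>t. W t \<omega>)"
    and increments_indep: "\<And>s t. 0 \<le> s \<Longrightarrow> s < t \<Longrightarrow>
      indep_set (sets (F s)) {(\<lambda>\<omega>. W t \<omega> - W s \<omega>) -` A \<inter> space M | A. A \<in> sets borel}"
    and increments_normal: "\<And>s t. 0 \<le> s \<Longrightarrow> s < t \<Longrightarrow>
      distr M borel (\<lambda>\<omega>. W t \<omega> - W s \<omega>) =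
      density lborel (\<lambda>x. ennreal (\<Prod>k\<in>UNIV. normal_density 0 (sqrt (t - s)) (x $ k)))"

text \<open>
  \<open>X\<close> solves \<open>dX = b(X) dt + \<epsilon> dW\<close> in the state space \<open>D\<close> up to the stopping time \<open>\<tau>\<close> (a
  solution may leave \<open>D\<close> in finite time; values of \<open>X\<close> from time \<open>\<tau>\<close> on are
  irrelevant). As \<open>\<epsilon>\<close> is constant, the Ito integral of \<open>\<epsilon>\<close> over \<open>[0, t]\<close> is \<open>\<epsilon> (W\<^sub>t - W\<^sub>0)\<close>.
\<close>

definition solves_sde ::
    "(real^'n \<Rightarrow> real^'n) \<Rightarrow> real \<Rightarrow> (real^'n) set \<Rightarrow> 'w measure \<Rightarrow> (real \<Rightarrow> 'w measure) \<Rightarrow>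
     (real \<Rightarrow> 'w \<Rightarrow> real^'n) \<Rightarrow> (real \<Rightarrow> 'w \<Rightarrow> real^'n) \<Rightarrow> ('w \<Rightarrow> ereal) \<Rightarrow> bool" where
  "solves_sde b \<epsilon> D M F W X \<tau> \<longleftrightarrow>
     wiener_process M F W \<and>
     (\<forall>t\<ge>0. X t \<in> borel_measurable (F t)) \<and>
     (\<forall>t\<ge>0. Measurable.pred (F t) (\<lambda>\<omega>. \<tau> \<omega> \<le> ereal t)) \<and>
     (AE \<omega> in M. 0 < \<tau> \<omega> \<and>
        continuous_on {t. 0 \<le> t \<and> ereal t < \<tau> \<omega>} (\<lambda>t. X t \<omega>) \<and>
        (\<forall>t\<ge>0. ereal t < \<tau> \<omega> \<longrightarrow>
           X t \<omega> \<in> D \<and>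
           ((\<lambda>s. b (X s \<omega>)) has_integral
              (X t \<omega> - X 0 \<omega> - \<epsilon> *\<^sub>R (W t \<omega> - W 0 \<omega>))) {0..t}))"

definition sigma_drift :: "real^'n \<Rightarrow> real^'n" where
  "sigma_drift \<sigma> =
     (\<chi> k. 1/2 * (cosh (\<sigma> $ k) / sinh (\<sigma> $ k) +
                 (\<Sum>l\<in>UNIV - {k}. sinh (\<sigma> $ k) / (cosh (\<sigma> $ k) - cosh (\<sigma> $ l)))))"

text \<open>At \<open>\<beta> = \<infinity>\<close> the quotient is \<open>0\<close>, hence so is the amplitude.\<close>

definition noise_amplitude :: "ereal \<Rightarrow> real" where
  "noise_amplitude \<beta> = sqrt (real_of_ereal (2 / \<beta>))"

end

theory Submission
  imports Defs
begin

text \<open>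
  In the disc model \<open>Z = \<i> (1 + W) (1 - W)\<^sup>-\<^sup>1\<close> the cross-ratio
  \<open>\<RR>(Z, \<i>)\<close> becomes \<open>W W\<^sup>*\<close>, so by Takagi's factorisation the orbit consists of
  the points with \<open>W = U D U\<^sup>T\<close>, where \<open>U\<close> is unitary and \<open>D\<close> is the diagonal matrix of the
  \<open>tanh (\<sigma>\<^sup>k / 2)\<close>; here \<open>U\<close> is unique up to a diagonal matrix of signs. With
  \<open>\<kappa> = U\<^sup>* dU\<close> one has \<open>dW = U (\<kappa> D + D \<kappa>\<^sup>T) U\<^sup>T\<close>, and the metric
  pulls back to a quadratic form that is diagonal in the real coordinates of \<open>\<kappa>\<close>, with
  coefficients depending on \<open>D\<close> alone. The left-invariant form \<open>\<kappa>\<close> does not depend on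
  \<open>D\<close>, and neither does the stabiliser, so one finite atlas coming from the
  unitary group serves all orbits, and the volume is the square root of the product of the coefficients times
  a constant. The drift is half the gradient of the logarithm of this product.
\<close>

section \<open>Change of variables for nonnegative integrals\<close>

text \<open>\<open>riemannian_volume\<close> is a definite description, so on every orbit a measure
  with the prescribed values in all parametrisations must be shown to exist and to be unique; this
  is what requires a substitution rule and differentiable transition maps. The remaining difficulty
  is to compare orbits with different \<open>d\<close>. Two facts remove \<open>d\<close> from the
  bookkeeping. In each chart the Gram determinant is a function of the parameter times a function of
  \<open>d\<close>. And for distinct entries of \<open>d\<close> in (0, 1), two unitary matrices
  give the same orbit point exactly when they differ by a diagonal of signs, a condition without
  \<open>d\<close>; so the radius of the parameter balls, the overlaps of the charts and the
  disjoint pieces cut from them are literally the same sets for all orbits. Summing over the pieces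
  leaves one number \<open>Q\<close>, positive, finite and fixed before \<open>d\<close>. The
  additive constant of the entropy is its logarithm plus the logarithms of the factors 2 and 4 that
  accompany each sinh and each difference of cosh.\<close>

text \<open>
  The library's change of variables theorem needs a well-ordered index type, while the charts are
  indexed by \<open>'n \<times> 'n\<close>; \<open>'a enumerated\<close> is a well-ordered
  copy of an arbitrary finite type.
\<close>

typedef 'a enumerated = "{..<CARD('a::finite)}"
  by (intro exI[of _ 0]) auto

instantiation enumerated :: (finite) wellorder
begin
definition "x \<le> y \<longleftrightarrow> Rep_enumerated x \<le> Rep_enumerated y"
definition "x < y \<longleftrightarrow> Rep_enumerated x < Rep_enumerated y"
instance
proof
  fix P :: "'a enumerated \<Rightarrow> bool" and a :: "'a enumerated"
  assume *: "\<And>x. (\<And>y. y < x \<Longrightarrow> P y) \<Longrightarrow> P x"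
  show "P a"
    by (induction a rule: measure_induct_rule[of Rep_enumerated]) (use * less_enumerated_def in blast)
qed (auto simp: less_eq_enumerated_def less_enumerated_def Rep_enumerated_inject)
end

instance enumerated :: (finite) finite
proof
  have "inj (Rep_enumerated :: 'a enumerated \<Rightarrow> nat)"
    by (auto simp: inj_def Rep_enumerated_inject)
  moreover have "finite (range (Rep_enumerated :: 'a enumerated \<Rightarrow> nat))"
    by (rule finite_subset[of _ "{..<CARD('a)}"]) (use Rep_enumerated in blast, simp)
  ultimately show "finite (UNIV :: 'a enumerated set)"
    using finite_image_iff by blast
qed

lemma card_enumerated: "CARD('a::finite enumerated) = CARD('a)"
  by (simp add: type_definition.card[OF type_definition_enumerated])

lemma ex_bij_enumerated: "\<exists>e :: 'a::finite enumerated \<Rightarrow> 'a. bij e"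
  using finite_same_card_bij[of "UNIV :: 'a enumerated set" "UNIV :: 'a set"]
  by (simp add: card_enumerated)

section \<open>Relabelling of coordinates\<close>

definition reindex :: "('k \<Rightarrow> 'm) \<Rightarrow> real^'m \<Rightarrow> real^'k" where
  "reindex e x = (\<chi> i. x $ e i)"

lemma linear_reindex: "linear (reindex e)"
  by (intro linearI) (auto simp: reindex_def vec_eq_iff)

lemma reindex_reindex_inv:
  assumes "bij e"
  shows "reindex e (reindex (inv e) x) = x" "reindex (inv e) (reindex e y) = y"
  using assms by (auto simp: reindex_def vec_eq_iff bij_is_inj bij_is_surj surj_f_inv_f)

lemma borel_measurable_reindex [measurable]:
  fixes e :: "'k::finite \<Rightarrow> 'm::finite"
  shows "reindex e \<in> borel_measurable borel"
  by (intro borel_measurable_continuous_onI linear_continuous_on linear_linear[THEN iffD2] linear_conv_bounded_linear[THEN iffD1] linear_reindex)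

lemma prod_Basis_real_vec:
  "(\<Prod>b\<in>(Basis :: (real^'n) set). f b) = (\<Prod>i\<in>UNIV. f (axis i 1))"
proof -
  have "(Basis :: (real^'n) set) = range (\<lambda>i. axis i 1)"
    by (auto simp: Basis_vec_def)
  moreover have "inj (\<lambda>i::'n. axis i (1::real))" by (auto simp: inj_def axis_eq_axis)
  ultimately show ?thesis using prod.reindex[of "\<lambda>i::'n. axis i (1::real)" UNIV f] by (simp only: o_def)
qed

text \<open>Lebesgue measure is determined by its values on boxes, and a permutation of the
  coordinates maps a box to a box with the same side lengths.\<close>

lemma distr_lborel_reindex:
  fixes e :: "'k::finite \<Rightarrow> 'm::finite"
  assumes "bij e"
  shows "distr lborel lborel (reindex e) = lborel"
proof (rule sym, rule lborel_eqI)
  fix l u :: "real^'k"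
  assume lu: "\<And>b. b \<in> Basis \<Longrightarrow> l \<bullet> b \<le> u \<bullet> b"
  have lu': "l $ i \<le> u $ i" for i
    using lu[of "axis i 1"] by (auto simp: Basis_vec_def inner_axis)
  have box: "reindex e -` box l u = box (reindex (inv e) l) (reindex (inv e) u)"
  proof -
    have "(\<forall>i. l $ i < x $ e i \<and> x $ e i < u $ i) \<longleftrightarrow> (\<forall>j. l $ inv e j < x $ j \<and> x $ j < u $ inv e j)" for x
      using assms by (metis bij_inv_eq_iff)
    then show ?thesis by (auto simp: mem_box_cart reindex_def)
  qed
  have "emeasure (distr lborel lborel (reindex e)) (box l u)
      = emeasure lborel (box (reindex (inv e) l) (reindex (inv e) u))"
    by (subst emeasure_distr) (auto simp: box)
  also have "\<dots> = (\<Prod>b\<in>Basis. (reindex (inv e) u - reindex (inv e) l) \<bullet> b)"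
    by (subst emeasure_lborel_box) (auto simp: Basis_vec_def inner_axis reindex_def lu')
  also have "\<dots> = (\<Prod>j\<in>UNIV. u $ inv e j - l $ inv e j)"
    by (subst prod_Basis_real_vec) (auto simp: reindex_def inner_axis)
  also have "(\<Prod>j\<in>UNIV. u $ inv e j - l $ inv e j) = (\<Prod>i\<in>UNIV. u $ i - l $ i)"
    by (rule prod.reindex_bij_betw[of "inv e" UNIV UNIV "\<lambda>i. u $ i - l $ i"]) (use assms bij_imp_bij_inv in blast)
  also have "\<dots> = (\<Prod>b\<in>Basis. (u - l) \<bullet> b)"
    by (subst prod_Basis_real_vec) (auto simp: inner_axis)
  finally show "emeasure (distr lborel lborel (reindex e)) (box l u) = (\<Prod>b\<in>Basis. (u - l) \<bullet> b)" .
qed auto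

text \<open>The substitution rule for absolutely integrable functions becomes one for nonnegative
  integrals: either both sides are integrable and their values agree, or neither is, and then
  nonnegativity makes both infinite.\<close>

lemma nn_integral_change_of_variables_wellorder:
  fixes f :: "real^'m::{finite,wellorder} \<Rightarrow> real" and g :: "real^'m::_ \<Rightarrow> real^'m::_"
  assumes S: "S \<in> sets borel"
    and der: "\<And>x. x \<in> S \<Longrightarrow> (g has_derivative g' x) (at x)"
    and inj: "inj_on g S"
    and meas1: "(\<lambda>x. f x * indicator (g ` S) x) \<in> borel_measurable borel"
    and meas2: "(\<lambda>x. \<bar>det (matrix (g' x))\<bar> * f (g x) * indicator S x) \<in> borel_measurable borel"
    and nonneg: "\<And>x. x \<in> S \<Longrightarrow> 0 \<le> f (g x)"
  shows "(\<integral>\<^sup>+x\<in>g ` S. ennreal (f x) \<partial>lborel) =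
    (\<integral>\<^sup>+x\<in>S. ennreal (\<bar>det (matrix (g' x))\<bar> * f (g x)) \<partial>lborel)"
proof -
  let ?D = "\<lambda>x. \<bar>det (matrix (g' x))\<bar> * f (g x)"
  let ?F = "\<lambda>x. f x * indicator (g ` S) x" and ?H = "\<lambda>x. ?D x * indicator S x"
  have der': "\<And>x. x \<in> S \<Longrightarrow> (g has_derivative g' x) (at x within S)"
    using der has_derivative_at_withinI by blast
  have SL: "S \<in> sets lebesgue" using S by auto
  \<comment> \<open>The rule is applied to vector-valued functions with values in
    \<open>real^1\<close>. The equivalence holds for every \<open>b\<close>, so it transfers
    integrability as well as the value.\<close>
  have key: "(?D absolutely_integrable_on S \<and> integral S ?D = b) \<longleftrightarrow>
    (f absolutely_integrable_on (g ` S) \<and> integral (g ` S) f = b)" for b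
    using has_absolute_integral_change_of_variables[OF SL der' inj, of "\<lambda>x. vec (f x) :: real^1" "vec b"]
    by (simp add: absolutely_integrable_on_1_iff integral_on_1_eq)
  have LF: "(\<integral>\<^sup>+x\<in>g ` S. ennreal (f x) \<partial>lborel) = (\<integral>\<^sup>+x. ennreal (?F x) \<partial>lborel)"
    by (intro nn_integral_cong) (auto simp: indicator_def)
  have LH: "(\<integral>\<^sup>+x\<in>S. ennreal (?D x) \<partial>lborel) = (\<integral>\<^sup>+x. ennreal (?H x) \<partial>lborel)"
    by (intro nn_integral_cong) (auto simp: indicator_def)
  have iF: "f absolutely_integrable_on (g ` S) \<longleftrightarrow> integrable lborel ?F"
    unfolding set_integrable_def using integrable_completion[of ?F lborel] meas1
    by (simp add: mult.commute)
  have iH: "?D absolutely_integrable_on S \<longleftrightarrow> integrable lborel ?H"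
    unfolding set_integrable_def using integrable_completion[of ?H lborel] meas2
    by (simp add: mult.commute)
  have eF: "integral (g ` S) f = integral\<^sup>L lborel ?F" if "f absolutely_integrable_on (g ` S)"
    using set_lebesgue_integral_eq_integral(2)[OF that] integral_completion[of ?F lborel] meas1
    by (simp add: set_lebesgue_integral_def mult.commute)
  have eH: "integral S ?D = integral\<^sup>L lborel ?H" if "?D absolutely_integrable_on S"
    using set_lebesgue_integral_eq_integral(2)[OF that] integral_completion[of ?H lborel] meas2
    by (simp add: set_lebesgue_integral_def mult.commute)
  have nF: "0 \<le> ?F x" for x using nonneg by (auto simp: indicator_def)
  have nH: "0 \<le> ?H x" for x using nonneg by (auto simp: indicator_def)
  show ?thesis
  proof (cases "f absolutely_integrable_on (g ` S)")
    case True
    then have D: "?D absolutely_integrable_on S" and eq: "integral S ?D = integral (g ` S) f"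
      using key by blast+
    have "(\<integral>\<^sup>+x. ennreal (?F x) \<partial>lborel) = ennreal (integral\<^sup>L lborel ?F)"
      using True iF nF by (intro nn_integral_eq_integral) auto
    moreover have "(\<integral>\<^sup>+x. ennreal (?H x) \<partial>lborel) = ennreal (integral\<^sup>L lborel ?H)"
      using D iH nH by (intro nn_integral_eq_integral) auto
    ultimately show ?thesis using eF eH True D eq LF LH by simp
  next
    case False
    then have "\<not> ?D absolutely_integrable_on S" using key by blast
    then have "(\<integral>\<^sup>+x. ennreal (?H x) \<partial>lborel) = \<infinity>"
      using iH nH meas2 by (subst (asm) integrable_iff_bounded) (auto simp flip: less_top)
    moreover have "(\<integral>\<^sup>+x. ennreal (?F x) \<partial>lborel) = \<infinity>"
      using iF False nF meas1 by (subst (asm) integrable_iff_bounded) (auto simp flip: less_top)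
    ultimately show ?thesis using LF LH by simp
  qed
qed

text \<open>Conjugation by a bijection turns the transposition of \<open>a\<close> and
  \<open>b\<close> into that of their preimages, so a factorisation into swaps keeps its length and
  hence its parity.\<close>

lemma sign_conjugate:
  fixes e :: "'k::finite \<Rightarrow> 'm::finite"
  assumes e: "bij e" and p: "permutation p"
  shows "sign (inv e \<circ> p \<circ> e) = sign p"
proof -
  have inj: "inj e" and surj: "surj e" using e by (auto simp: bij_def)
  have *: "swapidseq n q \<Longrightarrow> swapidseq n (inv e \<circ> q \<circ> e)" for n q
  proof (induction rule: swapidseq.induct)
    case id
    have "inv e \<circ> id \<circ> e = id" using inj by (simp add: fun_eq_iff)
    then show ?case using swapidseq.id by metis
  next
    case (comp_Suc n q a b)
    have "inv e \<circ> (Transposition.transpose a b \<circ> q) \<circ> e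
        = Transposition.transpose (inv e a) (inv e b) \<circ> (inv e \<circ> q \<circ> e)"
      using e by (simp add: fun_eq_iff Transposition.transpose_def bij_inv_eq_iff inj surj surj_f_inv_f)
    moreover have "inv e a \<noteq> inv e b" using comp_Suc surj by (metis surj_f_inv_f)
    ultimately show ?case using comp_Suc swapidseq.comp_Suc by metis
  qed
  obtain n where n: "swapidseq n p" using p by (auto simp: permutation_def)
  show ?thesis using evenperm_unique[OF n refl] evenperm_unique[OF *[OF n] refl] by (simp add: sign_def)
qed

text \<open>Conjugating permutations by \<open>e\<close> matches the Leibniz sums of the two
  determinants term by term.\<close>

lemma det_reindex:
  fixes e :: "'k::finite \<Rightarrow> 'm::finite" and A :: "real^'m^'m" and B :: "real^'k^'k"
  assumes e: "bij e" and B: "\<And>i j. B $ i $ j = A $ e i $ e j"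
  shows "det B = det A"
proof -
  have inj: "inj e" and surj: "surj e" using e by (auto simp: bij_def)
  have bij: "bij_betw (\<lambda>p. inv e \<circ> p \<circ> e) {p. p permutes UNIV} {q. q permutes UNIV}"
  proof (rule bij_betw_byWitness[where f' = "\<lambda>q. e \<circ> q \<circ> inv e"])
    show "(\<lambda>p. inv e \<circ> p \<circ> e) ` {p. p permutes UNIV} \<subseteq> {q. q permutes UNIV}"
      using e by (auto intro!: bij_imp_permutes bij_comp bij_imp_bij_inv dest: permutes_bij)
    show "(\<lambda>q. e \<circ> q \<circ> inv e) ` {q. q permutes UNIV} \<subseteq> {p. p permutes UNIV}"
      using e by (auto intro!: bij_imp_permutes bij_comp bij_imp_bij_inv dest: permutes_bij)
  qed (use inj surj in \<open>auto simp: fun_eq_iff surj_f_inv_f\<close>)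
  have "det B = (\<Sum>p\<in>{p. p permutes UNIV}.
      of_int (sign (inv e \<circ> p \<circ> e)) * (\<Prod>i\<in>UNIV. B $ i $ (inv e \<circ> p \<circ> e) i))"
    unfolding det_def by (rule sum.reindex_bij_betw[OF bij, symmetric])
  also have "\<dots> = det A"
    unfolding det_def
  proof (rule sum.cong[OF refl], goal_cases)
    case (1 p)
    have "(\<Prod>i\<in>UNIV. B $ i $ (inv e \<circ> p \<circ> e) i) = (\<Prod>i\<in>UNIV. A $ e i $ p (e i))"
      by (simp add: B surj surj_f_inv_f)
    also have "\<dots> = (\<Prod>i\<in>UNIV. A $ i $ p i)"
      by (rule prod.reindex_bij_betw[OF e])
    finally show ?case
      using sign_conjugate[OF e, of p] 1 by (simp add: permutation_permutes) (metis finite_code)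
  qed
  finally show ?thesis .
qed

lemma nn_integral_reindex:
  fixes e :: "'k::finite \<Rightarrow> 'm::finite" and h :: "real^'k \<Rightarrow> ennreal"
  assumes "bij e" "h \<in> borel_measurable borel"
  shows "(\<integral>\<^sup>+x. h (reindex e x) \<partial>lborel) = (\<integral>\<^sup>+y. h y \<partial>lborel)"
  using nn_integral_distr[of "reindex e" lborel lborel h] assms by (simp add: distr_lborel_reindex)

text \<open>Here \<open>g\<close> is conjugated by a relabelling of the coordinates. The relabelling
  preserves Lebesgue measure, and it permutes rows and columns of the Jacobian matrix alike, so the
  determinant is unchanged.\<close>

lemma nn_integral_change_of_variables:
  fixes f :: "real^'m::finite \<Rightarrow> real" and g :: "real^'m \<Rightarrow> real^'m"
  assumes S: "S \<in> sets borel"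
    and der: "\<And>x. x \<in> S \<Longrightarrow> (g has_derivative g' x) (at x)"
    and inj: "inj_on g S"
    and meas1: "(\<lambda>x. f x * indicator (g ` S) x) \<in> borel_measurable borel"
    and meas2: "(\<lambda>x. \<bar>det (matrix (g' x))\<bar> * f (g x) * indicator S x) \<in> borel_measurable borel"
    and nonneg: "\<And>x. x \<in> S \<Longrightarrow> 0 \<le> f (g x)"
  shows "(\<integral>\<^sup>+x\<in>g ` S. ennreal (f x) \<partial>lborel) =
    (\<integral>\<^sup>+x\<in>S. ennreal (\<bar>det (matrix (g' x))\<bar> * f (g x)) \<partial>lborel)"
proof -
  obtain e :: "'m enumerated \<Rightarrow> 'm" where e: "bij e" using ex_bij_enumerated by blast
  let ?r = "reindex e" and ?s = "reindex (inv e)"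
  have e': "bij (inv e)" using e by (rule bij_imp_bij_inv)
  note rs = reindex_reindex_inv[OF e]
  define T where "T = ?s -` S"
  define G where "G = ?r \<circ> g \<circ> ?s"
  define G' where "G' = (\<lambda>y. ?r \<circ> g' (?s y) \<circ> ?s)"
  have blr: "bounded_linear ?r" and bls: "bounded_linear ?s"
    using linear_reindex linear_conv_bounded_linear by blast+
  have T: "T \<in> sets borel" unfolding T_def using measurable_sets_borel[OF borel_measurable_reindex S] .
  have derG: "(G has_derivative G' y) (at y)" if "y \<in> T" for y
    unfolding G_def G'_def
    using that diff_chain_at[OF bounded_linear_imp_has_derivative[OF bls]
        diff_chain_at[OF der bounded_linear_imp_has_derivative[OF blr]], of y]
    by (simp add: T_def o_def)
  have injG: "inj_on G T"
    using inj unfolding G_def T_def inj_on_def by (metis comp_apply rs vimageE)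
  have detG: "det (matrix (G' y)) = det (matrix (g' (?s y)))" for y
  proof (rule det_reindex[OF e])
    fix i j
    have "?s (axis j 1) = axis (e j) 1"
      unfolding reindex_def axis_def using e by (simp add: vec_eq_iff) (metis bij_inv_eq_iff)
    then show "matrix (G' y) $ i $ j = matrix (g' (?s y)) $ e i $ e j"
      by (simp add: matrix_def G'_def) (simp add: reindex_def)
  qed
  have imG: "y \<in> G ` T \<longleftrightarrow> ?s y \<in> g ` S" for y
  proof
    assume "y \<in> G ` T"
    then show "?s y \<in> g ` S" by (auto simp: G_def T_def rs)
  next
    assume "?s y \<in> g ` S"
    then obtain x where x: "x \<in> S" "?s y = g x" by blast
    then have "y = G (?r x)" "?r x \<in> T" by (auto simp: G_def T_def rs) (metis rs(1))
    then show "y \<in> G ` T" by blast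
  qed
  have iG: "indicator (G ` T) y = (indicator (g ` S) (?s y) :: 'z::zero_neq_one)" for y
    by (simp add: indicator_def imG)
  have iT: "indicator T y = (indicator S (?s y) :: 'z::zero_neq_one)" for y
    by (simp add: indicator_def T_def)
  have G: "?s (G y) = g (?s y)" for y by (simp add: G_def rs)
  note ms = measurable_compose[OF borel_measurable_reindex]
  have m1: "(\<lambda>y. f (?s y) * indicator (G ` T) y) \<in> borel_measurable borel"
    using ms[OF meas1] by (simp add: iG)
  have m2: "(\<lambda>y. \<bar>det (matrix (G' y))\<bar> * f (?s (G y)) * indicator T y) \<in> borel_measurable borel"
    using ms[OF meas2] by (simp add: iT detG G)
  have eq: "(\<integral>\<^sup>+y\<in>G ` T. ennreal (f (?s y)) \<partial>lborel) =
    (\<integral>\<^sup>+y\<in>T. ennreal (\<bar>det (matrix (G' y))\<bar> * f (?s (G y))) \<partial>lborel)"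
    using nn_integral_change_of_variables_wellorder[of T G G' "f \<circ> ?s"] T derG injG m1 m2 nonneg
    by (simp add: G T_def)
  have "(\<integral>\<^sup>+x\<in>g ` S. ennreal (f x) \<partial>lborel) = (\<integral>\<^sup>+x. ennreal (f x * indicator (g ` S) x) \<partial>lborel)"
    by (intro nn_integral_cong) (auto simp: indicator_def)
  also have "\<dots> = (\<integral>\<^sup>+y. ennreal (f (?s y) * indicator (g ` S) (?s y)) \<partial>lborel)"
    using meas1 by (intro nn_integral_reindex[OF e', symmetric]) auto
  also have "\<dots> = (\<integral>\<^sup>+y\<in>G ` T. ennreal (f (?s y)) \<partial>lborel)"
    by (intro nn_integral_cong) (auto simp: indicator_def imG)
  also note eq
  also have "(\<integral>\<^sup>+y\<in>T. ennreal (\<bar>det (matrix (G' y))\<bar> * f (?s (G y))) \<partial>lborel)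
     = (\<integral>\<^sup>+y. ennreal (\<bar>det (matrix (g' (?s y)))\<bar> * f (g (?s y)) * indicator S (?s y)) \<partial>lborel)"
    by (intro nn_integral_cong) (auto simp: indicator_def T_def detG G)
  also have "\<dots> = (\<integral>\<^sup>+x. ennreal (\<bar>det (matrix (g' x))\<bar> * f (g x) * indicator S x) \<partial>lborel)"
    using meas2 by (intro nn_integral_reindex[OF e']) auto
  also have "\<dots> = (\<integral>\<^sup>+x\<in>S. ennreal (\<bar>det (matrix (g' x))\<bar> * f (g x)) \<partial>lborel)"
    by (intro nn_integral_cong) (auto simp: indicator_def)
  finally show ?thesis .
qed

section \<open>Riemannian measures from finite atlases\<close>

text \<open>Only continuity of \<open>\<tau>\<close> is known, and \<open>\<eta>\<close> may map
  into a space of larger dimension. Since \<open>A\<close> is injective, it is bounded below; the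
  expansion of \<open>\<eta>\<close> then shows first that \<open>\<tau>\<close> is Lipschitz at
  \<open>u\<close>, and second, after a left inverse \<open>A'\<close> is applied to the two
  expansions of \<open>f\<close>, that \<open>A' \<circ> B\<close> is the derivative.\<close>

lemma transition_has_derivative:
  fixes f :: "'a::euclidean_space \<Rightarrow> 'b::euclidean_space" and \<eta> :: "'c::euclidean_space \<Rightarrow> 'b"
  assumes \<eta>: "(\<eta> has_derivative A) (at (\<tau> u))" and inj: "inj A"
    and f: "(f has_derivative B) (at u)"
    and cont: "isCont \<tau> u"
    and eq: "\<forall>\<^sub>F x in nhds u. \<eta> (\<tau> x) = f x"
  obtains J where "(\<tau> has_derivative J) (at u)" "B = A \<circ> J"
proof -
  have linA: "linear A" and linB: "linear B"
    using \<eta> f has_derivative_linear by blast+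
  obtain c where c: "c > 0" "\<And>x. c * norm x \<le> norm (A x)"
    using linear_inj_bounded_below_pos[OF linA inj] by blast
  obtain A' where A': "linear A'" "A' \<circ> A = id"
    using linear_injective_left_inverse[OF linA inj] by blast
  obtain K where K: "K > 0" "\<And>x. norm (A' x) \<le> K * norm x"
    using linear_bounded_pos[OF A'(1)] by blast
  obtain b where b: "b > 0" "\<And>x. norm (B x) \<le> b * norm x"
    using linear_bounded_pos[OF linB] by blast
  define J where "J = A' \<circ> B"
  have linJ: "linear J" unfolding J_def using A'(1) linB linear_compose by blast
  have equ: "\<eta> (\<tau> u) = f u" using eq eventually_nhds_x_imp_x by blast
  have "(\<tau> has_derivative J) (at u)"
    unfolding has_derivative_at_alt
  proof (intro conjI allI impI)
    show "bounded_linear J" using linJ linear_conv_bounded_linear by blast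
    fix e :: real assume e: "e > 0"
    \<comment> \<open>\<open>c * norm \<Delta>\<close> will be at most
      \<open>(b + 1) * norm h\<close> plus \<open>c / 2 * norm \<Delta>\<close>; absorbing the last
      term gives this Lipschitz constant.\<close>
    define L where "L = (2 / c) * (b + 1)"
    have L: "L > 0" using c b by (auto simp: L_def)
    \<comment> \<open>The bound \<open>c / 2\<close> permits that absorption. The other bounds let
      each of the two errors use half of \<open>e\<close> after \<open>A'\<close>, which enlarges
      norms at most by \<open>K\<close>.\<close>
    define e1 where "e1 = min (c / 2) (e / (2 * K * L))"
    define e2 where "e2 = min 1 (e / (2 * K))"
    have e1: "e1 > 0" "e1 \<le> c / 2" "K * e1 * L \<le> e / 2"
    proof -
      show "e1 > 0" "e1 \<le> c / 2" using e c K L by (auto simp: e1_def)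
      have "e1 \<le> e / (2 * K * L)" by (simp add: e1_def)
      then show "K * e1 * L \<le> e / 2" using K L by (simp add: field_simps)
    qed
    have e2: "e2 > 0" "e2 \<le> 1" "K * e2 \<le> e / 2"
    proof -
      show "e2 > 0" "e2 \<le> 1" using e K by (auto simp: e2_def)
      have "e2 \<le> e / (2 * K)" by (simp add: e2_def)
      then show "K * e2 \<le> e / 2" using K by (simp add: field_simps)
    qed
    obtain d1 where d1: "d1 > 0"
      "\<And>y. norm (y - \<tau> u) < d1 \<Longrightarrow> norm (\<eta> y - \<eta> (\<tau> u) - A (y - \<tau> u)) \<le> e1 * norm (y - \<tau> u)"
      using \<eta> e1 unfolding has_derivative_at_alt by blast
    obtain d2 where d2: "d2 > 0"
      "\<And>y. norm (y - u) < d2 \<Longrightarrow> norm (f y - f u - B (y - u)) \<le> e2 * norm (y - u)"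
      using f e2 unfolding has_derivative_at_alt by blast
    obtain d3 where d3: "d3 > 0" "\<And>y. norm (y - u) < d3 \<Longrightarrow> norm (\<tau> y - \<tau> u) < d1"
      using cont d1(1) unfolding continuous_at_eps_delta by (auto simp: dist_norm)
    obtain d4 where d4: "d4 > 0" "\<And>y. norm (y - u) < d4 \<Longrightarrow> \<eta> (\<tau> y) = f y"
      using eq unfolding eventually_nhds_metric by (auto simp: dist_norm)
    show "\<exists>d>0. \<forall>y. norm (y - u) < d \<longrightarrow> norm (\<tau> y - \<tau> u - J (y - u)) \<le> e * norm (y - u)"
    proof (intro exI[of _ "min d2 (min d3 d4)"] conjI allI impI)
      show "0 < min d2 (min d3 d4)" using d2 d3 d4 by auto
      fix y assume y: "norm (y - u) < min d2 (min d3 d4)"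
      define \<Delta> where "\<Delta> = \<tau> y - \<tau> u"
      define h where "h = y - u"
      have 1: "norm (f y - f u - A \<Delta>) \<le> e1 * norm \<Delta>"
        using d1(2)[of "\<tau> y"] d3(2)[of y] d4(2)[of y] y equ by (simp add: \<Delta>_def)
      have 2: "norm (f y - f u - B h) \<le> e2 * norm h"
        using d2(2)[of y] y by (simp add: h_def)
      have "norm (A \<Delta>) \<le> norm (f y - f u) + norm (f y - f u - A \<Delta>)"
        by (metis norm_minus_commute norm_triangle_sub add.commute)
      moreover have "norm (f y - f u) \<le> norm (B h) + norm (f y - f u - B h)"
        by (metis norm_triangle_sub)
      moreover have "e1 * norm \<Delta> \<le> c / 2 * norm \<Delta>" "e2 * norm h \<le> 1 * norm h"
          using mult_right_mono[OF e1(2), of "norm \<Delta>"] mult_right_mono[OF e2(2), of "norm h"] by auto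
      ultimately have "c * norm \<Delta> \<le> b * norm h + norm h + c / 2 * norm \<Delta>"
        using c(2)[of \<Delta>] b(2)[of h] 1 2 by linarith
      then have \<Delta>: "norm \<Delta> \<le> L * norm h"
        using c(1) by (simp add: L_def field_simps)
      have "A' (A \<Delta>) = \<Delta>" using A'(2) by (metis comp_apply id_apply)
      then have "\<Delta> - J h = A' (A \<Delta> - B h)"
        using A'(1) by (simp add: J_def linear_diff)
      then have "norm (\<Delta> - J h) \<le> K * norm (A \<Delta> - B h)" using K(2) by simp
      also have "norm (A \<Delta> - B h) \<le> norm (f y - f u - A \<Delta>) + norm (f y - f u - B h)"
        using norm_triangle_ineq4[of "f y - f u - B h" "f y - f u - A \<Delta>"] by (simp add: add.commute)
      then have "K * norm (A \<Delta> - B h) \<le> K * (e1 * norm \<Delta> + e2 * norm h)"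
        using 1 2 K(1) by (intro mult_left_mono) auto
      also have "\<dots> \<le> K * (e1 * (L * norm h) + e2 * norm h)"
        using \<Delta> e1(1) K(1) by (intro mult_left_mono add_right_mono) auto
      also have "\<dots> = (K * e1 * L + K * e2) * norm h" by (simp add: algebra_simps)
      also have "\<dots> \<le> e * norm h" using e1(3) e2(3) by (intro mult_right_mono) auto
      finally show "norm (\<tau> y - \<tau> u - J (y - u)) \<le> e * norm (y - u)"
        by (simp add: \<Delta>_def h_def)
    qed
  qed
  moreover have "B = A \<circ> J"
  proof -
    have "((\<eta> \<circ> \<tau>) has_derivative (A \<circ> J)) (at u)"
      using diff_chain_at[OF calculation \<eta>] .
    moreover have "((\<eta> \<circ> \<tau>) has_derivative B) (at u)"
    proof (rule has_derivative_transform_eventually[OF f])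
      show "\<forall>\<^sub>F x in at u. f x = (\<eta> \<circ> \<tau>) x"
        using eq unfolding eventually_nhds_conv_at by (auto elim: eventually_mono)
    qed (use equ in auto)
    ultimately show ?thesis using has_derivative_unique by blast
  qed
  ultimately show ?thesis using that by blast
qed

lemma gram_matrix_transition:
  fixes \<phi> :: "real^'m \<Rightarrow> 'a::euclidean_space" and J :: "real^'m \<Rightarrow> real^'m"
  assumes bil: "bilinear (g (\<phi> u))" and p: "\<eta> v = \<phi> u"
    and lin: "linear J" "linear (frechet_derivative \<eta> (at v))"
    and eq: "frechet_derivative \<phi> (at u) = frechet_derivative \<eta> (at v) \<circ> J"
  shows "gram_matrix g \<phi> u = transpose (matrix J) ** gram_matrix g \<eta> v ** matrix J"
proof -
  let ?A = "frechet_derivative \<eta> (at v)" and ?G = "gram_matrix g \<eta> v" and ?M = "matrix J"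
  have J: "?A (J (axis i 1)) = (\<Sum>k\<in>UNIV. ?M $ k $ i *\<^sub>R ?A (axis k 1))" for i
  proof -
    have "J (axis i 1) = (\<Sum>k\<in>UNIV. J (axis i 1) $ k *\<^sub>R axis k 1)"
      by (simp add: vec_eq_iff axis_def if_distrib cong: if_cong)
    then have "?A (J (axis i 1)) = ?A (\<Sum>k\<in>UNIV. J (axis i 1) $ k *\<^sub>R axis k 1)" by simp
    then show ?thesis using lin(2) by (simp add: linear_sum linear_cmul matrix_def)
  qed
  show ?thesis
  proof (simp add: vec_eq_iff, intro allI)
    fix i j
    have "gram_matrix g \<phi> u $ i $ j = (\<Sum>k\<in>UNIV. \<Sum>l\<in>UNIV. (?M $ k $ i * ?M $ l $ j) * ?G $ k $ l)"
      unfolding gram_matrix_def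
      by (simp add: eq J p bilinear_sum[OF bil] bilinear_lmul[OF bil] bilinear_rmul[OF bil]
          sum.cartesian_product mult.assoc split_beta) (simp add: mult.left_commute)
    also have "\<dots> = (\<Sum>l\<in>UNIV. \<Sum>k\<in>UNIV. (?M $ k $ i * ?M $ l $ j) * ?G $ k $ l)"
      by (rule sum.swap)
    also have "\<dots> = (transpose ?M ** ?G ** ?M) $ i $ j"
      by (simp add: matrix_matrix_mult_def transpose_def sum_distrib_left sum_distrib_right mult_ac)
    finally show "gram_matrix g \<phi> u $ i $ j = (transpose ?M ** ?G ** ?M) $ i $ j" .
  qed
qed

definition riemannian_density ::
    "('a::euclidean_space \<Rightarrow> 'a \<Rightarrow> 'a \<Rightarrow> real) \<Rightarrow> (real^'m \<Rightarrow> 'a) \<Rightarrow> real^'m \<Rightarrow> real" where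
  "riemannian_density g \<phi> u = sqrt (det (gram_matrix g \<phi> u))"

text \<open>Congruence by \<open>matrix J\<close> multiplies the Gram determinant by the square of
  \<open>det (matrix J)\<close>, which leaves the root as an absolute value.\<close>

lemma riemannian_density_transition:
  fixes \<phi> :: "real^'m \<Rightarrow> 'a::euclidean_space" and J :: "real^'m \<Rightarrow> real^'m"
  assumes "bilinear (g (\<phi> u))" "\<eta> v = \<phi> u" "linear J" "linear (frechet_derivative \<eta> (at v))"
    and "frechet_derivative \<phi> (at u) = frechet_derivative \<eta> (at v) \<circ> J"
  shows "riemannian_density g \<phi> u = \<bar>det (matrix J)\<bar> * riemannian_density g \<eta> v"
  unfolding riemannian_density_def gram_matrix_transition[where g=g and \<phi>=\<phi> and u=u and \<eta>=\<eta> and v=v and J=J, OF assms]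
  by (simp add: det_mul real_sqrt_mult)

lemma continuous_on_det:
  fixes A :: "'a::topological_space \<Rightarrow> real^'n^'n"
  assumes "\<And>i j. continuous_on S (\<lambda>x. A x $ i $ j)"
  shows "continuous_on S (\<lambda>x. det (A x))"
  unfolding det_def by (intro continuous_intros assms)

lemma local_parametrisation_subset: "local_parametrisation N U \<phi> \<Longrightarrow> \<phi> ` U \<subseteq> N"
  unfolding local_parametrisation_def openin_contains_ball by auto

lemma local_parametrisation_has_derivative:
  assumes "local_parametrisation N U \<phi>" "u \<in> U"
  shows "(\<phi> has_derivative frechet_derivative \<phi> (at u)) (at u)"
    "inj (frechet_derivative \<phi> (at u))" "linear (frechet_derivative \<phi> (at u))"
  using assms unfolding local_parametrisation_def
  by (auto simp: frechet_derivative_works[symmetric] intro: linear_frechet_derivative)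

text \<open>Continuity of \<open>g\<close> is available for fixed vectors. The varying tangent
  vectors are therefore expanded in \<open>Basis\<close>, which makes each Gram entry a finite sum
  of products of continuous functions.\<close>

lemma continuous_on_riemannian_density:
  fixes \<phi> :: "real^'m \<Rightarrow> 'a::euclidean_space"
  assumes \<phi>: "local_parametrisation N U \<phi>"
    and bil: "\<And>p. p \<in> N \<Longrightarrow> bilinear (g p)"
    and cont: "\<And>v w. continuous_on N (\<lambda>p. g p v w)"
  shows "continuous_on U (riemannian_density g \<phi>)"
proof -
  have c\<phi>: "continuous_on U \<phi>"
    using \<phi> unfolding local_parametrisation_def homeomorphism_def by blast
  note sub = local_parametrisation_subset[OF \<phi>]
  have cd: "continuous_on U (\<lambda>u. frechet_derivative \<phi> (at u) h)" for h
    using \<phi> unfolding local_parametrisation_def by blast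
  have cg: "continuous_on U (\<lambda>u. g (\<phi> u) v w)" for v w
    using continuous_on_compose2[OF cont c\<phi> sub] .
  have "continuous_on U (\<lambda>u. gram_matrix g \<phi> u $ i $ j)" for i j
  proof -
    let ?v = "\<lambda>u i. frechet_derivative \<phi> (at u) (axis i 1)"
    have "g (\<phi> u) (?v u i) (?v u j) = (\<Sum>(b, b')\<in>Basis \<times> Basis. (?v u i \<bullet> b) * ((?v u j \<bullet> b') * g (\<phi> u) b b'))"
      if "u \<in> U" for u
    proof -
      have b: "bilinear (g (\<phi> u))" using bil sub that by blast
      have "g (\<phi> u) (?v u i) (?v u j) = g (\<phi> u) (\<Sum>b\<in>Basis. (?v u i \<bullet> b) *\<^sub>R b) (\<Sum>b\<in>Basis. (?v u j \<bullet> b) *\<^sub>R b)"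
        by (simp add: euclidean_representation)
      also have "\<dots> = (\<Sum>(b, b')\<in>Basis \<times> Basis. (?v u i \<bullet> b) * ((?v u j \<bullet> b') * g (\<phi> u) b b'))"
        unfolding bilinear_sum[OF b]
        by (intro sum.cong refl) (auto simp: bilinear_lmul[OF b] bilinear_rmul[OF b])
      finally show ?thesis .
    qed
    moreover have "continuous_on U (\<lambda>u. (\<Sum>(b, b')\<in>Basis \<times> Basis. (?v u i \<bullet> b) * ((?v u j \<bullet> b') * g (\<phi> u) b b')))"
      unfolding split_beta by (intro continuous_intros cd cg)
    ultimately show ?thesis unfolding gram_matrix_def by (simp cong: continuous_on_cong)
  qed
  then show ?thesis
    unfolding riemannian_density_def by (intro continuous_on_real_sqrt continuous_on_det)
qed

text \<open>A parametrisation has a continuous inverse on its relatively open image, so images of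
  Borel sets are preimages under that inverse.\<close>

lemma local_parametrisation_image_borel:
  fixes \<phi> :: "real^'m \<Rightarrow> 'a::euclidean_space"
  assumes \<phi>: "local_parametrisation N U \<phi>" and B: "B \<in> sets borel" "B \<subseteq> U"
  shows "\<phi> ` B \<in> sets (restrict_space borel N)"
proof -
  obtain \<psi> where hom: "homeomorphism U (\<phi> ` U) \<phi> \<psi>"
    using \<phi> unfolding local_parametrisation_def by blast
  obtain T where T: "open T" "\<phi> ` U = N \<inter> T"
    using \<phi> unfolding local_parametrisation_def openin_open by blast
  have "\<psi> \<in> borel_measurable (restrict_space borel (\<phi> ` U))"
    using hom by (intro borel_measurable_continuous_on_restrict) (auto simp: homeomorphism_def)
  then have "\<psi> -` B \<inter> space (restrict_space borel (\<phi> ` U)) \<in> sets (restrict_space borel (\<phi> ` U))"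
    using B(1) by (rule measurable_sets)
  moreover have "\<psi> -` B \<inter> \<phi> ` U = \<phi> ` B"
    using hom B by (auto simp: homeomorphism_def)
  ultimately have "\<phi> ` B \<in> sets (restrict_space borel (\<phi> ` U))"
    by (simp add: space_restrict_space)
  then obtain C where C: "C \<in> sets borel" "\<phi> ` B = \<phi> ` U \<inter> C"
    by (auto simp: sets_restrict_space)
  then show ?thesis using T by (auto simp: sets_restrict_space image_iff intro!: bexI[of _ "T \<inter> C"])
qed

lemma local_parametrisation_vimage_borel:
  fixes \<phi> :: "real^'m \<Rightarrow> 'a::euclidean_space"
  assumes \<phi>: "local_parametrisation N U \<phi>" and A: "A \<in> sets (restrict_space borel N)"
  shows "{u \<in> U. \<phi> u \<in> A} \<in> sets borel"
proof -
  obtain C where C: "C \<in> sets borel" "A = N \<inter> C" using A by (auto simp: sets_restrict_space)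
  have U: "open U" using \<phi> unfolding local_parametrisation_def by blast
  have "continuous_on U \<phi>" using \<phi> unfolding local_parametrisation_def homeomorphism_def by blast
  then have "\<phi> \<in> borel_measurable (restrict_space borel U)"
    by (rule borel_measurable_continuous_on_restrict)
  then have "\<phi> -` C \<inter> space (restrict_space borel U) \<in> sets (restrict_space borel U)"
    using C by (auto intro: measurable_sets)
  moreover have "\<phi> -` C \<inter> U = {u \<in> U. \<phi> u \<in> A}"
    using local_parametrisation_subset[OF \<phi>] C by auto
  ultimately show ?thesis using U
    by (auto simp: space_restrict_space sets_restrict_space)
qed

lemma openin_borel_restrict: "openin (top_of_set N) A \<Longrightarrow> A \<in> sets (restrict_space borel N)"
  unfolding openin_open sets_restrict_space by (metis borel_open image_eqI)

text \<open>Both integrals describe the same subset of the manifold. The transition map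
  \<open>\<psi> \<circ> \<phi>\<close> is differentiable on the open set \<open>W\<close>, and its
  Jacobian determinant converts one density into the other, so the equation is the substitution
  rule.\<close>

lemma riemannian_density_change_of_charts:
  fixes \<phi> \<eta> :: "real^'m \<Rightarrow> 'a::euclidean_space"
  assumes \<phi>: "local_parametrisation N U \<phi>" and \<eta>: "local_parametrisation N V \<eta>"
    and bil: "\<And>p. p \<in> N \<Longrightarrow> bilinear (g p)"
    and cont: "\<And>v w. continuous_on N (\<lambda>p. g p v w)"
    and B: "B \<in> sets borel" "B \<subseteq> U" and sub: "\<phi> ` B \<subseteq> \<eta> ` V"
  shows "(\<integral>\<^sup>+u\<in>B. ennreal (riemannian_density g \<phi> u) \<partial>lborel) =
    (\<integral>\<^sup>+v\<in>{v \<in> V. \<eta> v \<in> \<phi> ` B}. ennreal (riemannian_density g \<eta> v) \<partial>lborel)"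
proof -
  obtain \<psi> where hom: "homeomorphism V (\<eta> ` V) \<eta> \<psi>"
    using \<eta> unfolding local_parametrisation_def by blast
  have c\<phi>: "continuous_on U \<phi>" and injphi: "inj_on \<phi> U" and U: "open U"
    using \<phi> unfolding local_parametrisation_def homeomorphism_def by (blast, metis inj_on_inverseI, blast)
  have c\<psi>: "continuous_on (\<eta> ` V) \<psi>" and inv: "\<And>v. v \<in> V \<Longrightarrow> \<psi> (\<eta> v) = v"
    and inv': "\<And>p. p \<in> \<eta> ` V \<Longrightarrow> \<eta> (\<psi> p) = p" and imV: "\<And>p. p \<in> \<eta> ` V \<Longrightarrow> \<psi> p \<in> V"
    using hom by (auto simp: homeomorphism_def)
  have V: "open V" using \<eta> unfolding local_parametrisation_def by blast
  define \<tau> where "\<tau> = \<psi> \<circ> \<phi>"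
  define W where "W = {u \<in> U. \<phi> u \<in> \<eta> ` V}"
  have BW: "B \<subseteq> W" using B sub by (auto simp: W_def)
  have "openin (top_of_set N) (\<eta> ` V)" using \<eta> unfolding local_parametrisation_def by blast
  then obtain T where T: "open T" "\<eta> ` V = N \<inter> T" unfolding openin_open by blast
  have "W = U \<inter> \<phi> -` T" using T local_parametrisation_subset[OF \<phi>] by (auto simp: W_def)
  then have W: "open W" using c\<phi> U T continuous_open_preimage by blast
  have c\<tau>: "continuous_on W \<tau>"
    unfolding \<tau>_def by (rule continuous_on_compose)
      (auto intro: continuous_on_subset[OF c\<phi>] continuous_on_subset[OF c\<psi>] simp: W_def)
  have \<eta>\<tau>: "\<eta> (\<tau> u) = \<phi> u" "\<tau> u \<in> V" if "u \<in> W" for u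
    using that inv' imV by (auto simp: \<tau>_def W_def)
  have "\<exists>J. (\<tau> has_derivative J) (at u) \<and>
      riemannian_density g \<phi> u = \<bar>det (matrix J)\<bar> * riemannian_density g \<eta> (\<tau> u)" if u: "u \<in> W" for u
  proof -
    have uU: "u \<in> U" using u by (simp add: W_def)
    note dphi = local_parametrisation_has_derivative[OF \<phi> uU]
    note dchi = local_parametrisation_has_derivative[OF \<eta> \<eta>\<tau>(2)[OF u]]
    have "isCont \<tau> u" using c\<tau> W u continuous_on_eq_continuous_at by blast
    moreover have "\<forall>\<^sub>F x in nhds u. \<eta> (\<tau> x) = \<phi> x"
      using eventually_nhds_in_open[OF W u] by eventually_elim (rule \<eta>\<tau>(1))
    ultimately obtain J where J: "(\<tau> has_derivative J) (at u)"
      "frechet_derivative \<phi> (at u) = frechet_derivative \<eta> (at (\<tau> u)) \<circ> J"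
      using transition_has_derivative[where \<tau>=\<tau> and u=u, OF dchi(1,2) dphi(1)] by blast
    have "\<phi> u \<in> N" using local_parametrisation_subset[OF \<phi>] uU by blast
    then have "bilinear (g (\<phi> u))" by (rule bil)
    from riemannian_density_transition[where g=g and \<phi>=\<phi> and u=u and \<eta>=\<eta> and v="\<tau> u" and J=J, OF this \<eta>\<tau>(1)[OF u] has_derivative_linear[OF J(1)] dchi(3) J(2)] J(1)
    show ?thesis by blast
  qed
  then obtain J where J: "\<And>u. u \<in> W \<Longrightarrow> (\<tau> has_derivative J u) (at u)"
    "\<And>u. u \<in> W \<Longrightarrow> riemannian_density g \<phi> u = \<bar>det (matrix (J u))\<bar> * riemannian_density g \<eta> (\<tau> u)"
    by metis
  have im: "\<tau> ` B = {v \<in> V. \<eta> v \<in> \<phi> ` B}"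
  proof (intro set_eqI iffI)
    fix v assume "v \<in> \<tau> ` B"
    then show "v \<in> {v \<in> V. \<eta> v \<in> \<phi> ` B}" using BW \<eta>\<tau> by auto
  next
    fix v assume "v \<in> {v \<in> V. \<eta> v \<in> \<phi> ` B}"
    then obtain u where "u \<in> B" "v \<in> V" "\<eta> v = \<phi> u" by auto
    then have "v = \<tau> u" using inv by (metis \<tau>_def comp_apply)
    then show "v \<in> \<tau> ` B" using \<open>u \<in> B\<close> by blast
  qed
  have imB: "\<tau> ` B \<in> sets borel"
    unfolding im by (rule local_parametrisation_vimage_borel[OF \<eta> local_parametrisation_image_borel[OF \<phi> B]])
  have inj: "inj_on \<tau> B"
    using injphi \<eta>\<tau>(1) BW B(2) unfolding inj_on_def by (metis subsetD)
  \<comment> \<open>\<open>g\<close> is not assumed positive, and the root of a negative determinant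
    is negative here. Truncation at 0 restores the nonnegativity that the substitution rule asks for
    and is invisible to \<open>ennreal\<close>.\<close>
  have pos: "ennreal (max 0 (riemannian_density g \<phi> u)) = ennreal (riemannian_density g \<phi> u)"
    "ennreal (max 0 (riemannian_density g \<eta> u)) = ennreal (riemannian_density g \<eta> u)" for u
    by (simp_all add: ennreal_max_0)
  have cont_meas: "(\<lambda>x. max 0 (riemannian_density g \<theta> x) * indicator C x) \<in> borel_measurable borel"
    if \<theta>: "local_parametrisation N O' \<theta>" and C: "C \<in> sets borel" "C \<subseteq> O'" for \<theta> :: "real^'m \<Rightarrow> 'a" and O' C
  proof -
    have "(\<lambda>x. indicator C x *\<^sub>R max 0 (riemannian_density g \<theta> x)) \<in> borel_measurable borel"
      using continuous_on_riemannian_density[OF \<theta> bil cont]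
      by (intro borel_measurable_continuous_on_indicator C(1))
        (auto intro!: continuous_intros intro: continuous_on_subset[OF _ C(2)])
    then show ?thesis by (simp add: mult.commute)
  qed
  have max: "max 0 (riemannian_density g \<phi> u) = \<bar>det (matrix (J u))\<bar> * max 0 (riemannian_density g \<eta> (\<tau> u))"
    if "u \<in> W" for u
    using J(2)[OF that] by (simp add: max_def mult_le_0_iff zero_le_mult_iff)
  have "(\<integral>\<^sup>+v\<in>\<tau> ` B. ennreal (max 0 (riemannian_density g \<eta> v)) \<partial>lborel) =
      (\<integral>\<^sup>+u\<in>B. ennreal (\<bar>det (matrix (J u))\<bar> * max 0 (riemannian_density g \<eta> (\<tau> u))) \<partial>lborel)"
  proof (rule nn_integral_change_of_variables[OF B(1) _ inj])
    show "(\<tau> has_derivative J u) (at u)" if "u \<in> B" for u using that BW J(1) by blast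
    show "(\<lambda>x. max 0 (riemannian_density g \<eta> x) * indicator (\<tau> ` B) x) \<in> borel_measurable borel"
      using im by (intro cont_meas[OF \<eta> imB]) auto
    \<comment> \<open>Measurability of the Jacobian factor is not known by itself; on
      \<open>B\<close> the whole product equals the truncated density of \<open>\<phi>\<close>,
      which is continuous there.\<close>
    have "(\<lambda>u. max 0 (riemannian_density g \<phi> u) * indicator B u) \<in> borel_measurable borel"
      by (rule cont_meas[OF \<phi> B])
    also have "(\<lambda>u. max 0 (riemannian_density g \<phi> u) * indicator B u) =
       (\<lambda>x. \<bar>det (matrix (J x))\<bar> * max 0 (riemannian_density g \<eta> (\<tau> x)) * indicator B x)"
      using max BW by (auto simp: fun_eq_iff indicator_def)
    finally show "(\<lambda>x. \<bar>det (matrix (J x))\<bar> * max 0 (riemannian_density g \<eta> (\<tau> x)) * indicator B x)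
        \<in> borel_measurable borel" .
  qed auto
  also have "\<dots> = (\<integral>\<^sup>+u\<in>B. ennreal (max 0 (riemannian_density g \<phi> u)) \<partial>lborel)"
  proof (rule nn_integral_cong)
    fix x
    show "ennreal (\<bar>det (matrix (J x))\<bar> * max 0 (riemannian_density g \<eta> (\<tau> x))) * indicator B x
      = ennreal (max 0 (riemannian_density g \<phi> x)) * indicator B x"
    proof (cases "x \<in> B")
      case True
      then have "x \<in> W" using BW by blast
      then show ?thesis by (simp only: max)
    qed simp
  qed
  finally show ?thesis by (simp only: pos im)
qed

section \<open>Existence and uniqueness of the Riemannian measure\<close>

locale riemannian_atlas =
  fixes g :: "'a::euclidean_space \<Rightarrow> 'a \<Rightarrow> 'a \<Rightarrow> real" and N :: "'a set"
    and K :: nat and U :: "nat \<Rightarrow> (real^'m) set" and \<phi> :: "nat \<Rightarrow> real^'m \<Rightarrow> 'a"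
  assumes bil: "\<And>p. p \<in> N \<Longrightarrow> bilinear (g p)"
    and cont: "\<And>v w. continuous_on N (\<lambda>p. g p v w)"
    and charts: "\<And>k. k < K \<Longrightarrow> local_parametrisation N (U k) (\<phi> k)"
    and cover: "N \<subseteq> (\<Union>k<K. \<phi> k ` U k)"
begin

text \<open>Disjointification: a point of \<open>A\<close> is counted only in the first patch that
  contains it.\<close>

definition piece :: "nat \<Rightarrow> 'a set \<Rightarrow> (real^'m) set" where
  "piece k A = {u \<in> U k. \<phi> k u \<in> A \<and> (\<forall>j<k. \<phi> k u \<notin> \<phi> j ` U j)}"

definition volume :: "'a set \<Rightarrow> ennreal" where
  "volume A = (\<Sum>k<K. \<integral>\<^sup>+u\<in>piece k A. ennreal (riemannian_density g (\<phi> k) u) \<partial>lborel)"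

lemma patch_borel: "k < K \<Longrightarrow> \<phi> k ` U k \<in> sets (restrict_space borel N)"
  using charts[of k] unfolding local_parametrisation_def by (blast intro: openin_borel_restrict)

lemma cell_borel:
  assumes "A \<in> sets (restrict_space borel N)" "k < K"
  shows "A \<inter> {p \<in> N. \<forall>j<k. p \<notin> \<phi> j ` U j} \<in> sets (restrict_space borel N)"
proof -
  have "A - (\<Union>j<k. \<phi> j ` U j) \<in> sets (restrict_space borel N)"
    using assms patch_borel by (intro sets.Diff sets.finite_UN) auto
  moreover have "A - (\<Union>j<k. \<phi> j ` U j) = A \<inter> {p \<in> N. \<forall>j<k. p \<notin> \<phi> j ` U j}"
    using sets.sets_into_space[OF assms(1)] by (auto simp: space_restrict_space)
  ultimately show ?thesis by simp
qed

lemma piece_borel: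
  assumes "A \<in> sets (restrict_space borel N)" "k < K"
  shows "piece k A \<in> sets borel"
proof -
  have "piece k A = {u \<in> U k. \<phi> k u \<in> A \<inter> {p \<in> N. \<forall>j<k. p \<notin> \<phi> j ` U j}}"
    using local_parametrisation_subset[OF charts[OF assms(2)]] by (auto simp: piece_def)
  then show ?thesis
    using local_parametrisation_vimage_borel[OF charts[OF assms(2)] cell_borel[OF assms]] by simp
qed

lemma first_patch:
  assumes "p \<in> N"
  obtains k where "k < K" "p \<in> \<phi> k ` U k" "\<And>j. j < k \<Longrightarrow> p \<notin> \<phi> j ` U j"
proof -
  let ?P = "\<lambda>k. k < K \<and> p \<in> \<phi> k ` U k"
  have "\<exists>k. ?P k" using assms cover by blast
  then have 1: "?P (LEAST k. ?P k)" by (rule LeastI_ex)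
  have "p \<notin> \<phi> j ` U j" if "j < (LEAST k. ?P k)" for j
    using not_less_Least[OF that] 1 that by (meson order_less_trans)
  then show ?thesis using that 1 by blast
qed

text \<open>This is the existence half. For an arbitrary parametrisation, the parameter set
  \<open>B\<close> is cut according to the first patch that its points hit, and on each part the
  change of charts applies.\<close>

lemma volume_is_riemannian_measure:
  "is_riemannian_measure g TYPE('m) N (measure_of N (sets (restrict_space borel N)) volume)"
    (is "is_riemannian_measure _ _ _ ?\<mu>")
proof -
  let ?S = "sets (restrict_space borel N)"
  let ?\<rho> = "\<lambda>k u. ennreal (riemannian_density g (\<phi> k) u * indicator (U k) u)"
  let ?D = "\<lambda>k. density lborel (?\<rho> k)"
  have sub: "?S \<subseteq> Pow N" using sets.sets_into_space by (fastforce simp: space_restrict_space)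
  have sig: "sigma_algebra N ?S"
    using sets.sigma_algebra_axioms[of "restrict_space borel N"] by (simp add: space_restrict_space)
  have meas: "(\<lambda>u. riemannian_density g (\<phi> k) u * indicator (U k) u) \<in> borel_measurable borel" if "k < K" for k
  proof -
    have "U k \<in> sets borel" using charts[OF that] by (simp add: local_parametrisation_def)
    then have "(\<lambda>u. indicator (U k) u *\<^sub>R riemannian_density g (\<phi> k) u) \<in> borel_measurable borel"
      using continuous_on_riemannian_density[OF charts[OF that] bil cont]
      by (rule borel_measurable_continuous_on_indicator)
    then show ?thesis by (simp add: mult.commute)
  qed
  \<comment> \<open>Extended by 0 outside \<open>U k\<close>, the density is measurable on the whole
    parameter space and defines a measure there, from which countable additivity is
    inherited.\<close>
  have vol: "volume A = (\<Sum>k<K. emeasure (?D k) (piece k A))" if "A \<in> ?S" for A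
    unfolding volume_def
  proof (rule sum.cong[OF refl])
    fix k assume "k \<in> {..<K}"
    then have k: "k < K" by simp
    have "emeasure (?D k) (piece k A) = (\<integral>\<^sup>+u\<in>piece k A. ?\<rho> k u \<partial>lborel)"
      using meas[OF k] piece_borel[OF that k] by (intro emeasure_density) auto
    also have "\<dots> = (\<integral>\<^sup>+u\<in>piece k A. ennreal (riemannian_density g (\<phi> k) u) \<partial>lborel)"
      by (intro nn_integral_cong) (auto simp: indicator_def piece_def)
    finally show "(\<integral>\<^sup>+u\<in>piece k A. ennreal (riemannian_density g (\<phi> k) u) \<partial>lborel) = emeasure (?D k) (piece k A)"
      by simp
  qed
  have ca: "countably_additive ?S volume"
  proof (rule countably_additiveI)
    fix A :: "nat \<Rightarrow> 'a set" assume A: "range A \<subseteq> ?S" "disjoint_family A" "(\<Union>i. A i) \<in> ?S"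
    have "(\<Sum>i. volume (A i)) = (\<Sum>i. \<Sum>k<K. emeasure (?D k) (piece k (A i)))"
      using A by (intro suminf_cong vol) auto
    also have "\<dots> = (\<Sum>k<K. \<Sum>i. emeasure (?D k) (piece k (A i)))"
      by (rule suminf_sum) simp
    also have "\<dots> = (\<Sum>k<K. emeasure (?D k) (piece k (\<Union>i. A i)))"
    proof (rule sum.cong[OF refl])
      fix k assume "k \<in> {..<K}"
      then have "range (\<lambda>i. piece k (A i)) \<subseteq> sets (?D k)"
        using A(1) piece_borel by auto
      moreover have "disjoint_family (\<lambda>i. piece k (A i))"
        using A(2) by (auto simp: disjoint_family_on_def piece_def)
      ultimately have "(\<Sum>i. emeasure (?D k) (piece k (A i))) = emeasure (?D k) (\<Union>i. piece k (A i))"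
        by (rule suminf_emeasure)
      also have "(\<Union>i. piece k (A i)) = piece k (\<Union>i. A i)" by (auto simp: piece_def)
      finally show "(\<Sum>i. emeasure (?D k) (piece k (A i))) = emeasure (?D k) (piece k (\<Union>i. A i))" .
    qed
    finally show "(\<Sum>i. volume (A i)) = volume (\<Union>i. A i)" using vol[OF A(3)] by simp
  qed
  have "volume {} = 0" by (simp add: volume_def piece_def)
  then have emeas: "emeasure ?\<mu> A = volume A" if "A \<in> ?S" for A
    using emeasure_measure_of_sigma[OF sig _ ca that] by (simp add: positive_def)
  have sets: "sets ?\<mu> = ?S" using sub by (simp add: sets_measure_of sigma_algebra.sigma_sets_eq[OF sig])
  show ?thesis unfolding is_riemannian_measure_def
  proof (intro conjI allI impI ballI)
    show "sets ?\<mu> = ?S" by (rule sets)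
    fix V :: "(real^'m) set" and \<eta> B
    assume \<eta>: "local_parametrisation N V \<eta>" and B: "B \<in> sets borel" "B \<subseteq> V"
    let ?r = "\<lambda>u. ennreal (riemannian_density g \<eta> u)"
    define C where "C k = {u \<in> B. \<eta> u \<in> \<phi> k ` U k \<and> (\<forall>j<k. \<eta> u \<notin> \<phi> j ` U j)}" for k
    have im: "\<eta> ` B \<in> ?S" by (rule local_parametrisation_image_borel[OF \<eta> B])
    have Cb: "C k \<in> sets borel" if k: "k < K" for k
    proof -
      have "C k = B \<inter> {u \<in> V. \<eta> u \<in> \<phi> k ` U k \<inter> {p \<in> N. \<forall>j<k. p \<notin> \<phi> j ` U j}}"
        using B local_parametrisation_subset[OF \<eta>] by (auto simp: C_def)
      then show ?thesis
        using local_parametrisation_vimage_borel[OF \<eta> cell_borel[OF patch_borel[OF k] k]] B by simp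
    qed
    have "emeasure ?\<mu> (\<eta> ` B) = (\<Sum>k<K. \<integral>\<^sup>+u\<in>piece k (\<eta> ` B). ennreal (riemannian_density g (\<phi> k) u) \<partial>lborel)"
      unfolding emeas[OF im] volume_def ..
    also have "\<dots> = (\<Sum>k<K. \<integral>\<^sup>+u\<in>C k. ?r u \<partial>lborel)"
    proof (rule sum.cong[OF refl])
      fix k assume "k \<in> {..<K}"
      then have k: "k < K" by simp
      have "piece k (\<eta> ` B) = {v \<in> U k. \<phi> k v \<in> \<eta> ` C k}"
      proof -
        define Q where "Q p \<longleftrightarrow> (\<forall>j<k. p \<notin> \<phi> j ` U j)" for p
        have "p \<in> \<eta> ` C k \<longleftrightarrow> p \<in> \<eta> ` B \<and> p \<in> \<phi> k ` U k \<and> Q p" for p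
          unfolding C_def Q_def[symmetric] by blast
        then show ?thesis unfolding piece_def Q_def[symmetric] by auto
      qed
      moreover have "C k \<subseteq> V" "\<eta> ` C k \<subseteq> \<phi> k ` U k" using B by (auto simp: C_def)
      ultimately show "(\<integral>\<^sup>+u\<in>piece k (\<eta> ` B). ennreal (riemannian_density g (\<phi> k) u) \<partial>lborel)
          = (\<integral>\<^sup>+u\<in>C k. ?r u \<partial>lborel)"
        using riemannian_density_change_of_charts[OF \<eta> charts[OF k] bil cont Cb[OF k]] by simp
    qed
    also have "\<dots> = (\<integral>\<^sup>+u. (\<Sum>k<K. ?r u * indicator (C k) u) \<partial>lborel)"
    proof (rule nn_integral_sum[symmetric])
      fix k assume "k \<in> {..<K}"
      then have "C k \<in> sets borel" "C k \<subseteq> V" using Cb B by (auto simp: C_def)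
      then have "(\<lambda>u. indicator (C k) u *\<^sub>R riemannian_density g \<eta> u) \<in> borel_measurable borel"
        using continuous_on_subset[OF continuous_on_riemannian_density[OF \<eta> bil cont]]
        by (intro borel_measurable_continuous_on_indicator) auto
      then have "(\<lambda>u. ennreal (indicator (C k) u *\<^sub>R riemannian_density g \<eta> u)) \<in> borel_measurable lborel"
        by simp
      also have "(\<lambda>u. ennreal (indicator (C k) u *\<^sub>R riemannian_density g \<eta> u)) = (\<lambda>u. ?r u * indicator (C k) u)"
        by (auto simp: indicator_def fun_eq_iff)
      finally show "(\<lambda>u. ?r u * indicator (C k) u) \<in> borel_measurable lborel" .
    qed
    also have "\<dots> = (\<integral>\<^sup>+u\<in>B. ?r u \<partial>lborel)"
    proof (rule nn_integral_cong)
      fix u :: "real^'m"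
      show "(\<Sum>k<K. ?r u * indicator (C k) u) = ?r u * indicator B u"
      proof (cases "u \<in> B")
        case True
        then have "\<eta> u \<in> N" using B local_parametrisation_subset[OF \<eta>] by auto
        then obtain k where k: "k < K" "\<eta> u \<in> \<phi> k ` U k" "\<And>j. j < k \<Longrightarrow> \<eta> u \<notin> \<phi> j ` U j"
          using first_patch by blast
        have "u \<in> C i \<longleftrightarrow> i = k" for i
          unfolding C_def using True k(2,3) linorder_neqE_nat[of i k] by blast
        then have "?r u * indicator (C i) u = (if i = k then ?r u else 0)" for i
          by (simp add: indicator_def)
        then show ?thesis using k(1) True by simp
      qed (simp add: C_def indicator_def)
    qed
    finally show "emeasure ?\<mu> (\<eta> ` B) = (\<integral>\<^sup>+u\<in>B. ennreal (sqrt (det (gram_matrix g \<eta> u))) \<partial>lborel)"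
      by (simp add: riemannian_density_def)
  qed
qed

text \<open>This is the uniqueness half: \<open>A\<close> is a finite disjoint union of images of
  Borel pieces under parametrisations, and on such images the value is prescribed.\<close>

lemma riemannian_measure_eq_volume:
  assumes \<mu>: "is_riemannian_measure g TYPE('m) N \<mu>" and A: "A \<in> sets \<mu>"
  shows "emeasure \<mu> A = volume A"
proof -
  have sets: "sets \<mu> = sets (restrict_space borel N)" using \<mu> by (simp add: is_riemannian_measure_def)
  note A' = A[unfolded sets]
  have AN: "A \<subseteq> N" using sets.sets_into_space[OF A'] by (auto simp: space_restrict_space)
  have "A = (\<Union>k<K. \<phi> k ` piece k A)"
  proof (intro subset_antisym subsetI)
    fix p assume p: "p \<in> A"
    then show "p \<in> (\<Union>k<K. \<phi> k ` piece k A)"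
    proof -
      obtain k where k: "k < K" "p \<in> \<phi> k ` U k" "\<And>j. j < k \<Longrightarrow> p \<notin> \<phi> j ` U j"
        using first_patch[of p] AN p by blast
      then obtain u where "u \<in> U k" "p = \<phi> k u" by blast
      then have "p \<in> \<phi> k ` piece k A" using k(3) p by (simp add: piece_def)
      then show ?thesis using k(1) by blast
    qed
  qed (auto simp: piece_def)
  moreover have "emeasure \<mu> (\<Union>k<K. \<phi> k ` piece k A) = (\<Sum>k<K. emeasure \<mu> (\<phi> k ` piece k A))"
  proof (rule sum_emeasure[symmetric])
    show "(\<lambda>k. \<phi> k ` piece k A) ` {..<K} \<subseteq> sets \<mu>"
      using local_parametrisation_image_borel[OF charts piece_borel[OF A']]
      by (auto simp: sets piece_def)
    have "\<phi> j ` piece j A \<inter> \<phi> k ` piece k A = {}" if "j < k" for j k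
    proof -
      have "\<phi> j ` piece j A \<subseteq> \<phi> j ` U j" "\<phi> k ` piece k A \<inter> \<phi> j ` U j = {}"
        using that by (auto simp: piece_def)
      then show ?thesis by blast
    qed
    then show "disjoint_family_on (\<lambda>k. \<phi> k ` piece k A) {..<K}"
      unfolding disjoint_family_on_def by (metis inf_commute linorder_neqE_nat)
  qed auto
  moreover have "emeasure \<mu> (\<phi> k ` piece k A) =
      (\<integral>\<^sup>+u\<in>piece k A. ennreal (riemannian_density g (\<phi> k) u) \<partial>lborel)" if "k < K" for k
    using \<mu> charts[OF that] piece_borel[OF A' that]
    unfolding is_riemannian_measure_def riemannian_density_def by (auto simp: piece_def)
  ultimately show ?thesis by (simp add: volume_def)
qed

text \<open>Existence and uniqueness together give the definite description its intended
  value.\<close>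

theorem riemannian_volume_eq:
  "riemannian_volume g TYPE('m) N = volume N"
proof -
  let ?P = "\<lambda>\<mu>. is_riemannian_measure g TYPE('m) N \<mu>"
  have "\<mu> = \<nu>" if "?P \<mu>" "?P \<nu>" for \<mu> \<nu>
    using that riemannian_measure_eq_volume
    by (intro measure_eqI) (auto simp: is_riemannian_measure_def)
  then have P: "?P (THE \<mu>. ?P \<mu>)"
    using theI'[of ?P] volume_is_riemannian_measure by blast
  then have "sets (THE \<mu>. ?P \<mu>) = sets (restrict_space borel N)"
    by (simp add: is_riemannian_measure_def)
  moreover have "N \<in> sets (restrict_space borel N)"
    using sets.top[of "restrict_space borel N"] by (simp add: space_restrict_space)
  ultimately show ?thesis
    unfolding riemannian_volume_def using riemannian_measure_eq_volume[OF P] by simp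
qed

end

section \<open>Matrix algebra and calculus\<close>

lemma matrix_diff_ldistrib: "A ** (B - C) = A ** B - A ** (C :: 'a::ring_1^'n^'m)"
  by (simp add: matrix_matrix_mult_def vec_eq_iff algebra_simps sum_subtractf)

lemma matrix_diff_rdistrib: "(B - C) ** A = B ** A - C ** (A :: 'a::ring_1^'n^'m)"
  by (simp add: matrix_matrix_mult_def vec_eq_iff algebra_simps sum_subtractf)

lemma matrix_minus_left: "(- B) ** A = - (B ** (A :: 'a::ring_1^'n^'m))"
  by (simp add: matrix_matrix_mult_def vec_eq_iff sum_negf)

lemma matrix_minus_right: "B ** (- A) = - (B ** (A :: 'a::ring_1^'n^'m))"
  by (simp add: matrix_matrix_mult_def vec_eq_iff sum_negf)

lemma matrix_add_rdistrib: "(B + C) ** A = B ** A + C ** (A :: 'a::semiring_1^'n^'m)"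
  by (simp add: matrix_matrix_mult_def vec_eq_iff algebra_simps sum.distrib)

lemmas matrix_distribs = matrix_add_ldistrib matrix_add_rdistrib matrix_diff_ldistrib
  matrix_diff_rdistrib matrix_minus_left matrix_minus_right

lemma mat_mult_left: "mat c ** A = (\<chi> i j. c * A $ i $ j)"
  for A :: "'a::comm_semiring_1^'n^'m"
  by (simp add: matrix_matrix_mult_def mat_def vec_eq_iff if_distrib if_distribR cong: if_cong)

lemma mat_mult_right: "A ** mat c = mat c ** A"
  for A :: "'a::comm_semiring_1^'n^'n"
  by (simp add: matrix_matrix_mult_def mat_def vec_eq_iff if_distrib if_distribR mult.commute cong: if_cong)

lemma mat_mult_left_commute: "A ** (mat c ** B) = mat c ** (A ** B)"
  for A B :: "'a::comm_semiring_1^'n^'n"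
  by (metis mat_mult_right matrix_mul_assoc)

lemma mat_mult_mat: "mat c ** mat d = (mat (c * d) :: 'a::comm_semiring_1^'n^'n)"
  unfolding mat_mult_left by (simp add: mat_def vec_eq_iff)

lemma mat_mult_mat_assoc: "mat c ** (mat d ** A) = mat (c * d) ** A"
  for A :: "'a::comm_semiring_1^'n^'n"
  by (simp add: matrix_mul_assoc mat_mult_mat)

lemma mat_uminus: "mat (- c) = - (mat c :: 'a::ring_1^'n^'n)"
  by (simp add: mat_def vec_eq_iff)

lemma matrix_inv_mult:
  fixes A :: "'a::field^'n^'n"
  assumes "invertible A"
  shows "A ** matrix_inv A = mat 1" "matrix_inv A ** A = mat 1"
  using someI_ex[of "\<lambda>A'. A ** A' = mat 1 \<and> A' ** A = mat 1"] assms
  unfolding matrix_inv_def invertible_def by blast+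

lemma matrix_inv_cancel:
  fixes A :: "'a::field^'n^'n"
  assumes "invertible A"
  shows "A ** (matrix_inv A ** B) = B" "matrix_inv A ** (A ** B) = B"
  using matrix_inv_mult[OF assms] by (simp_all add: matrix_mul_assoc)

lemma invertibleI: "A ** B = mat 1 \<Longrightarrow> invertible A" for A :: "'a::field^'n^'n"
  unfolding invertible_right_inverse by blast

lemma matrix_inv_eqI:
  fixes A :: "'a::field^'n^'n"
  assumes "A ** B = mat 1"
  shows "matrix_inv A = B"
  using matrix_inv_mult(2)[OF invertibleI[OF assms]] assms
  by (metis matrix_mul_assoc matrix_mul_lid matrix_mul_rid)

lemma invertible_matrix_inv:
  fixes A :: "'a::field^'n^'n"
  assumes "invertible A"
  shows "invertible (matrix_inv A)"
  using matrix_inv_mult[OF assms] invertibleI by blast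

lemma invertible_iff_kernel:
  fixes A :: "'a::field^'n^'n"
  shows "invertible A \<longleftrightarrow> (\<forall>x. A *v x = 0 \<longrightarrow> x = 0)"
  unfolding invertible_left_inverse matrix_left_invertible_ker ..

lemma transpose_matrix_inv:
  fixes A :: "'a::field^'n^'n"
  assumes "invertible A"
  shows "transpose (matrix_inv A) = matrix_inv (transpose A)"
  by (rule matrix_inv_eqI[symmetric]) (metis matrix_inv_mult(2)[OF assms] matrix_transpose_mul transpose_mat)

section \<open>Calculus of matrix products and inverses\<close>

lemma bounded_bilinear_matrix_mult:
  "bounded_bilinear ((**) :: 'a::{real_normed_field,euclidean_space}^'n^'m \<Rightarrow> 'a^'p^'n \<Rightarrow> 'a^'p^'m)"
  unfolding bilinear_conv_bounded_bilinear[symmetric] bilinear_def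
  by (auto intro!: linearI simp: matrix_add_ldistrib matrix_add_rdistrib scalar_matrix_assoc matrix_scalar_ac)

lemmas has_derivative_matrix_mult = bounded_bilinear.FDERIV[OF bounded_bilinear_matrix_mult]
lemmas continuous_on_matrix_mult = bounded_bilinear.continuous_on[OF bounded_bilinear_matrix_mult]

lemmas matrix_mult_scaleR = bounded_bilinear.scaleR_left[OF bounded_bilinear_matrix_mult]
  bounded_bilinear.scaleR_right[OF bounded_bilinear_matrix_mult]
lemmas matrix_mult_zero = bounded_bilinear.zero_left[OF bounded_bilinear_matrix_mult]
  bounded_bilinear.zero_right[OF bounded_bilinear_matrix_mult]

lemma continuous_on_det_field:
  fixes A :: "'a::topological_space \<Rightarrow> 'b::real_normed_field^'n^'n"
  assumes "continuous_on S A"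
  shows "continuous_on S (\<lambda>x. det (A x))"
  unfolding det_def by (intro continuous_intros assms)

lemma open_invertible: "open {A :: 'a::{real_normed_field}^'n^'n. invertible A}"
proof -
  have "{A :: 'a^'n^'n. invertible A} = det -` (- {0})"
    by (auto simp: invertible_det_nz)
  then show ?thesis
    using continuous_on_det_field[of UNIV "\<lambda>x. x"] by (metis open_vimage open_Compl closed_singleton continuous_on_id)
qed

text \<open>With \<open>P\<close> and \<open>Q\<close> the inverses of \<open>A\<close> and
  \<open>A + H\<close>, one has \<open>P H Q = P - Q\<close>. Using this twice writes the remainder
  \<open>Q - P + P H P\<close> as \<open>P H P H Q\<close>, which is quadratic in
  \<open>H\<close>.\<close>

lemma has_derivative_matrix_inv:
  fixes A :: "'a::{real_normed_field,euclidean_space}^'n^'n"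
  assumes A: "invertible A"
  shows "(matrix_inv has_derivative (\<lambda>H. - (matrix_inv A ** H ** matrix_inv A))) (at A)"
proof -
  let ?P = "matrix_inv A"
  obtain k where k: "k > 0" "\<And>(X :: 'a^'n^'n) (Y :: 'a^'n^'n). norm (X ** Y) \<le> norm X * norm Y * k"
    using bounded_bilinear.pos_bounded[OF bounded_bilinear_matrix_mult] by blast
  obtain d0 where d0: "d0 > 0" "\<And>B. norm (B - A) < d0 \<Longrightarrow> invertible B"
    using open_invertible A unfolding open_dist by (auto simp: dist_norm)
  define p where "p = norm ?P"
  have "?P \<noteq> 0"
  proof
    assume "?P = 0"
    then have "(mat 1 :: 'a^'n^'n) = A ** 0" using matrix_inv_mult(1)[OF A] by simp
    then have "(mat 1 :: 'a^'n^'n) $ i $ i = 0" for i :: 'n by (simp add: matrix_matrix_mult_def)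
    then show False by (simp add: mat_def)
  qed
  then have p: "p > 0" by (simp add: p_def)
  show ?thesis unfolding has_derivative_at_alt
  proof (intro conjI allI impI)
    show "bounded_linear (\<lambda>H. - (?P ** H ** ?P))"
      by (intro bounded_linear_minus bounded_linear_compose[OF bounded_bilinear.bounded_linear_left[OF bounded_bilinear_matrix_mult]]
          bounded_bilinear.bounded_linear_right[OF bounded_bilinear_matrix_mult])
    fix e :: real assume e: "e > 0"
    \<comment> \<open>\<open>k\<close> bounds the matrix product. The three bounds keep
      \<open>B\<close> invertible, give \<open>norm Q \<le> 2 * p\<close>, and make the remainder,
      which is at most \<open>2 * p * p * p * k ^ 4\<close> times the square of
      \<open>norm H\<close>, at most \<open>e * norm H\<close>.\<close>
    define d where "d = min d0 (min (1 / (2 * p * k * k)) (e / (2 * p * p * p * k ^ 4)))"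
    have "d > 0" using d0 p k e by (simp add: d_def)
    moreover have "norm (matrix_inv B - ?P - - (?P ** (B - A) ** ?P)) \<le> e * norm (B - A)"
      if B: "norm (B - A) < d" for B
    proof -
      define H where "H = B - A"
      define Q where "Q = matrix_inv B"
      have iB: "invertible B" using d0(2) B by (simp add: d_def)
      have BQ: "B ** Q = mat 1" using matrix_inv_mult[OF iB] by (simp add: Q_def)
      have h: "norm H < 1 / (2 * p * k * k)" "norm H < e / (2 * p * p * p * k ^ 4)"
        using B by (auto simp: d_def H_def)
      have "?P ** (H ** Q) = ?P ** (B ** Q) - (?P ** A) ** Q"
        by (simp add: H_def matrix_distribs matrix_mul_assoc)
      then have PHQ: "?P ** (H ** Q) = ?P - Q"
        using matrix_inv_mult(2)[OF A] BQ by simp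
      have n1: "norm (?P ** (H ** X)) \<le> p * (norm H * norm X * k) * k" for X :: "'a^'n^'n"
        using k(2)[where X="?P" and Y="H ** X"] k(2)[where X=H and Y=X] k(1) p
        by (smt (verit, best) mult_left_mono mult_right_mono p_def)
      have "norm (?P ** (H ** Q)) \<le> (p * k * k * norm H) * norm Q"
        using n1[of Q] by (simp add: algebra_simps)
      also have "\<dots> \<le> (1/2) * norm Q"
        using h(1) p k by (intro mult_right_mono) (auto simp: field_simps)
      finally have "norm Q \<le> 2 * p"
        using PHQ norm_triangle_sub[of Q ?P] by (simp add: p_def norm_minus_commute)
      have "Q - ?P - - (?P ** H ** ?P) = ?P ** (H ** (?P ** (H ** Q)))"
        unfolding PHQ using PHQ by (simp add: matrix_distribs matrix_mul_assoc[symmetric])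
      also have "norm \<dots> \<le> p * (norm H * norm (?P ** (H ** Q)) * k) * k" by (rule n1)
      also have "\<dots> \<le> p * (norm H * (p * (norm H * norm Q * k) * k) * k) * k"
        using n1[of Q] p k by (intro mult_left_mono mult_right_mono) auto
      also have "\<dots> \<le> p * (norm H * (p * (norm H * (2 * p) * k) * k) * k) * k"
        using \<open>norm Q \<le> 2 * p\<close> p k by (intro mult_left_mono mult_right_mono) auto
      also have "\<dots> = (norm H * (2 * p * p * p * k ^ 4)) * norm H"
        by (simp add: power4_eq_xxxx algebra_simps)
      also have "\<dots> \<le> e * norm H"
        using h(2) p k by (intro mult_right_mono) (auto simp: field_simps)
      finally show ?thesis by (simp add: Q_def H_def)
    qed
    ultimately show "\<exists>d>0. \<forall>y. norm (y - A) < d \<longrightarrow>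
        norm (matrix_inv y - ?P - - (?P ** (y - A) ** ?P)) \<le> e * norm (y - A)" by blast
  qed
qed

lemma continuous_on_matrix_inv:
  fixes f :: "'b::topological_space \<Rightarrow> 'a::{real_normed_field,euclidean_space}^'n^'n"
  assumes f: "continuous_on S f" and inv: "\<And>x. x \<in> S \<Longrightarrow> invertible (f x)"
  shows "continuous_on S (\<lambda>x. matrix_inv (f x))"
proof -
  have "continuous_on {A :: 'a^'n^'n. invertible A} matrix_inv"
    using has_derivative_continuous[OF has_derivative_matrix_inv]
    by (intro continuous_at_imp_continuous_on) auto
  then show ?thesis by (rule continuous_on_compose2[OF _ f]) (use inv in auto)
qed

section \<open>Complex matrices\<close>

definition adj_mat :: "complex^'n^'m \<Rightarrow> complex^'m^'n" where
  "adj_mat A = (\<chi> i j. cnj (A $ j $ i))"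

lemma transpose_cnj_mat: "transpose (cnj_mat A) = adj_mat A" "cnj_mat (transpose A) = adj_mat A"
  by (simp_all add: transpose_def cnj_mat_def adj_mat_def)

lemma transpose_adj_mat [simp]: "transpose (adj_mat A) = cnj_mat A" "adj_mat (transpose A) = cnj_mat A"
  for A :: "complex^'n^'n"
  by (simp_all add: transpose_def cnj_mat_def adj_mat_def)

lemma cnj_adj_mat [simp]: "cnj_mat (adj_mat A) = transpose A" "adj_mat (cnj_mat A) = transpose A"
  for A :: "complex^'n^'n"
  by (simp_all add: transpose_def cnj_mat_def adj_mat_def)

lemma cnj_mat_simps [simp]:
  "cnj_mat (A ** B) = cnj_mat A ** cnj_mat B" "cnj_mat (A + B) = cnj_mat A + cnj_mat B"
  "cnj_mat (A - B) = cnj_mat A - cnj_mat B" "cnj_mat (mat c) = mat (cnj c)"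
  "cnj_mat (cnj_mat A) = A" "cnj_mat (- A) = - cnj_mat A"
  by (simp_all add: cnj_mat_def vec_eq_iff matrix_matrix_mult_def mat_def)

lemma adj_mat_simps [simp]:
  "adj_mat (A + B) = adj_mat A + adj_mat B" "adj_mat (A - B) = adj_mat A - adj_mat B"
  "adj_mat (- A) = - adj_mat A" "adj_mat (adj_mat A) = A"
  by (simp_all add: adj_mat_def vec_eq_iff)

lemma adj_mat_mat [simp]: "adj_mat (mat c :: complex^'n^'n) = mat (cnj c)"
  by (simp add: adj_mat_def vec_eq_iff mat_def)

lemma adj_mat_mult: "adj_mat (A ** B) = adj_mat B ** adj_mat A"
  by (simp add: adj_mat_def vec_eq_iff matrix_matrix_mult_def mult.commute)

lemma transpose_simps:
  "transpose (A + B) = transpose A + transpose B" "transpose (A - B) = transpose A - transpose B"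
  "transpose (- C) = - transpose C"
  for A B C :: "'a::ab_group_add^'n^'m"
  by (simp_all add: transpose_def vec_eq_iff)

lemma cnj_matrix_inv:
  fixes A :: "complex^'n^'n"
  assumes "invertible A"
  shows "cnj_mat (matrix_inv A) = matrix_inv (cnj_mat A)" "invertible (cnj_mat A)"
proof -
  have "cnj_mat A ** cnj_mat (matrix_inv A) = mat 1"
    using matrix_inv_mult(1)[OF assms] by (metis cnj_mat_simps(1,4) complex_cnj_one)
  then show "cnj_mat (matrix_inv A) = matrix_inv (cnj_mat A)" "invertible (cnj_mat A)"
    using matrix_inv_eqI invertibleI by metis+
qed

lemma adj_matrix_inv:
  fixes A :: "complex^'n^'n"
  assumes "invertible A"
  shows "adj_mat (matrix_inv A) = matrix_inv (adj_mat A)" "invertible (adj_mat A)"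
proof -
  have "adj_mat A ** adj_mat (matrix_inv A) = mat 1"
    using matrix_inv_mult(2)[OF assms] by (metis adj_mat_mult adj_mat_mat complex_cnj_one)
  then show "adj_mat (matrix_inv A) = matrix_inv (adj_mat A)" "invertible (adj_mat A)"
    using matrix_inv_eqI invertibleI by metis+
qed

text \<open>The inner product on \<open>complex^'n\<close> is the real part of the Hermitian form,
  which suffices for the norms, orthogonality and positivity used below.\<close>

lemma inner_matrix_vector_adj:
  fixes A :: "complex^'n^'m"
  shows "x \<bullet> (A *v y) = (adj_mat A *v x) \<bullet> y"
proof -
  have "x \<bullet> (A *v y) = (\<Sum>i\<in>UNIV. \<Sum>j\<in>UNIV. x $ i \<bullet> (A $ i $ j * y $ j))"
    by (simp add: inner_vec_def matrix_vector_mult_def inner_sum_right)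
  also have "\<dots> = (\<Sum>i\<in>UNIV. \<Sum>j\<in>UNIV. (cnj (A $ i $ j) * x $ i) \<bullet> y $ j)"
    by (intro sum.cong refl) (simp add: inner_complex_def algebra_simps)
  also have "\<dots> = (\<Sum>j\<in>UNIV. \<Sum>i\<in>UNIV. (cnj (A $ i $ j) * x $ i) \<bullet> y $ j)" by (rule sum.swap)
  also have "\<dots> = (adj_mat A *v x) \<bullet> y"
    by (simp add: inner_vec_def matrix_vector_mult_def inner_sum_left adj_mat_def)
  finally show ?thesis .
qed

section \<open>Unitary and diagonal matrices\<close>

definition unitary_mat :: "complex^'n^'n \<Rightarrow> bool" where
  "unitary_mat U \<longleftrightarrow> adj_mat U ** U = mat 1"

lemma unitary_mat_mult:
  assumes "unitary_mat U"
  shows "adj_mat U ** U = mat 1" "U ** adj_mat U = mat 1"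
    "transpose U ** cnj_mat U = mat 1" "cnj_mat U ** transpose U = mat 1"
proof -
  show 1: "adj_mat U ** U = mat 1" using assms by (simp add: unitary_mat_def)
  then show 2: "U ** adj_mat U = mat 1" using matrix_left_right_inverse by blast
  have "transpose (adj_mat U ** U) = mat 1" using 1 by simp
  then show "transpose U ** cnj_mat U = mat 1" by (simp add: matrix_transpose_mul)
  then show "cnj_mat U ** transpose U = mat 1" using matrix_left_right_inverse by blast
qed

lemma unitary_mat_cancel:
  assumes "unitary_mat U"
  shows "adj_mat U ** (U ** A) = A" "U ** (adj_mat U ** A) = A"
    "transpose U ** (cnj_mat U ** A) = A" "cnj_mat U ** (transpose U ** A) = A"
  using unitary_mat_mult[OF assms] by (simp_all add: matrix_mul_assoc)

lemma unitary_mat_closed: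
  assumes "unitary_mat U"
  shows "unitary_mat (adj_mat U)" "unitary_mat (transpose U)" "unitary_mat V \<Longrightarrow> unitary_mat (U ** V)"
  using unitary_mat_mult[OF assms]
  by (simp_all add: unitary_mat_def adj_mat_mult matrix_mul_assoc[symmetric] unitary_mat_cancel[OF assms])

lemma norm_unitary_mult:
  assumes "unitary_mat U"
  shows "norm (U *v x) = norm x"
  using inner_matrix_vector_adj[of "U *v x" U x] unitary_mat_mult(1)[OF assms]
  by (simp add: norm_eq_sqrt_inner matrix_vector_mul_assoc)

lemma unitary_norm_entry:
  assumes "unitary_mat U"
  shows "norm (U $ i $ j) \<le> 1"
proof -
  have "U *v axis j 1 = column j U"
    by (simp add: matrix_vector_mult_def column_def axis_def vec_eq_iff if_distrib cong: if_cong)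
  then have "norm (column j U) = 1" using norm_unitary_mult[OF assms, of "axis j 1"] by (simp add: norm_eq_sqrt_inner inner_axis_axis)
  then show ?thesis using Finite_Cartesian_Product.norm_nth_le[of "column j U" i] by (simp add: column_def)
qed

lemma linear_adj_mat: "linear (adj_mat :: complex^'n^'n \<Rightarrow> _)"
  by (intro linearI) (auto simp: adj_mat_def vec_eq_iff)

lemma linear_transpose: "linear (transpose :: complex^'n^'n \<Rightarrow> _)"
  by (intro linearI) (auto simp: transpose_def vec_eq_iff)

lemma continuous_on_adj_mat [continuous_intros]:
  "continuous_on S f \<Longrightarrow> continuous_on S (\<lambda>x. adj_mat (f x :: complex^'n^'n))"
  using linear_adj_mat[unfolded linear_conv_bounded_linear] by (rule bounded_linear.continuous_on)

lemma continuous_on_transpose [continuous_intros]: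
  "continuous_on S f \<Longrightarrow> continuous_on S (\<lambda>x. transpose (f x :: complex^'n^'n))"
  using linear_transpose[unfolded linear_conv_bounded_linear] by (rule bounded_linear.continuous_on)

text \<open>Compactness is what later yields finitely many charts, and closed images of the
  complements of patches.\<close>

lemma compact_unitary: "compact {U :: complex^'n^'n. unitary_mat U}"
  unfolding compact_eq_bounded_closed
proof
  have "norm U \<le> (\<Sum>i\<in>(UNIV::'n set). \<Sum>j\<in>(UNIV::'n set). 1)" if "unitary_mat U" for U :: "complex^'n^'n"
  proof -
    have "norm U \<le> (\<Sum>i\<in>UNIV. norm (U $ i))" by (simp add: norm_vec_def L2_set_le_sum)
    also have "\<dots> \<le> (\<Sum>i\<in>UNIV. \<Sum>j\<in>UNIV. norm (U $ i $ j))"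
      by (intro sum_mono) (simp add: norm_vec_def L2_set_le_sum)
    also have "\<dots> \<le> (\<Sum>i\<in>(UNIV::'n set). \<Sum>j\<in>(UNIV::'n set). 1)"
      by (intro sum_mono unitary_norm_entry that)
    finally show ?thesis .
  qed
  then show "bounded {U :: complex^'n^'n. unitary_mat U}" by (auto simp: bounded_iff)
  have "continuous_on UNIV (\<lambda>U :: complex^'n^'n. adj_mat U ** U)"
    by (intro continuous_on_matrix_mult continuous_on_id
        linear_continuous_on[OF linear_adj_mat[unfolded linear_conv_bounded_linear]])
  then have "closed ((\<lambda>U :: complex^'n^'n. adj_mat U ** U) -` {mat 1})"
    using closed_vimage[OF closed_singleton] by blast
  then show "closed {U :: complex^'n^'n. unitary_mat U}" by (simp add: unitary_mat_def vimage_def)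
qed

definition diag_mat :: "('n \<Rightarrow> 'a::zero) \<Rightarrow> 'a^'n^'n" where
  "diag_mat d = (\<chi> i j. if i = j then d i else 0)"

lemma diag_mat_mult: "diag_mat d ** A = (\<chi> i j. d i * A $ i $ j)" "A ** diag_mat d = (\<chi> i j. A $ i $ j * d j)"
  for A :: "'a::semiring_1^'n^'n"
  by (simp_all add: diag_mat_def vec_eq_iff matrix_matrix_mult_def if_distrib if_distribR cong: if_cong)

lemma diag_mat_diag_mat: "diag_mat d ** diag_mat e = diag_mat (\<lambda>i. d i * e i)" for d :: "'n::finite \<Rightarrow> 'a::semiring_1"
  by (simp add: diag_mat_mult) (simp add: diag_mat_def vec_eq_iff)

lemma diag_mat_simps [simp]:
  "transpose (diag_mat d) = diag_mat d" "diag_mat (\<lambda>_. c) = mat c"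
  by (auto simp: diag_mat_def vec_eq_iff transpose_def mat_def)

lemma cnj_diag_mat [simp]: "cnj_mat (diag_mat d) = diag_mat (\<lambda>i. cnj (d i))" "adj_mat (diag_mat d) = diag_mat (\<lambda>i. cnj (d i))"
  by (auto simp: diag_mat_def cnj_mat_def adj_mat_def vec_eq_iff)

lemma diag_mat_vec: "diag_mat d *v x = (\<chi> i. d i * x $ i)" for d :: "'n::finite \<Rightarrow> 'a::semiring_1"
  by (simp add: diag_mat_def matrix_vector_mult_def vec_eq_iff if_distrib if_distribR cong: if_cong)

text \<open>The (i, j) entry of the commutator is \<open>A $ i $ j\<close> times a difference of two
  values of \<open>l\<close>, which is nonzero off the diagonal.\<close>

lemma commutes_diag_imp_diag:
  fixes A :: "'a::idom^'n^'n"
  assumes "A ** diag_mat l = diag_mat l ** A" "inj l"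
  shows "A = diag_mat (\<lambda>k. A $ k $ k)"
proof -
  have "A $ i $ j * l j = l i * A $ i $ j" for i j
    using assms(1) by (simp add: diag_mat_mult vec_eq_iff)
  then have "A $ i $ j = 0" if "i \<noteq> j" for i j
    using that assms(2) by (metis injD mult.commute mult_cancel_left)
  then show ?thesis by (simp add: diag_mat_def vec_eq_iff)
qed

lemma mat_2_mult: "mat 2 ** A = A + A" for A :: "'a::comm_semiring_1^'n^'m"
  by (simp add: mat_mult_left vec_eq_iff flip: mult_2)

section \<open>The Cayley transform\<close>

text \<open>One transform serves twice: followed by multiplication with \<open>\<i>\<close> it maps
  the disc model to the half-space, and on skew-Hermitian matrices it parametrises the unitary
  matrices without the eigenvalue -1.\<close>

definition cayley :: "complex^'n^'n \<Rightarrow> complex^'n^'n" where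
  "cayley X = (mat 1 + X) ** matrix_inv (mat 1 - X)"

definition cayley_inv :: "complex^'n^'n \<Rightarrow> complex^'n^'n" where
  "cayley_inv Y = (Y - mat 1) ** matrix_inv (Y + mat 1)"

text \<open>In these forms \<open>X\<close> enters through a single inverse, which is how the
  transform is inverted and differentiated below.\<close>

lemma cayley_eq:
  assumes "invertible (mat 1 - X)"
  shows "cayley X = mat 2 ** matrix_inv (mat 1 - X) - mat 1"
    "X ** matrix_inv (mat 1 - X) = matrix_inv (mat 1 - X) - mat 1"
    "matrix_inv (mat 1 - X) ** X = matrix_inv (mat 1 - X) - mat 1"
proof -
  let ?P = "matrix_inv (mat 1 - X)"
  show *: "X ** ?P = ?P - mat 1"
    using matrix_inv_mult(1)[OF assms] by (simp add: matrix_distribs algebra_simps)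
  show "?P ** X = ?P - mat 1"
    using matrix_inv_mult(2)[OF assms] by (simp add: matrix_distribs algebra_simps)
  show "cayley X = mat 2 ** ?P - mat 1"
    by (simp add: cayley_def matrix_distribs * mat_2_mult)
qed

lemma cayley_inv_eq:
  assumes "invertible (Y + mat 1)"
  shows "cayley_inv Y = mat 1 - mat 2 ** matrix_inv (Y + mat 1)"
proof -
  let ?Q = "matrix_inv (Y + mat 1)"
  have "Y ** ?Q = mat 1 - ?Q"
    using matrix_inv_mult(1)[OF assms] by (simp add: matrix_distribs algebra_simps)
  then show ?thesis by (simp add: cayley_inv_def matrix_distribs mat_2_mult)
qed

lemma cayley_inv_cayley:
  assumes "invertible (mat 1 - X)"
  shows "invertible (cayley X + mat 1)" "cayley_inv (cayley X) = X"
proof -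
  let ?P = "matrix_inv (mat 1 - X)"
  have 1: "(cayley X + mat 1) ** (mat (1/2) ** (mat 1 - X)) = mat 1"
    using matrix_inv_mult(2)[OF assms]
    by (simp add: cayley_eq(1)[OF assms] mat_mult_left_commute[of ?P] mat_mult_mat matrix_mul_assoc[symmetric] mat_mult_mat_assoc)
  then show inv: "invertible (cayley X + mat 1)" by (rule invertibleI)
  show "cayley_inv (cayley X) = X"
    unfolding cayley_inv_eq[OF inv] matrix_inv_eqI[OF 1] by (simp add: mat_mult_mat_assoc)
qed

lemma cayley_cayley_inv:
  assumes "invertible (Y + mat 1)"
  shows "invertible (mat 1 - cayley_inv Y)" "cayley (cayley_inv Y) = Y"
proof -
  let ?Q = "matrix_inv (Y + mat 1)"
  have 1: "(mat 1 - cayley_inv Y) ** (mat (1/2) ** (Y + mat 1)) = mat 1"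
    using matrix_inv_mult(2)[OF assms]
    by (simp add: cayley_inv_eq[OF assms] mat_mult_left_commute[of ?Q] mat_mult_mat matrix_mul_assoc[symmetric] mat_mult_mat_assoc)
  then show inv: "invertible (mat 1 - cayley_inv Y)" by (rule invertibleI)
  show "cayley (cayley_inv Y) = Y"
    unfolding cayley_eq(1)[OF inv] matrix_inv_eqI[OF 1] by (simp add: mat_mult_mat_assoc)
qed

lemma has_derivative_cayley:
  fixes f :: "'a::real_normed_vector \<Rightarrow> complex^'n^'n"
  assumes inv: "invertible (mat 1 - f u)" and f: "(f has_derivative f') (at u)"
  shows "((\<lambda>x. cayley (f x)) has_derivative
    (\<lambda>h. mat 2 ** (matrix_inv (mat 1 - f u) ** f' h ** matrix_inv (mat 1 - f u)))) (at u)"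
proof -
  have 1: "((\<lambda>x. mat 1 - f x) has_derivative (\<lambda>h. - f' h)) (at u)"
    using f by (auto intro!: derivative_eq_intros)
  have "((\<lambda>x. matrix_inv (mat 1 - f x)) has_derivative
      (\<lambda>h. - (matrix_inv (mat 1 - f u) ** (- f' h) ** matrix_inv (mat 1 - f u)))) (at u)"
    using diff_chain_at[OF 1 has_derivative_matrix_inv[OF inv]] by (simp add: o_def)
  then have "((\<lambda>x. mat 2 ** matrix_inv (mat 1 - f x) - mat 1) has_derivative
    (\<lambda>h. mat 2 ** (matrix_inv (mat 1 - f u) ** f' h ** matrix_inv (mat 1 - f u)))) (at u)"
    by (auto intro!: derivative_eq_intros has_derivative_matrix_mult simp: matrix_minus_left matrix_minus_right)
  moreover have "\<forall>\<^sub>F x in at u. mat 2 ** matrix_inv (mat 1 - f x) - mat 1 = cayley (f x)"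
  proof -
    have "isCont (\<lambda>x. mat 1 - f x) u" using has_derivative_continuous[OF 1] by simp
    then have "\<forall>\<^sub>F x in at u. invertible (mat 1 - f x)"
      using topological_tendstoD[OF _ open_invertible] inv unfolding isCont_def by fastforce
    then show ?thesis by eventually_elim (simp add: cayley_eq)
  qed
  ultimately show ?thesis
    by (rule has_derivative_transform_eventually) (simp_all add: cayley_eq inv)
qed

lemma continuous_on_cayley:
  fixes f :: "'a::topological_space \<Rightarrow> complex^'n^'n"
  assumes "continuous_on S f" "\<And>x. x \<in> S \<Longrightarrow> invertible (mat 1 - f x)"
  shows "continuous_on S (\<lambda>x. cayley (f x))"
  unfolding cayley_def using assms
  by (intro continuous_on_matrix_mult continuous_on_matrix_inv continuous_intros) auto

lemma continuous_on_cayley_inv: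
  fixes f :: "'a::topological_space \<Rightarrow> complex^'n^'n"
  assumes "continuous_on S f" "\<And>x. x \<in> S \<Longrightarrow> invertible (f x + mat 1)"
  shows "continuous_on S (\<lambda>x. cayley_inv (f x))"
  unfolding cayley_inv_def using assms
  by (intro continuous_on_matrix_mult continuous_on_matrix_inv continuous_intros) auto

text \<open>This is the disc condition that the matrix \<open>mat 1 - adj_mat W ** W\<close> be
  positive definite, stated through norms.\<close>

definition contraction_mat :: "complex^'n^'n \<Rightarrow> bool" where
  "contraction_mat W \<longleftrightarrow> (\<forall>x. x \<noteq> 0 \<longrightarrow> norm (W *v x) < norm x)"

lemma contraction_mat_invertible:
  assumes "contraction_mat W"
  shows "invertible (mat 1 - W)"
proof -
  have "x = 0" if "(mat 1 - W) *v x = 0" for x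
  proof (rule ccontr)
    assume "x \<noteq> 0"
    moreover have "W *v x = x" using that by (simp add: matrix_vector_mult_diff_rdistrib)
    ultimately show False using assms by (metis contraction_mat_def less_irrefl)
  qed
  then show ?thesis by (simp add: invertible_iff_kernel)
qed

text \<open>For skew-Hermitian \<open>K\<close> the vector \<open>K *v x\<close> is orthogonal to
  \<open>x\<close>, so it can equal \<open>x\<close> or \<open>- x\<close> only when
  \<open>x = 0\<close>.\<close>

lemma skew_resolventertible:
  assumes "adj_mat K = - K"
  shows "invertible (mat 1 - K)" "invertible (mat 1 + K)"
proof -
  have orth: "x \<bullet> (K *v x) = 0" for x
  proof -
    have "(- K) *v x = - (K *v x)" by (metis diff_0 matrix_vector_mult_diff_rdistrib matrix_vector_mult_0)
    then show ?thesis using inner_matrix_vector_adj[of x K x] assms by (simp add: inner_commute)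
  qed
  have "x = 0" if "(mat 1 - K) *v x = 0 \<or> (mat 1 + K) *v x = 0" for x
  proof -
    have "K *v x = x \<or> K *v x = - x" using that
      by (auto simp: matrix_vector_mult_diff_rdistrib matrix_vector_mult_add_rdistrib add_eq_0_iff)
    then show ?thesis using orth[of x] by auto
  qed
  then show "invertible (mat 1 - K)" "invertible (mat 1 + K)" unfolding invertible_iff_kernel by blast+
qed

lemma unitary_cayley:
  assumes K: "adj_mat K = - K"
  shows "unitary_mat (cayley K)" "invertible (cayley K + mat 1)" "cayley_inv (cayley K) = K"
proof -
  note inv = skew_resolventertible[OF K]
  show "invertible (cayley K + mat 1)" "cayley_inv (cayley K) = K" using cayley_inv_cayley inv by blast+
  have "adj_mat (cayley K) = matrix_inv (mat 1 + K) ** (mat 1 - K)"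
    using adj_matrix_inv(1)[OF inv(1)] K by (simp add: cayley_def adj_mat_mult)
  moreover have "(mat 1 - K) ** (mat 1 + K) = (mat 1 + K) ** (mat 1 - K)"
    by (simp add: matrix_distribs)
  ultimately have "adj_mat (cayley K) ** cayley K
      = matrix_inv (mat 1 + K) ** ((mat 1 + K) ** ((mat 1 - K) ** matrix_inv (mat 1 - K)))"
    by (metis cayley_def matrix_mul_assoc)
  then show "unitary_mat (cayley K)"
    using matrix_inv_mult[OF inv(1)] matrix_inv_mult[OF inv(2)] by (simp add: unitary_mat_def)
qed

lemma skew_cayley_inv:
  fixes U :: "complex^'n^'n"
  assumes U: "unitary_mat U" and inv: "invertible (U + mat 1)"
  shows "adj_mat (cayley_inv U) = - cayley_inv U"
proof -
  \<comment> \<open>Unitarity makes the adjoint of \<open>U + mat 1\<close> a multiple of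
    \<open>U + mat 1\<close> itself, so the inverse of the adjoint is again expressed by
    \<open>matrix_inv (U + mat 1)\<close>.\<close>
  have "adj_mat (U + mat 1) = adj_mat U ** (U + mat 1)"
    using unitary_mat_mult[OF U] by (simp add: matrix_distribs add.commute)
  then have "matrix_inv (adj_mat (U + mat 1)) = matrix_inv (U + mat 1) ** U"
    using unitary_mat_mult(1)[OF U] unitary_mat_mult(2)[OF U] matrix_inv_mult(1)[OF inv]
    by (intro matrix_inv_eqI) (simp add: matrix_mul_assoc[symmetric] matrix_inv_cancel[OF inv])
  then have "adj_mat (cayley_inv U) = mat 1 - (matrix_inv (U + mat 1) ** U) ** mat 2"
    using adj_matrix_inv(1)[OF inv] by (simp add: cayley_inv_eq[OF inv] adj_mat_mult)
  moreover have "matrix_inv (U + mat 1) ** U = mat 1 - matrix_inv (U + mat 1)"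
    using matrix_inv_mult(2)[OF inv] by (simp add: matrix_distribs algebra_simps)
  ultimately have "adj_mat (cayley_inv U) = mat 1 - mat 2 ** (mat 1 - matrix_inv (U + mat 1))"
    by (metis mat_mult_right)
  then show ?thesis
    using mat_2_mult[of "mat 1 :: complex^'n^'n"] by (simp add: cayley_inv_eq[OF inv] matrix_diff_ldistrib)
qed

section \<open>The Siegel half-space in the disc model\<close>

lemma complex_mat_mult: "complex_mat (A ** B) = complex_mat A ** complex_mat B"
  by (simp add: complex_mat_def matrix_matrix_mult_def vec_eq_iff)

lemma complex_mat_mat [simp]: "complex_mat (mat c) = mat (of_real c)"
  by (simp add: complex_mat_def mat_def vec_eq_iff)

lemma transpose_complex_mat: "transpose (complex_mat A) = complex_mat (transpose A)"
  by (simp add: complex_mat_def transpose_def)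

lemma transpose_eq_iff_Re_Im:
  "transpose Z = Z \<longleftrightarrow> transpose (Re_mat Z) = Re_mat Z \<and> transpose (Im_mat Z) = Im_mat Z"
  by (auto simp: transpose_def Re_mat_def Im_mat_def vec_eq_iff complex_eq_iff)

lemma inner_complex_mat_real:
  fixes v :: "real^'n" and Y :: "real^'n^'n"
  shows "v \<bullet> (Y *v v) = (\<chi> i. complex_of_real (v $ i)) \<bullet> (complex_mat Y *v (\<chi> i. complex_of_real (v $ i)))"
  by (simp add: inner_vec_def matrix_vector_mult_def complex_mat_def inner_complex_def)

lemma inner_complex_mat:
  fixes v :: "complex^'n" and Y :: "real^'n^'n"
  shows "v \<bullet> (complex_mat Y *v v) = (\<chi> i. Re (v $ i)) \<bullet> (Y *v (\<chi> i. Re (v $ i))) + (\<chi> i. Im (v $ i)) \<bullet> (Y *v (\<chi> i. Im (v $ i)))"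
  by (simp add: inner_vec_def matrix_vector_mult_def complex_mat_def inner_complex_def sum.distrib)

text \<open>The factor \<open>\<i>\<close> turns the imaginary part into the entrywise real part of
  \<open>cayley W = 2 A - 1\<close>, that is \<open>A + cnj A - 1\<close>. The product on the right
  expands to the same matrix because \<open>W A = A - 1\<close>.\<close>

lemma siegel_Im:
  assumes sym: "transpose W = W" and c: "contraction_mat W"
  defines "A \<equiv> matrix_inv (mat 1 - W)"
  shows "transpose A = A"
    "complex_mat (Im_mat (mat \<i> ** cayley W)) = cnj_mat A ** (mat 1 - cnj_mat W ** W) ** A"
proof -
  note inv = contraction_mat_invertible[OF c]
  note eq = cayley_eq[OF inv, folded A_def]
  show "transpose A = A" using transpose_matrix_inv[OF inv] sym by (simp add: A_def transpose_simps)
  have cA: "cnj_mat A ** cnj_mat W = cnj_mat A - mat 1"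
    using arg_cong[OF eq(3), of cnj_mat] by simp
  have "complex_mat (Im_mat (mat \<i> ** cayley W)) = A + cnj_mat A - mat 1"
    unfolding eq(1) mat_mult_left
    by (simp add: complex_mat_def Im_mat_def cnj_mat_def vec_eq_iff mat_def complex_eq_iff)
  also have "\<dots> = cnj_mat A ** A - (cnj_mat A ** cnj_mat W) ** (W ** A)"
    unfolding cA eq(2) by (simp add: matrix_distribs)
  also have "\<dots> = cnj_mat A ** (mat 1 - cnj_mat W ** W) ** A"
    by (simp add: matrix_distribs matrix_mul_assoc)
  finally show "complex_mat (Im_mat (mat \<i> ** cayley W)) = cnj_mat A ** (mat 1 - cnj_mat W ** W) ** A" .
qed

text \<open>With \<open>w = A v\<close>, where \<open>A\<close> is the inverse of
  \<open>mat 1 - W\<close>, the form at \<open>v\<close> is the squared norm of \<open>w\<close>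
  minus that of \<open>W w\<close>, hence positive for a strict contraction.\<close>

lemma siegel_half_space_cayley:
  fixes W :: "complex^'n^'n"
  assumes sym: "transpose W = W" and c: "contraction_mat W"
  shows "mat \<i> ** cayley W \<in> siegel_half_space"
proof -
  let ?A = "matrix_inv (mat 1 - W)"
  note inv = contraction_mat_invertible[OF c]
  note tA = siegel_Im(1)[OF sym c]
  have cA: "cnj_mat ?A = adj_mat ?A" by (metis tA transpose_cnj_mat(2))
  have cW: "cnj_mat W = adj_mat W" by (metis sym transpose_cnj_mat(2))
  have "0 < v \<bullet> (Im_mat (mat \<i> ** cayley W) *v v)" if v: "v \<noteq> 0" for v :: "real^'n"
  proof -
    let ?v = "\<chi> i. complex_of_real (v $ i)"
    let ?w = "?A *v ?v"
    have "?v \<noteq> 0" using v by (simp add: vec_eq_iff)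
    moreover have "invertible ?A" using invertible_matrix_inv[OF inv] .
    ultimately have w: "?w \<noteq> 0" by (metis invertible_iff_kernel)
    have "v \<bullet> (Im_mat (mat \<i> ** cayley W) *v v) = ?v \<bullet> ((adj_mat ?A ** ((mat 1 - adj_mat W ** W) ** ?A)) *v ?v)"
      unfolding inner_complex_mat_real siegel_Im(2)[OF sym c] cA cW by (simp add: matrix_mul_assoc)
    also have "\<dots> = ?w \<bullet> ((mat 1 - adj_mat W ** W) *v ?w)"
      by (simp add: matrix_vector_mul_assoc[symmetric] inner_matrix_vector_adj)
    also have "\<dots> = ?w \<bullet> ?w - (W *v ?w) \<bullet> (W *v ?w)"
      by (simp add: matrix_vector_mult_diff_rdistrib inner_diff_right matrix_vector_mul_assoc[symmetric])
        (simp add: inner_matrix_vector_adj)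
    also have "\<dots> = (norm ?w)\<^sup>2 - (norm (W *v ?w))\<^sup>2"
      by (simp add: power2_norm_eq_inner)
    also have "\<dots> > 0"
      using c w by (simp add: contraction_mat_def power_strict_mono)
    finally show ?thesis .
  qed
  moreover have "transpose (cayley W) = cayley W"
    by (simp add: cayley_eq(1)[OF inv] transpose_simps matrix_transpose_mul tA mat_mult_right[of ?A])
  then have "transpose (mat \<i> ** cayley W) = mat \<i> ** cayley W"
    by (simp add: matrix_transpose_mul mat_mult_right[of "cayley W"])
  ultimately show ?thesis
    unfolding siegel_half_space_def transpose_eq_iff_Re_Im by simp
qed

lemma siegel_half_space_transpose: "Z \<in> siegel_half_space \<Longrightarrow> transpose Z = Z"
  by (simp add: siegel_half_space_def transpose_eq_iff_Re_Im)

lemma complex_mat_inv_Im: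
  assumes "Z \<in> siegel_half_space"
  shows "complex_mat (matrix_inv (Im_mat Z)) ** complex_mat (Im_mat Z) = mat 1"
    "complex_mat (Im_mat Z) ** complex_mat (matrix_inv (Im_mat Z)) = mat 1"
    "invertible (Im_mat Z)"
proof -
  have "x = 0" if "Im_mat Z *v x = 0" for x
    using assms that by (force simp: siegel_half_space_def)
  then show inv: "invertible (Im_mat Z)" by (simp add: invertible_iff_kernel)
  show "complex_mat (matrix_inv (Im_mat Z)) ** complex_mat (Im_mat Z) = mat 1"
    "complex_mat (Im_mat Z) ** complex_mat (matrix_inv (Im_mat Z)) = mat 1"
    using matrix_inv_mult[OF inv] by (metis complex_mat_mult complex_mat_mat of_real_1)+
qed

text \<open>\<open>Y = - \<i> Z\<close> is the sum of a skew-Hermitian matrix and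
  \<open>Im_mat Z\<close>, so \<open>Y + mat 1\<close> has trivial kernel and \<open>Z\<close> comes
  from \<open>W = cayley_inv Y\<close>. The first two factors of the cross-ratio multiply to
  \<open>W\<close>, the last two to its conjugate.\<close>

lemma siegel_half_space_disc:
  assumes Z: "Z \<in> siegel_half_space"
  obtains W where "transpose W = W" "invertible (mat 1 - W)" "Z = mat \<i> ** cayley W"
    "cross_ratio Z (mat \<i>) = W ** cnj_mat W"
proof -
  note sym = siegel_half_space_transpose[OF Z]
  define Y where "Y = mat (- \<i>) ** Z"
  have ZY: "Z = mat \<i> ** Y" by (simp add: Y_def mat_mult_mat_assoc)
  have tY: "transpose Y = Y" by (simp add: Y_def matrix_transpose_mul sym mat_mult_right[of Z])
  have inv: "invertible (Y + mat 1)"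
    unfolding invertible_iff_kernel
  proof (intro allI impI)
    fix v assume v: "(Y + mat 1) *v v = 0"
    have X: "v \<bullet> ((mat (- \<i>) ** complex_mat (Re_mat Z)) *v v) = 0"
    proof -
      let ?B = "mat (- \<i>) ** complex_mat (Re_mat Z)"
      have "transpose (Re_mat Z) = Re_mat Z" using Z by (simp add: siegel_half_space_def)
      then have "Re (Z $ i $ j) = Re (Z $ j $ i)" for i j
        by (simp add: transpose_def Re_mat_def vec_eq_iff)
      then have "adj_mat ?B = - ?B"
        by (simp add: mat_mult_left adj_mat_def complex_mat_def Re_mat_def vec_eq_iff)
      moreover have "(- ?B) *v v = - (?B *v v)" by (metis diff_0 matrix_vector_mult_diff_rdistrib matrix_vector_mult_0)
      ultimately show ?thesis using inner_matrix_vector_adj[of v ?B v] by (simp add: inner_commute)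
    qed
    have "Y = mat (- \<i>) ** complex_mat (Re_mat Z) + complex_mat (Im_mat Z)"
      by (simp add: Y_def mat_mult_left complex_mat_def Re_mat_def Im_mat_def vec_eq_iff complex_eq_iff)
    then have "v \<bullet> (complex_mat (Im_mat Z) *v v) + v \<bullet> v = 0"
      using arg_cong[OF v, of "\<lambda>w. v \<bullet> w"] X
      by (simp add: matrix_vector_mult_add_rdistrib inner_add_right)
    moreover have "0 \<le> x \<bullet> (Im_mat Z *v x)" for x
      using Z by (cases "x = 0") (auto simp: siegel_half_space_def less_imp_le)
    then have "0 \<le> v \<bullet> (complex_mat (Im_mat Z) *v v)" unfolding inner_complex_mat by (intro add_nonneg_nonneg)
    ultimately show "v = 0" by (smt (verit) inner_ge_zero inner_eq_zero_iff)
  qed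
  define W where "W = cayley_inv Y"
  note c = cayley_cayley_inv[OF inv]
  let ?Q = "matrix_inv (Y + mat 1)"
  have tQ: "transpose (matrix_inv (Y + mat 1)) = matrix_inv (Y + mat 1)"
    using transpose_matrix_inv[OF inv] by (simp add: transpose_simps tY)
  have tW: "transpose W = W"
    by (simp add: W_def cayley_inv_eq[OF inv] transpose_simps matrix_transpose_mul tQ mat_mult_right[of ?Q])
  have Wi: "(Z - mat \<i>) ** matrix_inv (Z + mat \<i>) = W"
  proof -
    have "Z + mat \<i> = mat \<i> ** (Y + mat 1)" by (simp add: ZY matrix_distribs mat_mult_mat)
    moreover have "matrix_inv (mat \<i> ** (Y + mat 1)) = mat (- \<i>) ** matrix_inv (Y + mat 1)"
      by (rule matrix_inv_eqI)
        (simp add: matrix_mul_assoc[symmetric] mat_mult_left_commute[of "Y + mat 1"] mat_mult_mat_assoc matrix_inv_mult[OF inv] mat_mult_mat)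
    moreover have "Z - mat \<i> = mat \<i> ** (Y - mat 1)" by (simp add: ZY matrix_distribs mat_mult_mat)
    ultimately show ?thesis
      by (simp add: W_def cayley_inv_def matrix_mul_assoc[symmetric] mat_mult_left_commute[of "Y - mat 1"] mat_mult_mat_assoc)
  qed
  have inv': "invertible (Z + mat \<i>)"
  proof (rule invertibleI)
    have "(Z + mat \<i>) = mat \<i> ** (Y + mat 1)" by (simp add: ZY matrix_distribs mat_mult_mat)
    then show "(Z + mat \<i>) ** (mat (- \<i>) ** matrix_inv (Y + mat 1)) = mat 1"
      by (simp add: matrix_mul_assoc[symmetric] mat_mult_left_commute[of "Y + mat 1"] mat_mult_mat_assoc matrix_inv_mult[OF inv] mat_mult_mat)
  qed
  have "cross_ratio Z (mat \<i>) = W ** cnj_mat W"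
    using cnj_matrix_inv(1)[OF inv']
    by (simp add: cross_ratio_def Wi[symmetric] mat_uminus matrix_mul_assoc)
  then show thesis using that[of W] tW c by (simp add: W_def ZY)
qed

section \<open>Orbits of the unitary group\<close>

definition takagi :: "('n::finite \<Rightarrow> real) \<Rightarrow> complex^'n^'n \<Rightarrow> complex^'n^'n" where
  "takagi d U = U ** diag_mat (\<lambda>k. complex_of_real (d k)) ** transpose U"

definition siegel_point :: "('n::finite \<Rightarrow> real) \<Rightarrow> complex^'n^'n \<Rightarrow> complex^'n^'n" where
  "siegel_point d U = mat \<i> ** cayley (takagi d U)"

definition sign_function :: "('n \<Rightarrow> complex) \<Rightarrow> bool" where
  "sign_function s \<longleftrightarrow> (\<forall>k. s k = 1 \<or> s k = - 1)"

lemma transpose_takagi: "transpose (takagi d U) = takagi d U"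
  by (simp add: takagi_def matrix_transpose_mul matrix_mul_assoc)

lemma diag_mat_contraction:
  assumes d: "\<And>k. \<bar>d k\<bar> < 1" and y: "y \<noteq> 0"
  shows "norm (diag_mat (\<lambda>k. complex_of_real (d k)) *v y) < norm (y :: complex^'n)"
proof -
  have sq: "(norm z)\<^sup>2 = (\<Sum>k\<in>UNIV. (cmod (z $ k))\<^sup>2)" for z :: "complex^'n"
    by (simp add: norm_vec_def L2_set_def sum_nonneg)
  have d2: "(d k)\<^sup>2 < 1" for k using d[of k] by (simp add: abs_square_less_1)
  obtain k where k: "y $ k \<noteq> 0" using y by (auto simp: vec_eq_iff)
  have "(\<Sum>k\<in>UNIV. (d k)\<^sup>2 * (cmod (y $ k))\<^sup>2) < (\<Sum>k\<in>UNIV. (cmod (y $ k))\<^sup>2)"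
  proof (rule sum_strict_mono_ex1)
    show "\<forall>x\<in>UNIV. (d x)\<^sup>2 * (cmod (y $ x))\<^sup>2 \<le> (cmod (y $ x))\<^sup>2"
      using mult_right_mono[OF less_imp_le[OF d2]] by fastforce
    have "(d k)\<^sup>2 * (cmod (y $ k))\<^sup>2 < (cmod (y $ k))\<^sup>2" using d2[of k] k by simp
    then show "\<exists>a\<in>UNIV. (d a)\<^sup>2 * (cmod (y $ a))\<^sup>2 < (cmod (y $ a))\<^sup>2" by blast
  qed simp
  then have "(norm (diag_mat (\<lambda>k. complex_of_real (d k)) *v y))\<^sup>2 < (norm y)\<^sup>2"
    unfolding sq by (simp add: diag_mat_vec norm_mult power_mult_distrib)
  then show ?thesis using power_less_imp_less_base by fastforce
qed

lemma takagi_contraction: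
  assumes d: "\<And>k. \<bar>d k\<bar> < 1" and U: "unitary_mat U"
  shows "contraction_mat (takagi d U)"
  unfolding contraction_mat_def
proof (intro allI impI)
  fix x :: "complex^'a" assume x: "x \<noteq> 0"
  have n: "norm (transpose U *v x) = norm x" by (rule norm_unitary_mult[OF unitary_mat_closed(2)[OF U]])
  then have "transpose U *v x \<noteq> 0" using x by (metis norm_eq_zero)
  from diag_mat_contraction[where d=d, OF d this]
  show "norm (takagi d U *v x) < norm x"
    by (simp add: takagi_def matrix_vector_mul_assoc[symmetric] norm_unitary_mult[OF U] n del: transpose_matrix_vector)
qed

lemma takagi_cnj_product:
  assumes U: "unitary_mat U"
  shows "takagi d U ** cnj_mat (takagi d U) = U ** diag_mat (\<lambda>k. complex_of_real ((d k)\<^sup>2)) ** adj_mat U"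
    "cnj_mat (takagi d U) ** takagi d U = cnj_mat U ** diag_mat (\<lambda>k. complex_of_real ((d k)\<^sup>2)) ** transpose U"
  using diag_mat_diag_mat[of "\<lambda>k. complex_of_real (d k)" "\<lambda>k. complex_of_real (d k)"]
  by (simp_all add: takagi_def matrix_mul_assoc[symmetric] unitary_mat_cancel[OF U] transpose_cnj_mat power2_eq_square)
     (simp_all add: matrix_mul_assoc)

lemma eigenvalues_takagi:
  assumes U: "unitary_mat U"
  shows "eigenvalues (takagi d U ** cnj_mat (takagi d U)) = range (\<lambda>k. complex_of_real ((d k)\<^sup>2))"
proof -
  let ?L = "diag_mat (\<lambda>k. complex_of_real ((d k)\<^sup>2))"
  show ?thesis unfolding takagi_cnj_product[OF U]
  proof (intro set_eqI iffI)
    fix \<mu> assume "\<mu> \<in> eigenvalues (U ** ?L ** adj_mat U)"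
    then obtain v where v: "v \<noteq> 0" "(U ** ?L ** adj_mat U) *v v = \<mu> *s v" by (auto simp: eigenvalues_def)
    define y where "y = adj_mat U *v v"
    have "norm y = norm v" unfolding y_def by (rule norm_unitary_mult[OF unitary_mat_closed(1)[OF U]])
    then have "y \<noteq> 0" using v by (metis norm_eq_zero)
    then obtain k where k: "y $ k \<noteq> 0" by (auto simp: vec_eq_iff)
    have "?L *v y = adj_mat U *v ((U ** ?L ** adj_mat U) *v v)"
      by (simp add: y_def matrix_vector_mul_assoc matrix_mul_assoc[symmetric] unitary_mat_cancel[OF U])
    also have "\<dots> = \<mu> *s y" by (simp only: v y_def vector_scalar_commute)
    finally have "complex_of_real ((d k)\<^sup>2) * y $ k = \<mu> * y $ k" by (simp add: diag_mat_vec vec_eq_iff)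
    then show "\<mu> \<in> range (\<lambda>k. complex_of_real ((d k)\<^sup>2))" using k by auto
  next
    fix \<mu> assume "\<mu> \<in> range (\<lambda>k. complex_of_real ((d k)\<^sup>2))"
    then obtain k where \<mu>: "\<mu> = complex_of_real ((d k)\<^sup>2)" by blast
    define v where "v = U *v axis k 1"
    have "norm v = norm (axis k (1::complex))" unfolding v_def by (rule norm_unitary_mult[OF U])
    then have "v \<noteq> 0" by (auto simp: axis_eq_0_iff)
    have "(U ** ?L ** adj_mat U) *v v = U *v (?L *v axis k 1)"
      by (simp add: v_def matrix_vector_mul_assoc matrix_mul_assoc[symmetric] unitary_mat_mult[OF U])
    also have "?L *v axis k 1 = \<mu> *s axis k 1"
      by (simp add: diag_mat_vec vec_eq_iff axis_def \<mu>)
    also have "U *v (\<mu> *s axis k 1) = \<mu> *s v" by (simp add: v_def vector_scalar_commute)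
    finally show "\<mu> \<in> eigenvalues (U ** ?L ** adj_mat U)" using \<open>v \<noteq> 0\<close> by (auto simp: eigenvalues_def)
  qed
qed

text \<open>
  With distinct eigenvalues of \<open>W cnj W = W adj W\<close>, unit eigenvectors form a unitary \<open>V\<close>, and
  \<open>adj V W cnj V\<close> commutes with the diagonal of eigenvalues, hence is itself diagonal.
\<close>

lemma takagi_factorisation:
  fixes W :: "complex^'n^'n"
  assumes sym: "transpose W = W" and d: "\<And>k. 0 < d k" and inj: "inj d"
    and ev: "range (\<lambda>k. complex_of_real ((d k)\<^sup>2)) \<subseteq> eigenvalues (W ** cnj_mat W)"
  obtains U where "unitary_mat U" "W = takagi d U"
proof -
  define l where "l k = complex_of_real ((d k)\<^sup>2)" for k
  let ?G = "W ** cnj_mat W" and ?L = "diag_mat l"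
  have injl: "inj l"
  proof (rule injI)
    fix j k assume "l j = l k"
    then have "(d j)\<^sup>2 = (d k)\<^sup>2" unfolding l_def of_real_eq_iff .
    then have "d j = d k" using d[of j] d[of k] by (simp add: power2_eq_iff_nonneg)
    then show "j = k" using inj by (simp add: inj_eq)
  qed
  have cW: "cnj_mat W = adj_mat W" by (metis sym transpose_cnj_mat(2))
  have adjG: "adj_mat ?G = ?G" by (simp add: cW adj_mat_mult)
  have "\<exists>v. norm v = 1 \<and> ?G *v v = l k *s v" for k
  proof -
    obtain v where v: "v \<noteq> 0" "?G *v v = l k *s v" using ev by (auto simp: eigenvalues_def l_def)
    let ?u = "complex_of_real (1 / norm v) *s v"
    have "?u = (1 / norm v) *\<^sub>R v" unfolding vec_eq_iff by (simp add: scaleR_conv_of_real[where 'a=complex])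
    then have "norm ?u = 1" using v by simp
    moreover have "?G *v ?u = l k *s ?u"
      unfolding vector_scalar_commute v(2) by (simp add: vector_smult_assoc mult.commute)
    ultimately show ?thesis by blast
  qed
  then obtain v where v: "\<And>k. norm (v k) = 1" "\<And>k. ?G *v v k = l k *s v k" by metis
  define V where "V = (\<chi> i k. v k $ i)"
  have GV: "?G ** V = V ** ?L"
  proof -
    have "(?G ** V) $ i $ k = (?G *v v k) $ i" for i k
      by (simp add: V_def matrix_matrix_mult_def matrix_vector_mult_def)
    then show ?thesis unfolding v(2) by (simp add: diag_mat_mult vec_eq_iff V_def mult.commute)
  qed
  have adjL: "adj_mat ?L = ?L" by (simp add: l_def[abs_def])
  have "adj_mat V ** V ** ?L = ?L ** (adj_mat V ** V)"
  proof -
    have "adj_mat V ** V ** ?L = adj_mat V ** ?G ** V" using GV by (simp add: matrix_mul_assoc[symmetric])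
    also have "adj_mat V ** ?G = adj_mat (?G ** V)" by (simp add: adj_mat_mult[of ?G] adjG del: cnj_mat_simps)
    also have "\<dots> = ?L ** adj_mat V" by (simp only: GV adj_mat_mult adjL)
    finally show ?thesis by (simp add: matrix_mul_assoc)
  qed
  from commutes_diag_imp_diag[OF this injl]
  have "adj_mat V ** V = diag_mat (\<lambda>k. (adj_mat V ** V) $ k $ k)" .
  moreover have "(adj_mat V ** V) $ k $ k = 1" for k
  proof -
    have "(adj_mat V ** V) $ k $ k = (\<Sum>i\<in>UNIV. complex_of_real ((cmod (v k $ i))\<^sup>2))"
      by (simp add: matrix_matrix_mult_def adj_mat_def V_def complex_norm_square mult.commute del: of_real_power)
    also have "\<dots> = complex_of_real ((norm (v k))\<^sup>2)"
      by (simp add: norm_vec_def L2_set_def sum_nonneg del: of_real_power)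
    finally show ?thesis by (simp add: v)
  qed
  ultimately have V: "unitary_mat V" by (simp add: unitary_mat_def)
  define S where "S = adj_mat V ** W ** cnj_mat V"
  have SS: "S ** cnj_mat S = ?L"
  proof -
    have "S ** cnj_mat S = adj_mat V ** (W ** cnj_mat W ** V)"
      by (simp add: S_def matrix_mul_assoc[symmetric] unitary_mat_cancel[OF V])
    then show ?thesis unfolding GV by (simp add: unitary_mat_cancel[OF V])
  qed
  \<comment> \<open>\<open>?L\<close> is real, so both products of \<open>S\<close> with its
    conjugate equal \<open>?L\<close>; hence \<open>S ** ?L\<close> and \<open>?L ** S\<close> are
    both \<open>S ** cnj_mat S ** S\<close>.\<close>
  have "cnj_mat S ** S = ?L" using arg_cong[OF SS, of cnj_mat] by (simp add: l_def[abs_def])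
  with SS have "S ** ?L = ?L ** S" by (metis matrix_mul_assoc)
  from commutes_diag_imp_diag[OF this injl]
  obtain s where s: "S = diag_mat s" by blast
  have "s k * cnj (s k) = l k" for k
  proof -
    have "diag_mat (\<lambda>k. s k * cnj (s k)) $ k $ k = ?L $ k $ k"
      using SS unfolding s by (simp add: diag_mat_diag_mat)
    then show ?thesis by (simp add: diag_mat_def)
  qed
  then have "complex_of_real ((cmod (s k))\<^sup>2) = complex_of_real ((d k)\<^sup>2)" for k
    by (simp only: complex_norm_square l_def)
  then have sq: "(cmod (s k))\<^sup>2 = (d k)\<^sup>2" for k by (simp only: of_real_eq_iff)
  have ns: "cmod (s k) = d k" for k
    using sq[of k] d[of k] power2_eq_iff_nonneg[of "cmod (s k)" "d k"] by simp
  \<comment> \<open>The diagonal entries \<open>s k\<close> have modulus \<open>d k\<close> but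
    arbitrary phase. A phase put into \<open>U\<close> enters once through \<open>U\<close> and once
    through \<open>transpose U\<close>, hence the square root.\<close>
  define \<theta> where "\<theta> k = csqrt (s k / complex_of_real (d k))" for k
  have \<theta>2: "\<theta> k * (complex_of_real (d k) * \<theta> k) = s k" for k
  proof -
    have *: "\<theta> k * \<theta> k = s k / complex_of_real (d k)"
      unfolding \<theta>_def by (metis power2_csqrt power2_eq_square)
    have "\<theta> k * (complex_of_real (d k) * \<theta> k) = complex_of_real (d k) * (\<theta> k * \<theta> k)"
      by (rule mult.left_commute)
    also have "\<dots> = s k" unfolding * using d[of k] by simp
    finally show ?thesis .
  qed
  have "cmod (\<theta> k) = 1" for k
    unfolding \<theta>_def using ns[of k] d[of k] by (simp add: norm_divide)
  then have \<theta>1: "cnj (\<theta> k) * \<theta> k = 1" for k by (metis complex_norm_square mult.commute of_real_1 one_power2)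
  define U where "U = V ** diag_mat \<theta>"
  have "unitary_mat (diag_mat \<theta>)" by (simp add: unitary_mat_def diag_mat_diag_mat \<theta>1)
  then have "unitary_mat U" unfolding U_def by (rule unitary_mat_closed(3)[OF V])
  moreover have "takagi d U = V ** S ** transpose V"
  proof -
    have "takagi d U = V ** (diag_mat \<theta> ** (diag_mat (\<lambda>k. complex_of_real (d k)) ** diag_mat \<theta>)) ** transpose V"
      by (simp add: takagi_def U_def matrix_transpose_mul matrix_mul_assoc)
    then show ?thesis by (simp add: diag_mat_diag_mat \<theta>2 s)
  qed
  then have "takagi d U = W"
    by (simp add: S_def matrix_mul_assoc[symmetric] unitary_mat_mult[OF V] unitary_mat_cancel[OF V])
  ultimately show thesis using that by simp
qed

lemma takagi_sign: "sign_function s \<Longrightarrow> takagi d (U ** diag_mat s) = takagi d U"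
proof -
  assume s: "sign_function s"
  have "takagi d (U ** diag_mat s)
      = U ** (diag_mat s ** (diag_mat (\<lambda>k. complex_of_real (d k)) ** diag_mat s)) ** transpose U"
    by (simp add: takagi_def matrix_transpose_mul matrix_mul_assoc)
  moreover have "s k * (complex_of_real (d k) * s k) = complex_of_real (d k)" for k
    using s[unfolded sign_function_def, THEN spec, of k] by auto
  ultimately show ?thesis by (simp add: diag_mat_diag_mat takagi_def)
qed

lemma unitary_sign: "sign_function s \<Longrightarrow> unitary_mat (diag_mat s)"
proof -
  assume "sign_function s"
  then have "cnj (s k) * s k = 1" for k by (auto simp: sign_function_def dest: spec[of _ k])
  then show ?thesis by (simp add: unitary_mat_def diag_mat_diag_mat)
qed

text \<open>The matrix \<open>S = adj_mat U ** V\<close> satisfies \<open>S D S^T = D\<close>, that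
  is \<open>S D = D cnj S\<close>. Together with the conjugate equation this makes \<open>S\<close>
  commute with the square of \<open>D\<close>, whose entries are distinct; so \<open>S\<close> is
  diagonal, and then its entries have square 1.\<close>

lemma takagi_eqD:
  fixes U V :: "complex^'n^'n"
  assumes U: "unitary_mat U" and V: "unitary_mat V"
    and d: "\<And>k. 0 < d k" and inj: "inj d"
    and eq: "takagi d U = takagi d V"
  obtains s where "sign_function s" "V = U ** diag_mat s"
proof -
  let ?D = "diag_mat (\<lambda>k. complex_of_real (d k))"
  define S where "S = adj_mat U ** V"
  have VS: "V = U ** S" by (simp add: S_def unitary_mat_cancel[OF U])
  have S: "unitary_mat S" unfolding S_def by (rule unitary_mat_closed(3)[OF unitary_mat_closed(1)[OF U] V])
  have "adj_mat U ** takagi d V ** cnj_mat U = ?D"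
    unfolding eq[symmetric] by (simp add: takagi_def matrix_mul_assoc[symmetric] unitary_mat_cancel[OF U] unitary_mat_mult[OF U])
  then have SD: "S ** ?D ** transpose S = ?D"
    by (simp add: takagi_def S_def matrix_transpose_mul matrix_mul_assoc)
  then have SD': "S ** ?D = ?D ** cnj_mat S"
    by (metis matrix_mul_assoc matrix_mul_rid unitary_mat_mult(3)[OF S])
  have "cnj_mat S ** ?D = ?D ** S" using arg_cong[OF SD', of cnj_mat] by simp
  with SD' have "S ** (?D ** ?D) = ?D ** ?D ** S" by (metis matrix_mul_assoc)
  then have "S ** diag_mat (\<lambda>k. complex_of_real (d k * d k)) = diag_mat (\<lambda>k. complex_of_real (d k * d k)) ** S"
    by (simp add: diag_mat_diag_mat)
  moreover have "inj (\<lambda>k. complex_of_real (d k * d k))"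
  proof (rule injI)
    fix j k assume "complex_of_real (d j * d j) = complex_of_real (d k * d k)"
    then have "(d j)\<^sup>2 = (d k)\<^sup>2" unfolding of_real_eq_iff power2_eq_square .
    then have "d j = d k" using d[of j] d[of k] by (simp add: power2_eq_iff_nonneg)
    then show "j = k" using inj by (simp add: inj_eq)
  qed
  ultimately have "S = diag_mat (\<lambda>k. S $ k $ k)" by (rule commutes_diag_imp_diag)
  then obtain s where s: "S = diag_mat s" by blast
  have "s k * complex_of_real (d k) * s k = complex_of_real (d k)" for k
  proof -
    have "diag_mat (\<lambda>k. s k * complex_of_real (d k) * s k) $ k $ k = ?D $ k $ k"
      using SD unfolding s by (simp add: diag_mat_diag_mat)
    then show ?thesis by (simp add: diag_mat_def)
  qed
  then have "(s k * s k) * complex_of_real (d k) = 1 * complex_of_real (d k)" for k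
    by (metis mult.commute mult.left_commute mult_1)
  then have "s k * s k = 1" for k using d[of k] mult_right_cancel by (metis less_irrefl of_real_eq_0_iff)
  then have "sign_function s" by (simp add: sign_function_def square_eq_1_iff)
  then show thesis using that VS s by blast
qed

lemma siegel_point_eq_iff:
  fixes U V :: "complex^'n^'n"
  assumes U: "unitary_mat U" and V: "unitary_mat V"
    and d: "\<And>k. 0 < d k" "\<And>k. d k < 1" and inj: "inj d"
  shows "siegel_point d U = siegel_point d V \<longleftrightarrow> (\<exists>s. sign_function s \<and> V = U ** diag_mat s)"
proof
  assume eq: "siegel_point d U = siegel_point d V"
  have d': "\<bar>d k\<bar> < 1" for k using d[of k] by simp
  have "cayley (takagi d U) = cayley (takagi d V)"
    using arg_cong[OF eq, of "\<lambda>X. mat (- \<i>) ** X"] by (simp add: siegel_point_def mat_mult_mat_assoc)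
  then have "takagi d U = takagi d V"
    using cayley_inv_cayley(2)[OF contraction_mat_invertible[OF takagi_contraction[where d=d, OF d' U]]]
      cayley_inv_cayley(2)[OF contraction_mat_invertible[OF takagi_contraction[where d=d, OF d' V]]] by metis
  then show "\<exists>s. sign_function s \<and> V = U ** diag_mat s"
    using takagi_eqD[OF U V d(1) inj] by metis
next
  assume "\<exists>s. sign_function s \<and> V = U ** diag_mat s"
  then show "siegel_point d U = siegel_point d V" by (auto simp: siegel_point_def takagi_sign)
qed

lemma siegel_orbit_eq_image:
  fixes d :: "'n::finite \<Rightarrow> real"
  assumes d: "\<And>k. 0 < d k" "\<And>k. d k < 1" and inj: "inj d"
  shows "siegel_orbit (\<chi> k. (d k)\<^sup>2) = siegel_point d ` {U. unitary_mat U}"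
proof -
  have d': "\<bar>d k\<bar> < 1" for k using d[of k] by simp
  \<comment> \<open>Every disc representative of \<open>Z\<close> gives the same cross-ratio, since
    \<open>cayley\<close> is injective where \<open>mat 1 - W\<close> is invertible.\<close>
  have cr: "cross_ratio Z (mat \<i>) = W ** cnj_mat W"
    if Z: "Z \<in> siegel_half_space" "Z = mat \<i> ** cayley W" "invertible (mat 1 - W)" for Z W :: "complex^'n^'n"
  proof -
    obtain W' where W': "invertible (mat 1 - W')" "Z = mat \<i> ** cayley W'" "cross_ratio Z (mat \<i>) = W' ** cnj_mat W'"
      using siegel_half_space_disc[OF Z(1)] by metis
    have "cayley W = cayley W'"
      using arg_cong[OF trans[OF Z(2)[symmetric] W'(2)], of "\<lambda>X. mat (- \<i>) ** X"]
      by (simp add: mat_mult_mat_assoc)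
    then have "W = W'" using cayley_inv_cayley(2) Z(3) W'(1) by metis
    then show ?thesis using W' by simp
  qed
  show ?thesis
  proof (intro set_eqI iffI)
    fix Z :: "complex^'n^'n" assume "Z \<in> siegel_orbit (\<chi> k. (d k)\<^sup>2)"
    then have Z: "Z \<in> siegel_half_space"
      "eigenvalues (cross_ratio Z (mat \<i>)) = range (\<lambda>k. complex_of_real ((d k)\<^sup>2))"
      by (auto simp: siegel_orbit_def)
    obtain W where W: "transpose W = W" "Z = mat \<i> ** cayley W" "cross_ratio Z (mat \<i>) = W ** cnj_mat W"
      using siegel_half_space_disc[OF Z(1)] by metis
    obtain U where "unitary_mat U" "W = takagi d U"
      using takagi_factorisation[OF W(1) d(1) inj] Z(2) W(3) by (metis order_refl)
    then show "Z \<in> siegel_point d ` {U. unitary_mat U}" using W(2) by (auto simp: siegel_point_def)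
  next
    fix Z assume "Z \<in> siegel_point d ` {U. unitary_mat U}"
    then obtain U where U: "unitary_mat U" "Z = mat \<i> ** cayley (takagi d U)"
      by (auto simp: siegel_point_def)
    note c = takagi_contraction[where d=d, OF d' U(1)]
    have Z: "Z \<in> siegel_half_space" unfolding U(2) by (rule siegel_half_space_cayley[OF transpose_takagi c])
    show "Z \<in> siegel_orbit (\<chi> k. (d k)\<^sup>2)"
      using Z cr[OF Z U(2) contraction_mat_invertible[OF c]] eigenvalues_takagi[OF U(1), of d]
      by (simp add: siegel_orbit_def)
  qed
qed

section \<open>The metric on the orbits\<close>

lemma trace_conjugate_cancel:
  fixes P Q M :: "complex^'n^'n"
  assumes "Q ** P = mat 1"
  shows "trace (P ** M ** Q) = trace M"
proof -
  have "trace (P ** M ** Q) = trace (Q ** (P ** M))" by (rule trace_mul_sym)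
  then show ?thesis using assms by (simp add: matrix_mul_assoc)
qed

text \<open>The arguments are \<open>dZ\<close> for \<open>dW = U w U^T\<close>, with
  \<open>2 * \<i>\<close> coming from the derivative of the Cayley transform. Once the inverse of
  the imaginary part is inserted, the resolvents and \<open>U\<close> cancel, partly by cyclicity of
  the trace, and only the diagonal \<open>G\<close>, the inverse of \<open>1 - D^2\<close>,
  remains.\<close>

lemma siegel_metric_orbit:
  fixes U w w' :: "complex^'n^'n"
  assumes d: "\<And>k. \<bar>d k\<bar> < 1" and U: "unitary_mat U"
  defines "A \<equiv> matrix_inv (mat 1 - takagi d U)"
  assumes w': "transpose w' = w'"
  shows "siegel_metric (siegel_point d U)
      (mat (2 * \<i>) ** (A ** (U ** w ** transpose U) ** A)) (mat (2 * \<i>) ** (A ** (U ** w' ** transpose U) ** A))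
    = (\<Sum>k\<in>UNIV. \<Sum>l\<in>UNIV. 4 * Re (w $ k $ l * cnj (w' $ k $ l)) / ((1 - (d k)\<^sup>2) * (1 - (d l)\<^sup>2)))"
proof -
  define W where "W = takagi d U"
  define B where "B = mat 1 - W"
  define gk where "gk k = complex_of_real (1 / (1 - (d k)\<^sup>2))" for k
  define G where "G = diag_mat gk"
  define E where "E = cnj_mat U ** G ** transpose U"
  let ?Z = "siegel_point d U"
  let ?X = "U ** w ** transpose U" and ?X' = "U ** w' ** transpose U"
  have A: "A = matrix_inv B" by (simp add: A_def B_def W_def)
  have c: "contraction_mat W" unfolding W_def by (rule takagi_contraction[where d=d, OF d U])
  have invB: "invertible B" unfolding B_def by (rule contraction_mat_invertible[OF c])
  have tW: "transpose W = W" by (simp add: W_def transpose_takagi)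
  have tB: "transpose B = B" by (simp add: B_def transpose_simps tW)
  have AB: "A ** B = mat 1" "B ** A = mat 1" using matrix_inv_mult[OF invB] by (simp_all add: A)
  have cAB: "cnj_mat A ** cnj_mat B = mat 1" "cnj_mat B ** cnj_mat A = mat 1"
    using AB by (metis cnj_mat_simps(1,4) complex_cnj_one)+
  note Z_eq = siegel_point_def[of d U, folded W_def]
  have ZH: "?Z \<in> siegel_half_space" unfolding Z_eq by (rule siegel_half_space_cayley[OF tW c])
  have Y: "complex_mat (Im_mat ?Z) = cnj_mat A ** (mat 1 - cnj_mat W ** W) ** A"
    unfolding Z_eq using siegel_Im(2)[OF tW c] by (simp add: A B_def)
  have d1: "1 - (d k)\<^sup>2 \<noteq> 0" for k using d[of k] by (metis abs_square_less_1 diff_gt_0_iff_gt less_irrefl)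
  have E: "(mat 1 - cnj_mat W ** W) ** E = mat 1"
  proof -
    let ?L = "diag_mat (\<lambda>k. complex_of_real ((d k)\<^sup>2))"
    have "mat 1 - cnj_mat W ** W = cnj_mat U ** (mat 1 - ?L) ** transpose U"
      unfolding W_def takagi_cnj_product[OF U] by (simp add: matrix_distribs unitary_mat_mult[OF U])
    then have "(mat 1 - cnj_mat W ** W) ** E = cnj_mat U ** ((mat 1 - ?L) ** G) ** transpose U"
      by (simp add: E_def matrix_mul_assoc[symmetric] unitary_mat_cancel[OF U])
    moreover have "(mat 1 - ?L) ** G = mat 1"
    proof -
      have "mat 1 - ?L = diag_mat (\<lambda>k. complex_of_real (1 - (d k)\<^sup>2))"
        by (simp add: diag_mat_def mat_def vec_eq_iff)
      then have "(mat 1 - ?L) ** G = diag_mat (\<lambda>k. complex_of_real (1 - (d k)\<^sup>2) * gk k)"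
        by (simp only: G_def diag_mat_diag_mat)
      also have "complex_of_real (1 - (d k)\<^sup>2) * gk k = 1" for k
        unfolding gk_def using d1[of k] by (simp only: of_real_mult[symmetric]) simp
      then have "diag_mat (\<lambda>k. complex_of_real (1 - (d k)\<^sup>2) * gk k) = mat 1"
        by (simp only: diag_mat_simps(2))
      finally show ?thesis .
    qed
    ultimately show ?thesis by (simp add: unitary_mat_mult[OF U])
  qed
  define I where "I = complex_mat (matrix_inv (Im_mat ?Z))"
  have "complex_mat (Im_mat ?Z) ** (B ** E ** cnj_mat B) = cnj_mat A ** ((mat 1 - cnj_mat W ** W) ** ((A ** B) ** E)) ** cnj_mat B"
    unfolding Y by (simp add: matrix_mul_assoc)
  then have "complex_mat (Im_mat ?Z) ** (B ** E ** cnj_mat B) = mat 1" by (simp add: AB E cAB)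
  then have I1: "I = B ** E ** cnj_mat B"
    using complex_mat_inv_Im(1)[OF ZH] unfolding I_def by (metis matrix_mul_assoc matrix_mul_lid matrix_mul_rid)
  have tI: "transpose I = I"
  proof -
    have "transpose (Im_mat ?Z) = Im_mat ?Z" using ZH by (simp add: siegel_half_space_def)
    then have "transpose (matrix_inv (Im_mat ?Z)) = matrix_inv (Im_mat ?Z)"
      using transpose_matrix_inv[OF complex_mat_inv_Im(3)[OF ZH]] by simp
    then show ?thesis by (simp add: I_def transpose_complex_mat)
  qed
  have tcB: "transpose (cnj_mat B) = cnj_mat B" by (metis tB transpose_cnj_mat(1,2))
  \<comment> \<open>The symmetric matrix \<open>I\<close> is now known in two forms. Using one on
    each side of the first tangent vector puts \<open>B\<close> next to both of its factors
    \<open>A\<close>, which cancel.\<close>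
  have I2: "I = cnj_mat B ** transpose E ** B"
    using arg_cong[OF I1, of transpose] unfolding tI by (simp add: matrix_transpose_mul tB tcB matrix_mul_assoc)
  have tE: "transpose E = U ** G ** adj_mat U"
    by (simp add: E_def matrix_transpose_mul G_def matrix_mul_assoc transpose_cnj_mat)
  let ?V = "mat (2 * \<i>) ** (A ** ?X ** A)" and ?V' = "mat (2 * \<i>) ** (A ** ?X' ** A)"
  have "I ** ?V ** I ** cnj_mat ?V' = mat 4 ** ((cnj_mat B ** transpose E ** B) ** (A ** ?X ** A) ** (B ** E ** cnj_mat B) ** (cnj_mat A ** cnj_mat ?X' ** cnj_mat A))"
  proof -
    have "I ** ?V ** I ** cnj_mat ?V' = I ** (mat (2 * \<i>) ** (A ** ?X ** A)) ** (I ** (mat (- 2 * \<i>) ** cnj_mat (A ** ?X' ** A)))"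
      by (simp add: matrix_mul_assoc)
    also have "\<dots> = mat 4 ** (I ** (A ** ?X ** A) ** (I ** cnj_mat (A ** ?X' ** A)))"
      unfolding mat_mult_left_commute[of I]
      by (simp only: matrix_mul_assoc[symmetric] mat_mult_left_commute[of A] mat_mult_left_commute[of U] mat_mult_left_commute[of w]
          mat_mult_left_commute[of "transpose U"] mat_mult_left_commute[of I] mat_mult_mat_assoc) simp
    also have "I ** (A ** ?X ** A) ** (I ** cnj_mat (A ** ?X' ** A)) = (cnj_mat B ** transpose E ** B) ** (A ** ?X ** A) ** ((B ** E ** cnj_mat B) ** cnj_mat (A ** ?X' ** A))"
      using I1 I2 by metis
    finally show ?thesis by (simp add: matrix_mul_assoc)
  qed
  also have "(cnj_mat B ** transpose E ** B) ** (A ** ?X ** A) ** (B ** E ** cnj_mat B) ** (cnj_mat A ** cnj_mat ?X' ** cnj_mat A)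
     = cnj_mat B ** (transpose E ** (B ** A) ** ?X ** (A ** B) ** E ** (cnj_mat B ** cnj_mat A) ** cnj_mat ?X') ** cnj_mat A"
    by (simp only: matrix_mul_assoc)
  also have "\<dots> = cnj_mat B ** (transpose E ** ?X ** E ** cnj_mat ?X') ** cnj_mat A"
    by (simp only: AB cAB matrix_mul_rid)
  also have "transpose E ** ?X ** E ** cnj_mat ?X' = U ** (G ** w ** G ** cnj_mat w') ** adj_mat U"
    unfolding tE by (simp add: E_def matrix_mul_assoc[symmetric] unitary_mat_cancel[OF U] transpose_cnj_mat)
  finally have eq: "I ** ?V ** I ** cnj_mat ?V' = mat 4 ** (cnj_mat B ** (U ** (G ** w ** G ** cnj_mat w') ** adj_mat U) ** cnj_mat A)" .
  have tr4: "trace (mat 4 ** M) = 4 * trace M" for M :: "complex^'n^'n"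
    by (simp add: trace_def mat_mult_left sum_distrib_left)
  have "trace (I ** ?V ** I ** cnj_mat ?V') = 4 * trace (G ** w ** G ** cnj_mat w')"
    unfolding eq tr4 trace_conjugate_cancel[OF cAB(1)] trace_conjugate_cancel[OF unitary_mat_mult(1)[OF U]] ..
  also have "trace (G ** w ** G ** cnj_mat w') = (\<Sum>k\<in>UNIV. \<Sum>l\<in>UNIV. gk k * w $ k $ l * gk l * cnj (w' $ l $ k))"
    unfolding G_def diag_mat_mult by (simp add: trace_def matrix_matrix_mult_def cnj_mat_def)
  also have "\<dots> = (\<Sum>k\<in>UNIV. \<Sum>l\<in>UNIV. gk k * w $ k $ l * gk l * cnj (w' $ k $ l))"
    using w' by (simp add: transpose_def vec_eq_iff)
  finally have "trace (I ** ?V ** I ** cnj_mat ?V') = (\<Sum>k\<in>UNIV. \<Sum>l\<in>UNIV. 4 * (gk k * w $ k $ l * gk l * cnj (w' $ k $ l)))"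
    by (simp only: sum_distrib_left)
  moreover have "Re (4 * (gk k * w $ k $ l * gk l * cnj (w' $ k $ l))) = 4 * Re (w $ k $ l * cnj (w' $ k $ l)) / ((1 - (d k)\<^sup>2) * (1 - (d l)\<^sup>2))" for k l
  proof -
    have "4 * (gk k * w $ k $ l * gk l * cnj (w' $ k $ l)) = complex_of_real (4 / ((1 - (d k)\<^sup>2) * (1 - (d l)\<^sup>2))) * (w $ k $ l * cnj (w' $ k $ l))"
      by (simp add: gk_def)
    moreover have "Re (complex_of_real r * z) = r * Re z" for r z by simp
    ultimately show ?thesis by (simp only: times_divide_eq_left)
  qed
  ultimately show ?thesis unfolding siegel_metric_def Let_def I_def[symmetric] by (simp only: Re_sum)
qed

section \<open>Parametrisations of the orbits\<close>

text \<open>Coordinates on the Lie algebra of the unitary group. For \<open>k < l\<close> the real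
  part of the entry sits at \<open>(k, l)\<close> and the imaginary part at the otherwise free index
  \<open>(l, k)\<close>, so every index pair is used exactly once.\<close>

definition skew :: "real^('n::{finite,linorder} \<times> 'n) \<Rightarrow> complex^'n::_^'n::_" where
  "skew x = (\<chi> k l. if k < l then Complex (x $ (k, l)) (x $ (l, k))
     else if l < k then Complex (- (x $ (l, k))) (x $ (k, l)) else Complex 0 (x $ (k, k)))"

definition unskew :: "complex^'n::_^'n::_ \<Rightarrow> real^('n::{finite,linorder} \<times> 'n)" where
  "unskew K = (\<chi> p. if fst p < snd p then Re (K $ fst p $ snd p) else Im (K $ fst p $ snd p))"

lemma adj_skew: "adj_mat (skew x) = - skew x"
  by (auto simp: skew_def adj_mat_def vec_eq_iff complex_eq_iff)

lemma unskew_skew: "unskew (skew x) = x"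
  by (auto simp: skew_def unskew_def vec_eq_iff)

lemma skew_unskew:
  assumes "adj_mat K = - K"
  shows "skew (unskew K) = K"
proof -
  have *: "cnj (K $ l $ k) = - K $ k $ l" for k l
    using arg_cong[OF assms, of "\<lambda>A. A $ k $ l"] by (simp add: adj_mat_def)
  have R: "Re (K $ l $ k) = - Re (K $ k $ l)" for k l using arg_cong[OF *[of l k], of Re] by simp
  have I: "Im (K $ l $ k) = Im (K $ k $ l)" for k l using arg_cong[OF *[of l k], of Im] by simp
  have "skew (unskew K) $ k $ l = K $ k $ l" for k l
    using R[of k l] I[of k l] by (cases k l rule: linorder_cases) (auto simp: skew_def unskew_def complex_eq_iff)
  then show ?thesis by (simp add: vec_eq_iff)
qed

lemma linear_skew: "linear skew" "linear unskew"
  by (intro linearI; auto simp: skew_def unskew_def vec_eq_iff complex_eq_iff)+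

lemma continuous_on_skew [continuous_intros]:
  "continuous_on S f \<Longrightarrow> continuous_on S (\<lambda>x. skew (f x))"
  "continuous_on S g \<Longrightarrow> continuous_on S (\<lambda>x. unskew (g x))"
  using linear_skew[unfolded linear_conv_bounded_linear] by (auto intro: bounded_linear.continuous_on)

definition skew_resolvent :: "real^('n::{finite,linorder} \<times> 'n) \<Rightarrow> complex^'n::_^'n::_" where
  "skew_resolvent u = matrix_inv (mat 1 - skew u)"

text \<open>
  In the coordinates \<open>skew\<close>, the left-invariant form \<open>c\<^sup>-\<^sup>1 dc\<close> of the Cayley
  chart \<open>c = cayley (skew u)\<close> of the unitary group.
\<close>

definition frame :: "real^('n::{finite,linorder} \<times> 'n) \<Rightarrow> real^('n \<times> 'n) \<Rightarrow> real^('n \<times> 'n)" where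
  "frame u h = unskew (mat 2 ** (adj_mat (skew_resolvent u) ** skew h ** skew_resolvent u))"

lemma skew_resolvent_mult:
  "(mat 1 - skew u) ** skew_resolvent u = mat 1" "skew_resolvent u ** (mat 1 - skew u) = mat 1"
  "invertible (mat 1 - skew u)" "invertible (skew_resolvent u)" "invertible (adj_mat (skew_resolvent u))"
proof -
  show inv: "invertible (mat 1 - skew u)" by (rule skew_resolventertible(1)[OF adj_skew])
  then show "(mat 1 - skew u) ** skew_resolvent u = mat 1" "skew_resolvent u ** (mat 1 - skew u) = mat 1"
    "invertible (skew_resolvent u)"
    by (auto simp: skew_resolvent_def matrix_inv_mult invertible_matrix_inv)
  then show "invertible (adj_mat (skew_resolvent u))" using adj_matrix_inv(2) by blast
qed

lemma skew_frame: "skew (frame u h) = mat 2 ** (adj_mat (skew_resolvent u) ** skew h ** skew_resolvent u)"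
proof -
  have "adj_mat (mat 2 ** (adj_mat (skew_resolvent u) ** skew h ** skew_resolvent u)) =
     - (mat 2 ** (adj_mat (skew_resolvent u) ** skew h ** skew_resolvent u))"
    by (simp add: adj_mat_mult adj_skew matrix_mul_assoc matrix_minus_left matrix_minus_right mat_mult_right)
  then show ?thesis unfolding frame_def by (rule skew_unskew)
qed

lemma linear_frame: "linear (frame u)"
proof -
  have "linear (\<lambda>h. mat 2 ** (adj_mat (skew_resolvent u) ** skew h ** skew_resolvent u))"
    by (intro linearI)
      (simp_all add: linear_add[OF linear_skew(1)] linear_cmul[OF linear_skew(1)] matrix_distribs matrix_mult_scaleR)
  then show ?thesis unfolding frame_def[abs_def]
    using linear_compose[OF _ linear_skew(2)] by (simp add: o_def)
qed

lemma frame_eq_0_iff: "frame u h = 0 \<longleftrightarrow> h = 0"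
proof
  assume "frame u h = 0"
  then have "mat (1/2) ** skew (frame u h) = 0" by (simp add: matrix_mult_zero linear_0[OF linear_skew(1)])
  then have "adj_mat (skew_resolvent u) ** (skew h ** skew_resolvent u) = 0"
    unfolding skew_frame mat_mult_mat_assoc by (simp add: matrix_mul_assoc)
  then have "skew h ** skew_resolvent u = 0"
    using matrix_inv_cancel(2)[OF skew_resolvent_mult(5)] by (metis matrix_mult_zero(2))
  then have "skew h = 0"
    using skew_resolvent_mult(1,2) by (metis matrix_mult_zero(1) matrix_left_right_inverse matrix_mul_assoc matrix_mul_rid)
  then show "h = 0" by (metis linear_0 linear_skew(2) unskew_skew)
qed (simp add: linear_0[OF linear_frame])

lemma det_frame: "det (matrix (frame u)) \<noteq> 0"
  by (simp add: det_nz_iff_inj[OF linear_frame] linear_injective_0[OF linear_frame] frame_eq_0_iff)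

lemma continuous_on_skew_resolvent: "continuous_on S skew_resolvent"
  unfolding skew_resolvent_def[abs_def]
  by (intro continuous_on_matrix_inv continuous_intros skew_resolvent_mult)

lemma continuous_on_frame: "continuous_on S (\<lambda>u. frame u h)"
  unfolding frame_def by (intro continuous_intros continuous_on_matrix_mult continuous_on_skew_resolvent)

lemma continuous_on_det_frame: "continuous_on S (\<lambda>u. det (matrix (frame u)))"
  unfolding matrix_def
  by (intro continuous_on_det) (auto intro!: continuous_intros continuous_on_frame)

text \<open>With \<open>K = skew u\<close> and \<open>R\<close> its resolvent,
  \<open>adj_mat R\<close> is the inverse of \<open>1 + K\<close>, while
  \<open>cayley K = R (1 + K)\<close>. This turns the derivative \<open>2 R dK R\<close> of the
  Cayley transform into \<open>cayley K\<close> times a skew-Hermitian matrix, which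
  \<open>frame\<close> records.\<close>

lemma cayley_skew_adj: "cayley (skew u) ** adj_mat (skew_resolvent u) = skew_resolvent u"
proof -
  have "adj_mat (skew_resolvent u) = matrix_inv (mat 1 + skew u)"
    using adj_matrix_inv(1)[OF skew_resolvent_mult(3)] by (simp add: skew_resolvent_def adj_skew)
  moreover have "cayley (skew u) = skew_resolvent u ** (mat 1 + skew u)"
    using cayley_eq(1,3)[OF skew_resolvent_mult(3)[of u]] by (simp add: skew_resolvent_def matrix_distribs mat_2_mult)
  ultimately show ?thesis
    using matrix_inv_mult(1)[OF skew_resolventertible(2)[OF adj_skew[of u]]] by (simp add: matrix_mul_assoc[symmetric])
qed

lemma has_derivative_cayley_skew:
  "((\<lambda>u. cayley (skew u)) has_derivative (\<lambda>h. cayley (skew u) ** skew (frame u h))) (at u)"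
proof -
  have "(skew has_derivative skew) (at u)"
    using linear_skew(1) linear_conv_bounded_linear bounded_linear_imp_has_derivative by blast
  note has_derivative_cayley[OF skew_resolvent_mult(3) this, folded skew_resolvent_def]
  moreover have "mat 2 ** (skew_resolvent u ** skew h ** skew_resolvent u) = cayley (skew u) ** skew (frame u h)" for h
    unfolding skew_frame mat_mult_left_commute by (simp add: matrix_mul_assoc cayley_skew_adj)
  ultimately show ?thesis by simp
qed

lemma unitary_cayley_skew: "unitary_mat (cayley (skew u))"
  by (rule unitary_cayley(1)[OF adj_skew])

section \<open>Charts of the orbits and the pulled-back metric\<close>

definition chart :: "('n \<Rightarrow> real) \<Rightarrow> complex^'n::_^'n::_ \<Rightarrow> real^('n::{finite,linorder} \<times> 'n) \<Rightarrow> complex^'n::_^'n::_" where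
  "chart d V u = siegel_point d (V ** cayley (skew u))"

definition tangent :: "('n \<Rightarrow> real) \<Rightarrow> real^('n::{finite,linorder} \<times> 'n) \<Rightarrow> complex^'n::_^'n::_" where
  "tangent d x = skew x ** diag_mat (\<lambda>k. complex_of_real (d k)) + diag_mat (\<lambda>k. complex_of_real (d k)) ** transpose (skew x)"

definition chart_derivative ::
    "('n \<Rightarrow> real) \<Rightarrow> complex^'n::_^'n::_ \<Rightarrow> real^('n::{finite,linorder} \<times> 'n) \<Rightarrow> real^('n \<times> 'n) \<Rightarrow> complex^'n::_^'n::_" where
  "chart_derivative d V u h =
    (let U = V ** cayley (skew u); A = matrix_inv (mat 1 - takagi d U)
     in mat (2 * \<i>) ** (A ** (U ** tangent d (frame u h) ** transpose U) ** A))"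

lemma has_derivative_chart:
  assumes d: "\<And>k. \<bar>d k\<bar> < 1" and V: "unitary_mat V"
  shows "(chart d V has_derivative chart_derivative d V u) (at u)"
proof -
  let ?D = "diag_mat (\<lambda>k. complex_of_real (d k))"
  let ?U = "\<lambda>u. V ** cayley (skew u)"
  have U: "unitary_mat (?U u)" by (rule unitary_mat_closed(3)[OF V unitary_cayley_skew])
  have dU: "(?U has_derivative (\<lambda>h. ?U u ** skew (frame u h))) (at u)"
    using has_derivative_matrix_mult[OF has_derivative_const has_derivative_cayley_skew, of V]
    by (simp add: matrix_mul_assoc)
  have dUt: "((\<lambda>u. transpose (?U u)) has_derivative (\<lambda>h. transpose (?U u ** skew (frame u h)))) (at u)"
    using bounded_linear.has_derivative[OF linear_transpose[unfolded linear_conv_bounded_linear] dU] .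
  have "((\<lambda>u. takagi d (?U u)) has_derivative
      (\<lambda>h. ?U u ** ?D ** transpose (?U u ** skew (frame u h)) + (?U u ** skew (frame u h)) ** ?D ** transpose (?U u))) (at u)"
    unfolding takagi_def
    using has_derivative_matrix_mult[OF has_derivative_matrix_mult[OF dU has_derivative_const[of ?D]] dUt]
    by simp
  moreover have "?U u ** ?D ** transpose (?U u ** skew (frame u h)) + (?U u ** skew (frame u h)) ** ?D ** transpose (?U u)
     = ?U u ** tangent d (frame u h) ** transpose (?U u)" for h
  proof -
    let ?X = "?U u" and ?s = "skew (frame u h)"
    have "?X ** ?D ** transpose (?X ** ?s) + (?X ** ?s) ** ?D ** transpose ?X
      = ?X ** (?s ** ?D + ?D ** transpose ?s) ** transpose ?X" for X
      unfolding matrix_transpose_mul[of ?X ?s] matrix_add_ldistrib matrix_add_rdistrib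
      by (simp only: matrix_mul_assoc add.commute)
    then show ?thesis by (simp add: tangent_def)
  qed
  ultimately have dT: "((\<lambda>u. takagi d (?U u)) has_derivative (\<lambda>h. ?U u ** tangent d (frame u h) ** transpose (?U u))) (at u)"
    by simp
  note has_derivative_cayley[OF contraction_mat_invertible[OF takagi_contraction[where d=d, OF d U]] dT]
  from has_derivative_matrix_mult[OF has_derivative_const[of "mat \<i>"] this]
  show ?thesis
    unfolding chart_def[abs_def] siegel_point_def chart_derivative_def[abs_def] Let_def
    by (simp add: mat_mult_mat_assoc mult.commute)
qed

text \<open>The numerators are the 4 of the metric times the squared factors that
  \<open>tangent\<close> attaches to real and imaginary parts. Off the diagonal each coordinate
  occurs in two entries of a symmetric matrix, giving 8; on the diagonal the factor
  \<open>2 * d k\<close> gives 16.\<close>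

definition weight :: "('n \<Rightarrow> real) \<Rightarrow> 'n \<times> 'n::linorder \<Rightarrow> real" where
  "weight d = (\<lambda>(k, l).
     (if k < l then 8 * (d l - d k)\<^sup>2 else if l < k then 8 * (d l + d k)\<^sup>2 else 16 * (d k)\<^sup>2)
       / ((1 - (d k)\<^sup>2) * (1 - (d l)\<^sup>2)))"

lemma transpose_tangent: "transpose (tangent d x) = tangent d x"
  by (simp add: tangent_def transpose_simps matrix_transpose_mul add.commute)

text \<open>Off the diagonal an entry of \<open>tangent\<close> has one coordinate in its real part
  and the mirrored one in its imaginary part, scaled up to sign by \<open>d l - d k\<close> and
  \<open>d l + d k\<close>. The real part of a product with a conjugate pairs like with like, so
  there are no cross terms.\<close>

lemma tangent_form:
  "(\<Sum>k\<in>UNIV. \<Sum>l\<in>UNIV. 4 * Re (tangent d x $ k $ l * cnj (tangent d y $ k $ l)) / ((1 - (d k)\<^sup>2) * (1 - (d l)\<^sup>2)))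
    = (\<Sum>p\<in>UNIV. weight d p * x $ p * y $ p)"
proof -
  define c where "c k l = 4 / ((1 - (d k)\<^sup>2) * (1 - (d l)\<^sup>2))" for k l
  define a where "a k l = x $ (k, l) * y $ (k, l)" for k l
  \<comment> \<open>\<open>t\<close> is the coefficient with which coordinate (k, l) contributes to
    the entry (k, l), \<open>t'\<close> that of the mirrored coordinate in the same entry. Swapping
    the summation indices in the second sum merges both into \<open>weight\<close>.\<close>
  define t where "t k l = (if k < l then c k l * (d l - d k)\<^sup>2 else if l < k then c k l * (d l + d k)\<^sup>2 else c k k * (2 * d k)\<^sup>2)" for k l
  define t' where "t' k l = (if k < l then c k l * (d l + d k)\<^sup>2 else if l < k then c k l * (d l - d k)\<^sup>2 else 0)" for k l
  have tan: "tangent d z $ k $ l = (if k < l then Complex (z $ (k, l) * (d l - d k)) (z $ (l, k) * (d l + d k))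
    else if l < k then Complex (z $ (l, k) * (d k - d l)) (z $ (k, l) * (d k + d l)) else Complex 0 (z $ (k, k) * (2 * d k)))" for z k l
    by (auto simp: tangent_def diag_mat_mult transpose_def skew_def complex_eq_iff algebra_simps)
  have 1: "4 * Re (tangent d x $ k $ l * cnj (tangent d y $ k $ l)) / ((1 - (d k)\<^sup>2) * (1 - (d l)\<^sup>2)) = t k l * a k l + t' k l * a l k" for k l
  proof -
    have "4 * Re (tangent d x $ k $ l * cnj (tangent d y $ k $ l)) / ((1 - (d k)\<^sup>2) * (1 - (d l)\<^sup>2)) = c k l * Re (tangent d x $ k $ l * cnj (tangent d y $ k $ l))"
      by (simp add: c_def)
    also have "\<dots> = t k l * a k l + t' k l * a l k"
      unfolding tan t_def t'_def a_def by (cases k l rule: linorder_cases) (simp_all add: power2_eq_square algebra_simps)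
    finally show ?thesis .
  qed
  have 2: "t k l + t' l k = weight d (k, l)" for k l
    by (auto simp: t_def t'_def weight_def c_def power2_commute add.commute mult.commute power_mult_distrib)
  have "(\<Sum>k\<in>UNIV. \<Sum>l\<in>UNIV. t k l * a k l + t' k l * a l k)
    = (\<Sum>k\<in>UNIV. \<Sum>l\<in>UNIV. t k l * a k l) + (\<Sum>k\<in>UNIV. \<Sum>l\<in>UNIV. t' k l * a l k)"
    by (simp add: sum.distrib)
  also have "(\<Sum>k\<in>UNIV. \<Sum>l\<in>UNIV. t' k l * a l k) = (\<Sum>l\<in>UNIV. \<Sum>k\<in>UNIV. t' k l * a l k)" by (rule sum.swap)
  also have "(\<Sum>k\<in>UNIV. \<Sum>l\<in>UNIV. t k l * a k l) + \<dots> = (\<Sum>k\<in>UNIV. \<Sum>l\<in>UNIV. (t k l + t' l k) * a k l)"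
    by (simp add: sum.distrib distrib_right)
  also have "\<dots> = (\<Sum>p\<in>UNIV. weight d p * x $ p * y $ p)"
    by (simp add: 2 a_def sum.cartesian_product mult.assoc split_beta flip: UNIV_Times_UNIV)
  finally show ?thesis by (simp only: 1)
qed

lemma siegel_metric_chart:
  assumes d: "\<And>k. \<bar>d k\<bar> < 1" and V: "unitary_mat V"
  shows "siegel_metric (chart d V u) (chart_derivative d V u h) (chart_derivative d V u h')
    = (\<Sum>p\<in>UNIV. weight d p * frame u h $ p * frame u h' $ p)"
proof -
  have U: "unitary_mat (V ** cayley (skew u))" by (rule unitary_mat_closed(3)[OF V unitary_cayley_skew])
  show ?thesis
    unfolding chart_def chart_derivative_def Let_def
    using siegel_metric_orbit[where d=d, OF d U transpose_tangent] by (simp only: tangent_form)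
qed

text \<open>The Gram matrix is a congruence of the diagonal matrix of weights by the matrix of
  \<open>frame u\<close>. So the density splits into a factor in \<open>u\<close> and a factor in
  \<open>d\<close>, the same for every base point \<open>V\<close>.\<close>

lemma riemannian_density_chart:
  assumes d: "\<And>k. \<bar>d k\<bar> < 1" and V: "unitary_mat V"
  shows "riemannian_density siegel_metric (chart d V) u = \<bar>det (matrix (frame u))\<bar> * sqrt (\<Prod>p\<in>UNIV. weight d p)"
proof -
  let ?L = "matrix (frame u)"
  have fd: "frechet_derivative (chart d V) (at u) = chart_derivative d V u"
    using frechet_derivative_at[OF has_derivative_chart[where d=d, OF d V]] by simp
  have "gram_matrix siegel_metric (chart d V) u = transpose ?L ** (diag_mat (weight d) ** ?L)"
    unfolding gram_matrix_def fd siegel_metric_chart[where d=d, OF d V] diag_mat_mult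
    by (simp add: matrix_matrix_mult_def transpose_def vec_eq_iff matrix_def mult_ac)
  moreover have "det (diag_mat (weight d)) = (\<Prod>p\<in>UNIV. weight d p)"
    by (subst det_diagonal) (simp_all add: diag_mat_def)
  ultimately have "det (gram_matrix siegel_metric (chart d V) u) = (det ?L)\<^sup>2 * (\<Prod>p\<in>UNIV. weight d p)"
    by (simp add: det_mul power2_eq_square mult_ac)
  then show ?thesis by (simp add: riemannian_density_def real_sqrt_mult)
qed

lemma weight_pos:
  assumes "\<And>k. 0 < d k" "\<And>k. d k < 1" "inj d"
  shows "0 < weight d p"
proof -
  have 1: "(d k)\<^sup>2 < 1" for k using assms(1,2)[of k] by (simp add: power_less_one_iff)
  have 2: "d k \<noteq> d l" if "k < l" for k l using that assms(3) by (simp add: inj_eq)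
  have 3: "d k + d l > 0" "d k > 0" for k l using assms(1) by (auto intro: add_pos_pos)
  have 4: "d k + d l \<noteq> 0" "d k \<noteq> 0" for k l using 3 by (metis less_irrefl)+
  show ?thesis by (cases p) (auto simp: weight_def 1 4 dest: 2 intro!: divide_pos_pos mult_pos_pos)
qed

text \<open>A vector in the kernel has length 0 in the pulled-back metric, and positive weights then
  force \<open>frame u h = 0\<close>.\<close>

lemma inj_chart_derivative:
  assumes d: "\<And>k. 0 < d k" "\<And>k. d k < 1" "inj d" and V: "unitary_mat V"
  shows "inj (chart_derivative d V u)"
proof -
  have d': "\<bar>d k\<bar> < 1" for k using d(1,2)[of k] by simp
  have lin: "linear (chart_derivative d V u)"
    using has_derivative_linear[OF has_derivative_chart[where d=d, OF d' V]] .
  show ?thesis unfolding linear_injective_0[OF lin]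
  proof (intro allI impI)
    fix h assume "chart_derivative d V u h = 0"
    then have "(\<Sum>p\<in>UNIV. weight d p * frame u h $ p * frame u h $ p) = siegel_metric (chart d V u) 0 0"
      using siegel_metric_chart[where d=d, OF d' V, of u h h] by simp
    also have "\<dots> = 0"
      by (simp add: siegel_metric_def cnj_mat_def trace_def matrix_matrix_mult_def)
    finally have "\<forall>p\<in>UNIV. weight d p * frame u h $ p * frame u h $ p = 0"
      using weight_pos[OF d] by (subst (asm) sum_nonneg_eq_0_iff) (auto simp: mult.assoc less_imp_le)
    then have "frame u h = 0" using weight_pos[OF d] by (simp add: vec_eq_iff less_le)
    then show "h = 0" by (simp add: frame_eq_0_iff)
  qed
qed

lemma continuous_on_chart_derivative:
  assumes d: "\<And>k. \<bar>d k\<bar> < 1" and V: "unitary_mat V"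
  shows "continuous_on S (\<lambda>u. chart_derivative d V u h)"
proof -
  have c: "continuous_on S (\<lambda>u. V ** cayley (skew u))"
    by (intro continuous_on_matrix_mult continuous_on_cayley continuous_intros skew_resolvent_mult)
  have t: "continuous_on S (\<lambda>u. tangent d (frame u h))"
    unfolding tangent_def by (intro continuous_intros continuous_on_matrix_mult continuous_on_frame)
  have "invertible (mat 1 - takagi d (V ** cayley (skew u)))" for u
    by (rule contraction_mat_invertible[OF takagi_contraction[where d=d, OF d unitary_mat_closed(3)[OF V unitary_cayley_skew]]])
  then show ?thesis
    unfolding chart_derivative_def Let_def
    by (intro continuous_intros continuous_on_matrix_mult continuous_on_matrix_inv c t)
      (auto simp: takagi_def intro!: continuous_intros continuous_on_matrix_mult c)
qed

section \<open>Injectivity and openness of the charts\<close>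

lemma ex_chart_radius:
  "\<exists>r>0. \<forall>u\<in>cball 0 r. \<forall>v\<in>cball 0 r. \<forall>s. sign_function s \<longrightarrow>
     cayley (skew u) = cayley (skew v :: complex^'n::{finite,linorder}^'n::_) ** diag_mat s \<longrightarrow> u = v"
proof -
  let ?c = "\<lambda>u. cayley (skew u) :: complex^'n::_^'n::_"
  have "isCont ?c 0" using has_derivative_continuous[OF has_derivative_cayley_skew] by blast
  moreover have "?c 0 = mat 1"
    using matrix_inv_eqI[of "mat 1 :: complex^'n::_^'n::_" "mat 1"] by (simp add: cayley_def linear_0[OF linear_skew(1)])
  ultimately obtain e where e: "e > 0" "\<And>u. norm u < e \<Longrightarrow> norm (?c u - mat 1) < 1"
    unfolding continuous_at_eps_delta by (auto simp: dist_norm) (metis zero_less_one)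
  \<comment> \<open>Near 0 the diagonal entries of the Cayley matrix have positive real part, so a
    sign -1 in \<open>s\<close> is impossible. The radius is found without any reference to
    \<open>d\<close>; the closed ball is kept for later compactness arguments.\<close>
  have re: "Re (?c u $ k $ k) > 0" if "u \<in> cball 0 (e/2)" for u k
  proof -
    have "norm u < e" using that e(1) by auto
    then have "norm (?c u - mat 1) < 1" by (rule e(2))
    moreover have "cmod ((?c u - mat 1) $ k $ k) \<le> norm (?c u - mat 1)"
      using Finite_Cartesian_Product.norm_nth_le[of "(?c u - mat 1) $ k" k]
        Finite_Cartesian_Product.norm_nth_le[of "?c u - mat 1" k] by (rule order_trans)
    ultimately have "cmod (?c u $ k $ k - 1) < 1" by (simp add: mat_def)
    then show ?thesis using abs_Re_le_cmod[of "?c u $ k $ k - 1"] by simp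
  qed
  have "u = v" if u: "u \<in> cball 0 (e/2)" and v: "v \<in> cball 0 (e/2)" and s: "sign_function s"
    and eq: "?c u = ?c v ** diag_mat s" for u v s
  proof -
    have "s k = 1" for k
    proof (rule ccontr)
      assume "s k \<noteq> 1"
      then have "s k = - 1" using s by (auto simp: sign_function_def)
      then have "?c u $ k $ k = - (?c v $ k $ k)" unfolding eq by (simp add: diag_mat_mult)
      then show False using re[OF u, of k] re[OF v, of k] by simp
    qed
    then have "diag_mat s = mat 1" by (simp add: diag_mat_def mat_def vec_eq_iff)
    then have "?c u = ?c v" using eq by simp
    then have "skew u = (skew v :: complex^'n::_^'n::_)" using unitary_cayley(3)[OF adj_skew] by metis
    then show "u = v" by (metis unskew_skew)
  qed
  then show ?thesis using e(1) by (intro exI[of _ "e/2"]) auto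
qed

text \<open>Up to the known factors \<open>V\<close> and \<open>diag_mat s\<close>, a unitary
  \<open>X\<close> lies in the patch when it is in the domain of the inverse Cayley transform and
  has coordinates of norm below \<open>r\<close>; both are open conditions on
  \<open>X\<close>.\<close>

lemma openin_unitary_patch:
  fixes V :: "complex^'n::{finite,linorder}^'n::_"
  assumes V: "unitary_mat V" and s: "sign_function s"
  shows "openin (top_of_set {U. unitary_mat U})
    {X. unitary_mat X \<and> (\<exists>u\<in>ball 0 r. X ** diag_mat s = V ** cayley (skew u))}"
proof -
  let ?Y = "\<lambda>X. adj_mat V ** (X ** diag_mat s)"
  define T where "T = {X. invertible (?Y X + mat 1)}"
  define T' where "T' = {X \<in> T. norm (unskew (cayley_inv (?Y X))) < r}"
  have cY: "continuous_on A ?Y" for A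
    by (intro continuous_on_matrix_mult continuous_intros)
  have "T = (\<lambda>X. ?Y X + mat 1) -` {A. invertible A}" by (auto simp: T_def)
  moreover have "continuous_on UNIV (\<lambda>X. ?Y X + mat 1)" by (intro continuous_intros cY)
  ultimately have T: "open T" using open_vimage open_invertible by metis
  have "continuous_on T (\<lambda>X. norm (unskew (cayley_inv (?Y X))))"
    by (intro continuous_intros continuous_on_cayley_inv cY) (simp add: T_def)
  then have "open ((\<lambda>X. norm (unskew (cayley_inv (?Y X)))) -` {..<r} \<inter> T)"
    using continuous_on_open_vimage[OF T] open_lessThan by blast
  moreover have "(\<lambda>X. norm (unskew (cayley_inv (?Y X)))) -` {..<r} \<inter> T = T'" by (auto simp: T'_def)
  ultimately have T': "open T'" by simp
  have "{X. unitary_mat X \<and> (\<exists>u\<in>ball 0 r. X ** diag_mat s = V ** cayley (skew u))} = {U. unitary_mat U} \<inter> T'"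
  proof (intro set_eqI iffI)
    fix X assume "X \<in> {X. unitary_mat X \<and> (\<exists>u\<in>ball 0 r. X ** diag_mat s = V ** cayley (skew u))}"
    then obtain u where u: "unitary_mat X" "norm u < r" "X ** diag_mat s = V ** cayley (skew u)" by auto
    then have "?Y X = cayley (skew u)" by (simp add: unitary_mat_cancel[OF V])
    then show "X \<in> {U. unitary_mat U} \<inter> T'"
      using u unitary_cayley(2,3)[OF adj_skew[of u]] by (simp add: T'_def T_def unskew_skew)
  next
    fix X assume X: "X \<in> {U. unitary_mat U} \<inter> T'"
    then have Y: "unitary_mat (?Y X)"
      by (auto intro!: unitary_mat_closed(3) unitary_sign s unitary_mat_closed(1)[OF V])
    have inv: "invertible (?Y X + mat 1)" using X by (simp add: T'_def T_def)
    define u where "u = unskew (cayley_inv (?Y X))"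
    have "cayley (skew u) = ?Y X"
      unfolding u_def skew_unskew[OF skew_cayley_inv[OF Y inv]] by (rule cayley_cayley_inv(2)[OF inv])
    then have "X ** diag_mat s = V ** cayley (skew u)" by (simp add: unitary_mat_cancel[OF V])
    moreover have "u \<in> ball 0 r" using X by (simp add: T'_def u_def)
    ultimately show "X \<in> {X. unitary_mat X \<and> (\<exists>u\<in>ball 0 r. X ** diag_mat s = V ** cayley (skew u))}"
      using X by auto
  qed
  then show ?thesis using T' by (auto simp: openin_open)
qed

lemma continuous_on_siegel_point:
  assumes d: "\<And>k. \<bar>d k\<bar> < 1"
  shows "continuous_on {U. unitary_mat U} (siegel_point d)"
proof -
  have "continuous_on {U. unitary_mat U} (takagi d)"
    unfolding takagi_def[abs_def] by (intro continuous_on_matrix_mult continuous_intros)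
  then show ?thesis unfolding siegel_point_def[abs_def]
    by (intro continuous_on_matrix_mult continuous_intros continuous_on_cayley)
      (auto intro!: contraction_mat_invertible takagi_contraction[where d=d, OF d])
qed

text \<open>Relative openness is seen on the unitary group: the complement of the patch in the orbit
  is the continuous image of a compact set, the unitary matrices outside the sign-saturation of the
  patch.\<close>

lemma local_parametrisation_chart:
  fixes V :: "complex^'n::{finite,linorder}^'n::_"
  assumes d: "\<And>k. 0 < d k" "\<And>k. d k < 1" "inj d" and V: "unitary_mat V"
    and r: "\<And>u v s. u \<in> cball 0 r \<Longrightarrow> v \<in> cball 0 r \<Longrightarrow> sign_function s \<Longrightarrow>
      cayley (skew u) = cayley (skew v :: complex^'n::_^'n::_) ** diag_mat s \<Longrightarrow> u = v"
  shows "local_parametrisation (siegel_point d ` {U. unitary_mat U}) (ball 0 r) (chart d V)"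
proof -
  let ?UG = "{U :: complex^'n::_^'n::_. unitary_mat U}" and ?B = "ball 0 r :: (real^('n \<times> 'n)) set"
  let ?c = "\<lambda>u. cayley (skew u) :: complex^'n::_^'n::_"
  have d': "\<bar>d k\<bar> < 1" for k using d(1,2)[of k] by simp
  have Vc: "unitary_mat (V ** ?c u)" for u by (rule unitary_mat_closed(3)[OF V unitary_cayley_skew])
  note der = has_derivative_chart[where d=d, OF d' V]
  have fd: "frechet_derivative (chart d V) (at u) = chart_derivative d V u" for u
    using frechet_derivative_at[OF der] by simp
  have cont: "continuous_on A (chart d V)" for A
    using has_derivative_continuous[OF der] by (auto intro: continuous_at_imp_continuous_on)
  have inj: "inj_on (chart d V) (cball 0 r)"
  proof (rule inj_onI)
    fix u v assume uv: "u \<in> cball 0 r" "v \<in> cball 0 r" "chart d V u = chart d V v"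
    then obtain s where s: "sign_function s" "V ** ?c v = V ** ?c u ** diag_mat s"
      using siegel_point_eq_iff[where d=d, OF Vc Vc d] unfolding chart_def by blast
    then have "?c v = ?c u ** diag_mat s"
      using unitary_mat_cancel(1)[OF V] by (metis matrix_mul_assoc)
    then show "u = v" using r[OF uv(2,1) s(1)] by simp
  qed
  \<comment> \<open>Injectivity holds on the closed ball, whose compactness makes the inverse
    continuous; this restricts to the open ball.\<close>
  have hom: "\<exists>\<psi>. homeomorphism ?B (chart d V ` ?B) (chart d V) \<psi>"
    using homeomorphism_compact[OF compact_cball cont refl inj]
    by (meson homeomorphism_of_subsets ball_subset_cball image_mono)
  \<comment> \<open>Saturating by all sign matrices makes membership depend only on the orbit point,
    so \<open>Sat\<close> is exactly the preimage of the patch.\<close>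
  define Sat where "Sat = (\<Union>s\<in>{s. sign_function s}. {X. unitary_mat X \<and> (\<exists>u\<in>?B. X ** diag_mat s = V ** ?c u)})"
  have Sat_open: "openin (top_of_set ?UG) Sat"
    unfolding Sat_def using openin_unitary_patch[OF V] by (intro openin_Union) auto
  have Sat: "siegel_point d X \<in> chart d V ` ?B \<longleftrightarrow> X \<in> Sat" if X: "unitary_mat X" for X
  proof -
    have "siegel_point d X \<in> chart d V ` ?B \<longleftrightarrow> (\<exists>u\<in>?B. siegel_point d X = siegel_point d (V ** ?c u))"
      by (auto simp: chart_def)
    also have "\<dots> \<longleftrightarrow> (\<exists>u\<in>?B. \<exists>s. sign_function s \<and> V ** ?c u = X ** diag_mat s)"
      using siegel_point_eq_iff[where d=d, OF X Vc d] by simp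
    also have "\<dots> \<longleftrightarrow> (\<exists>s. sign_function s \<and> (\<exists>u\<in>?B. X ** diag_mat s = V ** ?c u))" by metis
    also have "\<dots> \<longleftrightarrow> X \<in> Sat" unfolding Sat_def using X by blast
    finally show ?thesis .
  qed
  have "closedin (top_of_set ?UG) (?UG - Sat)"
    using Sat_open by (metis closedin_def openin_diff closedin_diff closedin_topspace openin_closedin_eq topspace_euclidean_subtopology)
  then have "compact (?UG - Sat)" using compact_unitary closedin_compact by blast
  then have "compact (siegel_point d ` (?UG - Sat))"
    by (intro compact_continuous_image continuous_on_subset[OF continuous_on_siegel_point[where d=d, OF d']]) auto
  then have cl: "closed (siegel_point d ` (?UG - Sat))" by (rule compact_imp_closed)
  have "chart d V ` ?B = siegel_point d ` ?UG \<inter> - (siegel_point d ` (?UG - Sat))"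
  proof (intro set_eqI iffI)
    fix Z assume Z: "Z \<in> chart d V ` ?B"
    then have "Z \<in> siegel_point d ` ?UG" using Vc by (auto simp: chart_def)
    moreover have "Z \<notin> siegel_point d ` (?UG - Sat)" using Z Sat by blast
    ultimately show "Z \<in> siegel_point d ` ?UG \<inter> - (siegel_point d ` (?UG - Sat))" by blast
  next
    fix Z assume "Z \<in> siegel_point d ` ?UG \<inter> - (siegel_point d ` (?UG - Sat))"
    then obtain X where "unitary_mat X" "Z = siegel_point d X" "X \<in> Sat" by blast
    then show "Z \<in> chart d V ` ?B" using Sat by blast
  qed
  then have "openin (top_of_set (siegel_point d ` ?UG)) (chart d V ` ?B)"
    using cl by (metis openin_open open_Compl)
  moreover have "chart d V differentiable (at u)" for u using der differentiable_def by blast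
  ultimately show ?thesis
    unfolding local_parametrisation_def fd using hom inj_chart_derivative[OF d V]
      continuous_on_chart_derivative[where d=d, OF d' V] by simp
qed

lemma bilinear_siegel_metric: "bilinear (siegel_metric Z)"
proof -
  have cnj_scaleR: "cnj_mat (r *\<^sub>R A) = r *\<^sub>R cnj_mat A" for r and A :: "complex^'n^'n"
    by (simp add: cnj_mat_def vec_eq_iff)
  have trace_scaleR: "trace (r *\<^sub>R A) = r *\<^sub>R trace A" for r and A :: "complex^'n^'n"
    by (simp add: trace_def scaleR_sum_right)
  have left: "linear (\<lambda>V. Re (trace (P ** V ** Q ** R)))" for P Q R :: "complex^'n^'n"
  proof (rule linearI)
    show "Re (trace (P ** (V + W) ** Q ** R)) = Re (trace (P ** V ** Q ** R)) + Re (trace (P ** W ** Q ** R))" for V W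
      by (simp only: matrix_add_ldistrib matrix_add_rdistrib trace_add plus_complex.sel)
    show "Re (trace (P ** (c *\<^sub>R V) ** Q ** R)) = c *\<^sub>R Re (trace (P ** V ** Q ** R))" for c V
      by (simp only: matrix_mult_scaleR trace_scaleR scaleR_complex.sel real_scaleR_def)
  qed
  have right: "linear (\<lambda>V. Re (trace (P ** cnj_mat V)))" for P :: "complex^'n^'n"
  proof (rule linearI)
    show "Re (trace (P ** cnj_mat (V + W))) = Re (trace (P ** cnj_mat V)) + Re (trace (P ** cnj_mat W))" for V W
      by (simp only: matrix_add_ldistrib trace_add plus_complex.sel cnj_mat_simps)
    show "Re (trace (P ** cnj_mat (c *\<^sub>R V))) = c *\<^sub>R Re (trace (P ** cnj_mat V))" for c V
      by (simp only: matrix_mult_scaleR trace_scaleR cnj_scaleR scaleR_complex.sel real_scaleR_def)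
  qed
  show ?thesis
    unfolding bilinear_def siegel_metric_def Let_def using left right by blast
qed

lemma continuous_on_siegel_metric: "continuous_on siegel_half_space (\<lambda>Z. siegel_metric Z v w)"
proof -
  have im: "continuous_on siegel_half_space (\<lambda>Z. Im_mat Z)"
    unfolding Im_mat_def by (intro continuous_intros)
  have "continuous_on siegel_half_space (\<lambda>Z. matrix_inv (Im_mat Z))"
    using complex_mat_inv_Im(3) by (intro continuous_on_matrix_inv im) auto
  then have "continuous_on siegel_half_space (\<lambda>Z. complex_mat (matrix_inv (Im_mat Z)))"
    unfolding complex_mat_def by (intro continuous_intros)
  then show ?thesis
    unfolding siegel_metric_def Let_def trace_def
    by (intro continuous_intros continuous_on_matrix_mult)
qed

section \<open>The common atlas and the volume of an orbit\<close>

lemma finite_unitary_cover: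
  assumes r: "r > 0"
  obtains m :: nat and V :: "nat \<Rightarrow> complex^'n::{finite,linorder}^'n::_"
  where "0 < m" "\<And>k. unitary_mat (V k)"
    "\<And>X. unitary_mat X \<Longrightarrow> \<exists>k<m. \<exists>u\<in>ball 0 r. X = V k ** cayley (skew u)"
proof -
  define UG where "UG = {U :: complex^'n::_^'n::_. unitary_mat U}"
  define P where "P V = {X. unitary_mat X \<and> (\<exists>u\<in>ball 0 r. X = V ** cayley (skew u))}" for V :: "complex^'n::_^'n::_"
  have "\<forall>V\<in>UG. \<exists>T. open T \<and> P V = UG \<inter> T"
  proof
    fix V assume "V \<in> UG"
    then have "unitary_mat V" "sign_function (\<lambda>_::'n. 1)" by (simp_all add: UG_def sign_function_def)
    from openin_unitary_patch[OF this, of r] have "openin (top_of_set UG) (P V)"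
      unfolding P_def UG_def by (simp only: diag_mat_simps matrix_mul_rid)
    then show "\<exists>T. open T \<and> P V = UG \<inter> T" unfolding openin_open by blast
  qed
  from bchoice[OF this] obtain T where T: "\<And>V. V \<in> UG \<Longrightarrow> open (T V)" "\<And>V. V \<in> UG \<Longrightarrow> P V = UG \<inter> T V"
    by blast
  have c1: "cayley (skew 0) = (mat 1 :: complex^'n::_^'n::_)"
    using matrix_inv_eqI[of "mat 1 :: complex^'n::_^'n::_" "mat 1"] by (simp add: cayley_def linear_0[OF linear_skew(1)])
  have "V \<in> P V" if "V \<in> UG" for V
    using that r c1 by (auto simp: P_def UG_def intro!: bexI[of _ 0])
  then have TV: "V \<in> T V" if "V \<in> UG" for V using T(2) that by blast
  have cUG: "compact UG" unfolding UG_def by (rule compact_unitary)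
  obtain I where I: "I \<subseteq> UG" "finite I" "UG \<subseteq> (\<Union>V\<in>I. T V)"
    by (rule compactE_image[OF cUG, of UG T]) (use T(1) TV in auto)
  have one: "mat 1 \<in> UG" by (simp add: unitary_mat_def UG_def)
  obtain m :: nat and f where f: "I = f ` {i. i < m}"
    using finite_imp_nat_seg_image_inj_on[OF I(2)] by metis
  \<comment> \<open>Indices from \<open>m\<close> on are padded with the identity, so that unitarity
    holds for every \<open>k\<close>.\<close>
  define V where "V k = (if k < m then f k else mat 1)" for k
  show thesis
  proof (rule that)
    show "0 < m" using one I(3) f by (cases "m = 0") auto
    have "V k \<in> UG" for k using I(1) f one by (auto simp: V_def)
    then show "unitary_mat (V k)" for k by (simp add: UG_def)
    fix X :: "complex^'n::_^'n::_" assume X: "unitary_mat X"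
    then have XU: "X \<in> UG" by (simp add: UG_def)
    then obtain W where W: "W \<in> I" "X \<in> T W" using I(3) by blast
    then have "X \<in> P W" using T(2)[of W] XU I(1) by blast
    moreover obtain k where k: "k < m" "W = V k" using W f by (auto simp: V_def)
    ultimately have "\<exists>u\<in>ball 0 r. X = V k ** cayley (skew u)" by (simp add: P_def)
    then show "\<exists>k<m. \<exists>u\<in>ball 0 r. X = V k ** cayley (skew u)" using k by blast
  qed
qed

text \<open>The disjoint pieces of the atlas are defined by coincidences of orbit points, which
  \<open>siegel_point_eq_iff\<close> turns into a condition on unitary matrices. They are therefore
  the same for all \<open>d\<close>, and the \<open>d\<close>-factor of the density comes out of
  every integral.\<close>

theorem siegel_orbit_volume:
  "\<exists>C>0. \<forall>d :: 'n::{finite,linorder} \<Rightarrow> real. (\<forall>k. 0 < d k \<and> d k < 1) \<longrightarrow> inj d \<longrightarrow>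
     orbit_volume (\<chi> k. (d k)\<^sup>2) = ennreal (C * sqrt (\<Prod>p\<in>UNIV. weight d p))"
proof -
  obtain r where r0: "r > 0" and r: "\<And>u v s. u \<in> cball 0 r \<Longrightarrow> v \<in> cball 0 r \<Longrightarrow> sign_function s \<Longrightarrow>
      cayley (skew u) = cayley (skew v :: complex^'n::_^'n::_) ** diag_mat s \<Longrightarrow> u = v"
    using ex_chart_radius[where 'n='n] by blast
  obtain m :: nat and V :: "nat \<Rightarrow> complex^'n::_^'n::_" where m: "0 < m" and V: "\<And>k. unitary_mat (V k)"
    and cover: "\<And>X. unitary_mat X \<Longrightarrow> \<exists>k<m. \<exists>u\<in>ball 0 r. X = V k ** cayley (skew u)"
    using finite_unitary_cover[OF r0] by blast
  let ?B = "ball 0 r :: (real^('n \<times> 'n)) set"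
  let ?c = "\<lambda>u. cayley (skew u) :: complex^'n::_^'n::_"
  let ?det = "\<lambda>u :: real^('n \<times> 'n). \<bar>det (matrix (frame u))\<bar>"
  \<comment> \<open>This will turn out to be the \<open>piece k\<close> of each orbit; it is written
    without \<open>d\<close> so that \<open>Q\<close> can be fixed before \<open>d\<close>.\<close>
  define cell where "cell k = {u \<in> ?B. \<forall>j<k. \<forall>v\<in>?B. \<forall>s. sign_function s \<longrightarrow> V j ** ?c v \<noteq> V k ** ?c u ** diag_mat s}" for k
  define Q where "Q = (\<Sum>k<m. \<integral>\<^sup>+u\<in>cell k. ennreal (?det u) \<partial>lborel)"
  have cdet: "continuous_on A ?det" for A by (intro continuous_intros continuous_on_det_frame)
  have mdet: "?det \<in> borel_measurable borel" using cdet by (rule borel_measurable_continuous_onI)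
  have mind: "(\<lambda>u. ennreal (?det u) * indicator A u) \<in> borel_measurable lborel" if "A \<in> sets borel" for A
  proof -
    have "(\<lambda>u. ennreal (?det u)) \<in> borel_measurable lborel" using mdet by (intro measurable_compose[OF _ measurable_ennreal]) simp
    moreover have "indicator A \<in> borel_measurable lborel" using that by simp
    ultimately show ?thesis by (rule borel_measurable_times_ennreal)
  qed
  obtain b where b: "b > 0" "\<And>u. u \<in> cball 0 r \<Longrightarrow> ?det u \<le> b"
  proof -
    have "bounded (?det ` cball 0 r)"
      by (intro compact_imp_bounded compact_continuous_image cdet compact_cball)
    then show ?thesis using that unfolding bounded_pos by (auto simp: image_iff)
  qed
  have "(\<integral>\<^sup>+u\<in>cell k. ennreal (?det u) \<partial>lborel) < \<infinity>" for k
  proof -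
    have "(\<integral>\<^sup>+u\<in>cell k. ennreal (?det u) \<partial>lborel) \<le> (\<integral>\<^sup>+u. ennreal b * indicator ?B u \<partial>lborel)"
    proof (rule nn_integral_mono)
      fix u show "ennreal (?det u) * indicator (cell k) u \<le> ennreal b * indicator ?B u"
        using b(2)[of u] by (auto simp: cell_def indicator_def intro!: ennreal_leI)
    qed
    also have "\<dots> = ennreal b * emeasure lborel ?B" by (rule nn_integral_cmult_indicator) simp
    also have "\<dots> < \<infinity>" using emeasure_bounded_finite[of ?B] by (simp add: ennreal_mult_less_top)
    finally show ?thesis .
  qed
  then have Qfin: "Q < \<infinity>" unfolding Q_def by (simp add: less_top)
  \<comment> \<open>No patch precedes the one with index 0, so its cell is the whole ball, which has
    positive measure, and the integrand vanishes nowhere on it.\<close>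
  have Qpos: "Q > 0"
  proof -
    have "cell 0 = ?B" by (auto simp: cell_def)
    have "(\<integral>\<^sup>+u\<in>?B. ennreal (?det u) \<partial>lborel) \<noteq> 0"
    proof
      assume "(\<integral>\<^sup>+u\<in>?B. ennreal (?det u) \<partial>lborel) = 0"
      then have "AE u in lborel. ennreal (?det u) * indicator ?B u = 0"
        using mind[of ?B] by (subst (asm) nn_integral_0_iff_AE) auto
      then have "AE u in lborel. u \<notin> ?B"
        by eventually_elim (use det_frame in \<open>auto simp: indicator_def split: if_splits\<close>)
      then have "emeasure lborel ?B = 0" by (subst (asm) AE_iff_measurable[of ?B]) (auto simp: set_eq_iff)
      then show False using content_ball_pos[OF r0, of "0 :: real^('n \<times> 'n)"] by (simp add: measure_def)
    qed
    then have "0 < (\<integral>\<^sup>+u\<in>cell 0. ennreal (?det u) \<partial>lborel)" unfolding \<open>cell 0 = ?B\<close> by (simp add: zero_less_iff_neq_zero)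
    also have "\<dots> \<le> Q" unfolding Q_def using m by (intro member_le_sum) auto
    finally show ?thesis .
  qed
  show ?thesis
  proof (intro exI[of _ "enn2real Q"] conjI allI impI)
    show "0 < enn2real Q" using Qpos Qfin by (simp add: enn2real_positive_iff)
    fix d :: "'n \<Rightarrow> real" assume d: "\<forall>k. 0 < d k \<and> d k < 1" and inj: "inj d"
    let ?N = "siegel_point d ` {U. unitary_mat U}"
    have d1: "\<And>k. 0 < d k" "\<And>k. d k < 1" and d': "\<bar>d k\<bar> < 1" for k using d by auto (smt (verit))
    have N: "siegel_orbit (\<chi> k. (d k)\<^sup>2) = ?N" by (rule siegel_orbit_eq_image[OF d1 inj])
    have NH: "?N \<subseteq> siegel_half_space" unfolding N[symmetric] by (auto simp: siegel_orbit_def)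
    interpret riemannian_atlas siegel_metric ?N m "\<lambda>_. ?B" "\<lambda>k. chart d (V k)"
    proof
      show "bilinear (siegel_metric p)" for p :: "complex^'n::_^'n::_" by (rule bilinear_siegel_metric)
      show "continuous_on ?N (\<lambda>p. siegel_metric p v w)" for v w
        by (rule continuous_on_subset[OF continuous_on_siegel_metric NH])
      show "local_parametrisation ?N ?B (chart d (V k))" for k
        by (rule local_parametrisation_chart[OF d1 inj V]) (rule r)
      show "?N \<subseteq> (\<Union>k<m. chart d (V k) ` ?B)"
        using cover by (fastforce simp: chart_def)
    qed
    have Vc: "unitary_mat (V k ** ?c u)" for k u by (rule unitary_mat_closed(3)[OF V unitary_cayley_skew])
    have piece: "piece k ?N = cell k" for k
    proof -
      have "chart d (V k) u \<notin> chart d (V j) ` ?B \<longleftrightarrow>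
          (\<forall>v\<in>?B. \<forall>s. sign_function s \<longrightarrow> V j ** ?c v \<noteq> V k ** ?c u ** diag_mat s)" for u j
        using siegel_point_eq_iff[where d=d, OF Vc[of k u] Vc[of j] d1 inj] unfolding chart_def by auto
      moreover have "chart d (V k) u \<in> ?N" for u using Vc by (auto simp: chart_def)
      ultimately show ?thesis by (simp add: piece_def cell_def)
    qed
    let ?w = "sqrt (\<Prod>p\<in>UNIV. weight d p)"
    have w: "?w \<ge> 0" using weight_pos[OF d1 inj] by (intro real_sqrt_ge_zero prod_nonneg) (simp add: less_imp_le)
    have top: "?N \<in> sets (restrict_space borel ?N)"
      using sets.top[of "restrict_space borel ?N"] by (simp add: space_restrict_space)
    have "volume ?N = (\<Sum>k<m. \<integral>\<^sup>+u\<in>cell k. ennreal (?det u * ?w) \<partial>lborel)"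
      unfolding volume_def piece riemannian_density_chart[where d=d, OF d' V] ..
    also have "\<dots> = (\<Sum>k<m. ennreal ?w * (\<integral>\<^sup>+u\<in>cell k. ennreal (?det u) \<partial>lborel))"
    proof (rule sum.cong[OF refl])
      fix k assume "k \<in> {..<m}"
      then have "cell k \<in> sets borel" using piece_borel[OF top, of k] piece by simp
      then have "(\<lambda>u. ennreal (?det u) * indicator (cell k) u) \<in> borel_measurable lborel" by (rule mind)
      from nn_integral_cmult[OF this, of "ennreal ?w"]
      show "(\<integral>\<^sup>+u\<in>cell k. ennreal (?det u * ?w) \<partial>lborel) = ennreal ?w * (\<integral>\<^sup>+u\<in>cell k. ennreal (?det u) \<partial>lborel)"
        using w by (simp add: ennreal_mult mult_ac)
    qed
    also have "\<dots> = ennreal ?w * Q" by (simp only: Q_def sum_distrib_left)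
    also have "\<dots> = ennreal (enn2real Q * ?w)"
      using Qfin w by (simp add: ennreal_mult mult.commute less_top)
    finally show "orbit_volume (\<chi> k. (d k)\<^sup>2) = ennreal (enn2real Q * ?w)"
      unfolding orbit_volume_def N riemannian_volume_eq .
  qed
qed

section \<open>The Boltzmann entropy\<close>

text \<open>The identity \<open>1 - t^2 = 1 / cosh^2 (x / 2)\<close> turns the double-argument
  formulas into rational functions of \<open>t\<close>.\<close>

lemma sinh_cosh_half_tanh:
  fixes x :: real
  defines "t \<equiv> tanh (x / 2)"
  shows "sinh x = 2 * t / (1 - t\<^sup>2)" "cosh x = (1 + t\<^sup>2) / (1 - t\<^sup>2)" "1 - t\<^sup>2 > 0"
proof -
  let ?c = "cosh (x / 2)" and ?s = "sinh (x / 2)"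
  have c: "?c > 0" by simp
  have cs: "?c\<^sup>2 - ?s\<^sup>2 = 1" by (simp add: hyperbolic_pythagoras)
  have "1 - t\<^sup>2 = (?c\<^sup>2 - ?s\<^sup>2) / ?c\<^sup>2"
    using c by (simp add: t_def tanh_def power_divide diff_divide_distrib)
  then have 1: "1 - t\<^sup>2 = 1 / ?c\<^sup>2" by (simp only: cs)
  then show "1 - t\<^sup>2 > 0" using c by simp
  have "sinh x = 2 * ?s * ?c" using sinh_double[of "x / 2"] by simp
  also have "\<dots> = 2 * t / (1 - t\<^sup>2)"
    using c unfolding 1 by (simp add: t_def tanh_def field_simps power2_eq_square)
  finally show "sinh x = 2 * t / (1 - t\<^sup>2)" .
  have "cosh x = ?c\<^sup>2 + ?s\<^sup>2" using cosh_double[of "x / 2"] by simp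
  also have "\<dots> = (1 + t\<^sup>2) / (1 - t\<^sup>2)"
    using c unfolding 1 by (simp add: t_def tanh_def field_simps power_divide)
  finally show "cosh x = (1 + t\<^sup>2) / (1 - t\<^sup>2)" .
qed

lemma cosh_less_cosh: "0 < x \<Longrightarrow> x < y \<Longrightarrow> cosh x < cosh (y :: real)"
  using cosh_real_strict_mono by fastforce

text \<open>On positive reals the squared half-argument tanh is strictly increasing with values in
  (0, 1), so the order of the eigenvalues can be read off \<open>\<sigma>\<close>.\<close>

lemma sigma_chamber_iff:
  "\<sigma> \<in> sigma_chamber \<longleftrightarrow> (\<forall>k. 0 < \<sigma> $ k) \<and> (\<forall>j k. j < k \<longrightarrow> \<sigma> $ j < \<sigma> $ k)"
  for \<sigma> :: "real^'n::{finite,linorder}"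
proof -
  have lt: "(tanh (\<sigma> $ j / 2))\<^sup>2 < (tanh (\<sigma> $ k / 2))\<^sup>2 \<longleftrightarrow> \<sigma> $ j < \<sigma> $ k" if "\<forall>k. 0 < \<sigma> $ k" for j k
    using that[THEN spec, of j] that[THEN spec, of k]
    by (simp add: abs_le_square_iff[symmetric] not_le[symmetric] del: not_le)
  have "0 < (tanh (\<sigma> $ k / 2))\<^sup>2 \<and> (tanh (\<sigma> $ k / 2))\<^sup>2 < 1" if "\<forall>k. 0 < \<sigma> $ k" for k
    using that[THEN spec, of k] sinh_cosh_half_tanh(3)[of "\<sigma> $ k"] by simp
  then show ?thesis using lt by (auto simp: sigma_chamber_def eigenvalue_chamber_def lambda_of_def)
qed

lemma open_sigma_chamber: "open (sigma_chamber :: (real^'n::{finite,linorder}) set)"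
proof -
  have "(sigma_chamber :: (real^'n::_) set) =
      (\<Inter>k. {\<sigma>. 0 < \<sigma> $ k}) \<inter> (\<Inter>p\<in>{(j, k). j < k}. {\<sigma>. \<sigma> $ fst p < \<sigma> $ snd p})"
    by (auto simp: sigma_chamber_iff)
  moreover have "open \<dots>"
    by (intro open_Int open_INT ballI open_Collect_less continuous_intros) auto
  ultimately show ?thesis by simp
qed

text \<open>Grouping mirrored pairs is what \<open>weight\<close> needs: it brings the factors with
  \<open>d l - d k\<close> and \<open>d l + d k\<close> together into a difference of
  squares.\<close>

lemma prod_Times_linorder:
  fixes f :: "'n::{finite,linorder} \<times> 'n \<Rightarrow> 'a::comm_monoid_mult"
  shows "(\<Prod>p\<in>UNIV. f p) = (\<Prod>k\<in>UNIV. f (k, k)) * (\<Prod>(k, l)\<in>{(k, l). k < l}. f (k, l) * f (l, k))"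
proof -
  define L where "L = {(k :: 'n, l). k < l}"
  have U: "UNIV = range (\<lambda>k :: 'n. (k, k)) \<union> (L \<union> prod.swap ` L)"
    by (auto simp: image_iff L_def)
  have "(\<Prod>p\<in>UNIV. f p) = (\<Prod>p\<in>range (\<lambda>k. (k, k)). f p) * ((\<Prod>p\<in>L. f p) * (\<Prod>p\<in>prod.swap ` L. f p))"
    unfolding U by (subst prod.union_disjoint, simp, simp, force simp: L_def)
      (subst prod.union_disjoint, auto simp: L_def)
  also have "(\<Prod>p\<in>range (\<lambda>k. (k, k)). f p) = (\<Prod>k\<in>UNIV. f (k, k))"
    by (subst prod.reindex) (auto simp: inj_on_def)
  also have "(\<Prod>p\<in>prod.swap ` L. f p) = (\<Prod>(k, l)\<in>L. f (l, k))"
    by (subst prod.reindex) (auto simp: inj_on_def split_beta prod.swap_def)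
  finally show ?thesis unfolding L_def[symmetric] by (simp add: split_beta prod.distrib)
qed

lemma sum_offdiagonal_linorder:
  fixes f :: "'n::{finite,linorder} \<Rightarrow> 'n \<Rightarrow> 'a::comm_monoid_add"
  shows "(\<Sum>k\<in>UNIV. \<Sum>l\<in>UNIV - {k}. f k l) = (\<Sum>(k, l)\<in>{(k, l). k < l}. f k l + f l k)"
proof -
  define L where "L = {(k :: 'n, l). k < l}"
  have "(\<Sum>k\<in>UNIV. \<Sum>l\<in>UNIV - {k}. f k l) = (\<Sum>(k, l)\<in>(SIGMA k:UNIV. UNIV - {k}). f k l)"
    by (rule sum.Sigma) auto
  also have "(SIGMA k:UNIV. UNIV - {k}) = L \<union> prod.swap ` L"
    by (auto simp: image_iff L_def)
  also have "(\<Sum>(k, l)\<in>L \<union> prod.swap ` L. f k l) = (\<Sum>(k, l)\<in>L. f k l) + (\<Sum>(k, l)\<in>prod.swap ` L. f k l)"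
    by (rule sum.union_disjoint) (auto simp: L_def)
  also have "(\<Sum>(k, l)\<in>prod.swap ` L. f k l) = (\<Sum>(k, l)\<in>L. f l k)"
    by (subst sum.reindex) (auto simp: inj_on_def split_beta)
  finally show ?thesis unfolding L_def[symmetric] by (simp add: split_beta sum.distrib)
qed

text \<open>A diagonal weight is the square of \<open>2 * sinh\<close>. With \<open>a\<close> and
  \<open>b\<close> the two values of tanh, mirrored weights multiply to 64 times the square of
  \<open>a^2 - b^2\<close> over \<open>(1 - a^2) (1 - b^2)\<close>, while the difference of the two
  cosh is 2 times that quotient; hence the factor 4.\<close>

lemma sqrt_prod_weight:
  fixes \<sigma> :: "real^'n::{finite,linorder}"
  assumes \<sigma>: "\<And>k. 0 < \<sigma> $ k"
  shows "sqrt (\<Prod>p\<in>UNIV. weight (\<lambda>k. tanh (\<sigma> $ k / 2)) p) =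
    (\<Prod>k\<in>UNIV. 2 * sinh (\<sigma> $ k)) * (\<Prod>(k, l)\<in>{(k, l). k < l}. 4 * \<bar>cosh (\<sigma> $ k) - cosh (\<sigma> $ l)\<bar>)"
proof -
  let ?t = "\<lambda>k. tanh (\<sigma> $ k / 2)"
  note half = sinh_cosh_half_tanh
  have diag: "weight ?t (k, k) = (2 * sinh (\<sigma> $ k))\<^sup>2" for k
    unfolding weight_def half(1) by (simp add: power2_eq_square)
  have off: "weight ?t (k, l) * weight ?t (l, k) = (4 * \<bar>cosh (\<sigma> $ k) - cosh (\<sigma> $ l)\<bar>)\<^sup>2" if "k < l" for k l
  proof -
    define a b where "a = ?t k" and "b = ?t l"
    have ab: "1 - a\<^sup>2 \<noteq> 0" "1 - b\<^sup>2 \<noteq> 0" using half(3)[of "\<sigma> $ k"] half(3)[of "\<sigma> $ l"] by (auto simp: a_def b_def)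
    have "cosh (\<sigma> $ k) - cosh (\<sigma> $ l) = ((1 + a\<^sup>2) * (1 - b\<^sup>2) - (1 + b\<^sup>2) * (1 - a\<^sup>2)) / ((1 - a\<^sup>2) * (1 - b\<^sup>2))"
      unfolding half(2) a_def[symmetric] b_def[symmetric] using ab by (simp add: diff_frac_eq)
    also have "(1 + a\<^sup>2) * (1 - b\<^sup>2) - (1 + b\<^sup>2) * (1 - a\<^sup>2) = 2 * ((a - b) * (a + b))"
      by (simp add: algebra_simps power2_eq_square)
    finally have "(4 * \<bar>cosh (\<sigma> $ k) - cosh (\<sigma> $ l)\<bar>)\<^sup>2 = (8 * ((a - b) * (a + b)) / ((1 - a\<^sup>2) * (1 - b\<^sup>2)))\<^sup>2"
      by (simp add: power_mult_distrib power_divide)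
    moreover have "weight ?t (k, l) * weight ?t (l, k) = (8 * ((a - b) * (a + b)) / ((1 - a\<^sup>2) * (1 - b\<^sup>2)))\<^sup>2"
    proof -
      have w: "weight ?t (k, l) = 8 * (b - a)\<^sup>2 / ((1 - a\<^sup>2) * (1 - b\<^sup>2))"
        "weight ?t (l, k) = 8 * (a + b)\<^sup>2 / ((1 - b\<^sup>2) * (1 - a\<^sup>2))"
        using that by (auto simp: weight_def a_def b_def)
      have "8 * p / (x * y) * (8 * q / (y * x)) = 64 * (p * q) / (x * y)\<^sup>2" for p q x y :: real
        by (simp add: power2_eq_square mult_ac)
      moreover have "(8 * (p * q) / z)\<^sup>2 = 64 * (p\<^sup>2 * q\<^sup>2) / z\<^sup>2" for p q z :: real
        by (simp add: power_mult_distrib power_divide)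
      ultimately show ?thesis unfolding w by (simp only: power2_commute[of b a])
    qed
    ultimately show ?thesis by simp
  qed
  have "(\<Prod>p\<in>UNIV. weight ?t p) = (\<Prod>k\<in>UNIV. (2 * sinh (\<sigma> $ k))\<^sup>2) * (\<Prod>(k, l)\<in>{(k, l). k < l}. (4 * \<bar>cosh (\<sigma> $ k) - cosh (\<sigma> $ l)\<bar>)\<^sup>2)"
    unfolding prod_Times_linorder[of "weight ?t"] by (intro arg_cong2[where f="(*)"] prod.cong) (auto simp: diag off)
  also have "\<dots> = ((\<Prod>k\<in>UNIV. 2 * sinh (\<sigma> $ k)) * (\<Prod>(k, l)\<in>{(k, l). k < l}. 4 * \<bar>cosh (\<sigma> $ k) - cosh (\<sigma> $ l)\<bar>))\<^sup>2"
    by (simp add: prod_power_distrib power_mult_distrib split_beta)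
  finally show ?thesis
    using \<sigma> by (simp add: real_sqrt_abs abs_mult abs_prod split_beta less_imp_le)
qed

definition entropy_formula :: "real^'n::{finite,linorder} \<Rightarrow> real" where
  "entropy_formula \<sigma> = (\<Sum>k\<in>UNIV. ln (sinh (\<sigma> $ k)))
     + (\<Sum>(k, l)\<in>{(k, l). k < l}. ln \<bar>cosh (\<sigma> $ k) - cosh (\<sigma> $ l)\<bar>)"

text \<open>Positivity and finiteness are claimed too because \<open>enn2real\<close> sends an
  infinite volume to 0 and \<open>ln 0\<close> is 0: they certify that the entropy is not a default
  value.\<close>

lemma orbit_volume_formula:
  "\<exists>C>0. \<forall>\<sigma> \<in> (sigma_chamber :: (real^'n::{finite,linorder}) set).
     0 < orbit_volume (lambda_of \<sigma>) \<and> orbit_volume (lambda_of \<sigma>) < \<infinity> \<and>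
     boltzmann_entropy \<sigma> = entropy_formula \<sigma> + ln C"
proof -
  obtain C where C: "C > 0" and vol: "\<And>d :: 'n \<Rightarrow> real. (\<forall>k. 0 < d k \<and> d k < 1) \<Longrightarrow> inj d \<Longrightarrow>
     orbit_volume (\<chi> k. (d k)\<^sup>2) = ennreal (C * sqrt (\<Prod>p\<in>UNIV. weight d p))"
    using siegel_orbit_volume[where 'n='n] by blast
  let ?L = "{(k :: 'n, l). k < l}"
  \<comment> \<open>The factors 2 and 4 of \<open>sqrt_prod_weight\<close> occur n and n(n-1)/2
    times, whatever \<open>\<sigma>\<close> is, so they join the constant.\<close>
  define C' where "C' = C * (\<Prod>k\<in>(UNIV :: 'n set). 2) * (\<Prod>p\<in>?L. 4)"
  have C': "C' > 0" using C by (simp add: C'_def)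
  show ?thesis
  proof (intro exI[of _ C'] conjI ballI)
    show "C' > 0" by (rule C')
    fix \<sigma> :: "real^'n::_" assume "\<sigma> \<in> sigma_chamber"
    then have \<sigma>: "\<And>k. 0 < \<sigma> $ k" and mono: "\<And>j k. j < k \<Longrightarrow> \<sigma> $ j < \<sigma> $ k" by (auto simp: sigma_chamber_iff)
    define S T where "S = (\<Prod>k\<in>UNIV. sinh (\<sigma> $ k))" and "T = (\<Prod>(k, l)\<in>?L. \<bar>cosh (\<sigma> $ k) - cosh (\<sigma> $ l)\<bar>)"
    have ne: "cosh (\<sigma> $ k) - cosh (\<sigma> $ l) \<noteq> 0" if "k < l" for k l
      using cosh_less_cosh[OF \<sigma> mono[OF that]] by linarith
    have S: "S > 0" unfolding S_def using \<sigma> by (intro prod_pos) auto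
    have T: "T > 0" unfolding T_def using ne by (intro prod_pos) auto
    have "inj (\<lambda>k. tanh (\<sigma> $ k / 2))"
    proof (rule injI)
      fix j k assume "tanh (\<sigma> $ j / 2) = tanh (\<sigma> $ k / 2)"
      then have "\<sigma> $ j = \<sigma> $ k" by simp
      then show "j = k" using mono by (metis less_irrefl linorder_neqE)
    qed
    moreover have "\<forall>k. 0 < tanh (\<sigma> $ k / 2) \<and> tanh (\<sigma> $ k / 2) < 1"
      using \<sigma> tanh_real_lt_1 by simp
    ultimately have "orbit_volume (lambda_of \<sigma>) = ennreal (C * sqrt (\<Prod>p\<in>UNIV. weight (\<lambda>k. tanh (\<sigma> $ k / 2)) p))"
      unfolding lambda_of_def using vol by simp
    also have "C * sqrt (\<Prod>p\<in>UNIV. weight (\<lambda>k. tanh (\<sigma> $ k / 2)) p) = S * T * C'"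
      unfolding sqrt_prod_weight[OF \<sigma>] S_def T_def C'_def by (simp add: prod.distrib split_beta mult_ac)
    finally have v: "orbit_volume (lambda_of \<sigma>) = ennreal (S * T * C')" .
    show "0 < orbit_volume (lambda_of \<sigma>)" "orbit_volume (lambda_of \<sigma>) < \<infinity>" unfolding v using S T C' by simp_all
    have "boltzmann_entropy \<sigma> = ln (S * T * C')" unfolding boltzmann_entropy_def v using S T C' by simp
    also have "\<dots> = ln S + ln T + ln C'" using S T C' by (simp add: ln_mult)
    also have "ln S = (\<Sum>k\<in>UNIV. ln (sinh (\<sigma> $ k)))" unfolding S_def
      by (intro ln_prod) (simp_all add: less_imp_neq[OF \<sigma>, symmetric] \<sigma>)
    also have "ln T = (\<Sum>(k, l)\<in>?L. ln \<bar>cosh (\<sigma> $ k) - cosh (\<sigma> $ l)\<bar>)"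
      unfolding T_def split_beta using ne by (intro ln_prod) auto
    finally show "boltzmann_entropy \<sigma> = entropy_formula \<sigma> + ln C'" by (simp add: entropy_formula_def)
  qed
qed

section \<open>Gradient of the entropy\<close>

lemma gderiv_entropy_formula:
  fixes \<sigma> :: "real^'n::{finite,linorder}"
  assumes "\<sigma> \<in> sigma_chamber"
  shows "GDERIV entropy_formula \<sigma> :> 2 *\<^sub>R sigma_drift \<sigma>"
proof -
  let ?L = "{(k :: 'n, l). k < l}"
  have \<sigma>: "\<And>k. 0 < \<sigma> $ k" and mono: "\<And>j k. j < k \<Longrightarrow> \<sigma> $ j < \<sigma> $ k"
    using assms by (auto simp: sigma_chamber_iff)
  have coord: "((\<lambda>x. x $ k) has_derivative (\<lambda>h. h $ k)) (at \<sigma>)" for k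
    by (rule bounded_linear_imp_has_derivative[OF bounded_linear_vec_nth])
  have d1: "((\<lambda>x. ln (sinh (x $ k))) has_derivative (\<lambda>h. cosh (\<sigma> $ k) / sinh (\<sigma> $ k) * h $ k)) (at \<sigma>)" for k
  proof -
    have "((\<lambda>y. ln (sinh y)) has_real_derivative cosh (\<sigma> $ k) / sinh (\<sigma> $ k)) (at (\<sigma> $ k))"
      using \<sigma>[of k] by (auto intro!: derivative_eq_intros)
    from diff_chain_at[OF coord this[unfolded has_field_derivative_def]]
    show ?thesis by (simp add: o_def)
  qed
  let ?a = "\<lambda>k l. sinh (\<sigma> $ k) / (cosh (\<sigma> $ k) - cosh (\<sigma> $ l))"
  \<comment> \<open>The coefficient of \<open>h $ l\<close> has no minus sign because the
    denominator of \<open>?a l k\<close> is that of \<open>?a k l\<close> with the opposite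
    sign.\<close>
  have d2: "((\<lambda>x. ln \<bar>cosh (x $ k) - cosh (x $ l)\<bar>) has_derivative (\<lambda>h. ?a k l * h $ k + ?a l k * h $ l)) (at \<sigma>)" if "k < l" for k l
  proof -
    have lt: "cosh (\<sigma> $ k) < cosh (\<sigma> $ l)" by (rule cosh_less_cosh[OF \<sigma> mono[OF that]])
    have cd: "((\<lambda>x. cosh (x $ i)) has_derivative (\<lambda>h. sinh (\<sigma> $ i) * h $ i)) (at \<sigma>)" for i
    proof -
      have "(cosh has_real_derivative sinh (\<sigma> $ i)) (at (\<sigma> $ i))" by (auto intro!: derivative_eq_intros)
      from diff_chain_at[OF coord this[unfolded has_field_derivative_def]]
      show ?thesis by (simp add: o_def)
    qed
    have "((\<lambda>x. cosh (x $ l) - cosh (x $ k)) has_derivative (\<lambda>h. sinh (\<sigma> $ l) * h $ l - sinh (\<sigma> $ k) * h $ k)) (at \<sigma>)"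
      by (intro has_derivative_diff cd)
    moreover have "(ln has_derivative (\<lambda>y. y / (cosh (\<sigma> $ l) - cosh (\<sigma> $ k)))) (at (cosh (\<sigma> $ l) - cosh (\<sigma> $ k)))"
    proof -
      have "(ln has_real_derivative 1 / (cosh (\<sigma> $ l) - cosh (\<sigma> $ k))) (at (cosh (\<sigma> $ l) - cosh (\<sigma> $ k)))"
        using lt by (intro DERIV_ln_divide) simp
      moreover have "(*) (1 / (cosh (\<sigma> $ l) - cosh (\<sigma> $ k))) = (\<lambda>y. y / (cosh (\<sigma> $ l) - cosh (\<sigma> $ k)))"
        by (simp add: fun_eq_iff)
      ultimately show ?thesis by (simp only: has_field_derivative_def)
    qed
    ultimately have "((\<lambda>x. ln (cosh (x $ l) - cosh (x $ k))) has_derivative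
        (\<lambda>h. (sinh (\<sigma> $ l) * h $ l - sinh (\<sigma> $ k) * h $ k) / (cosh (\<sigma> $ l) - cosh (\<sigma> $ k)))) (at \<sigma>)"
      using diff_chain_at[of "\<lambda>x. cosh (x $ l) - cosh (x $ k)" _ \<sigma> ln] by (simp add: o_def)
    moreover have "(sinh (\<sigma> $ l) * h $ l - sinh (\<sigma> $ k) * h $ k) / (cosh (\<sigma> $ l) - cosh (\<sigma> $ k)) = ?a k l * h $ k + ?a l k * h $ l" for h :: "real^'n::_"
    proof -
      have "sinh (\<sigma> $ k) * h $ k / (cosh (\<sigma> $ k) - cosh (\<sigma> $ l)) = - (sinh (\<sigma> $ k) * h $ k / (cosh (\<sigma> $ l) - cosh (\<sigma> $ k)))"
        by (metis minus_diff_eq minus_divide_right)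
      then show ?thesis by (simp add: diff_divide_distrib)
    qed
    ultimately have "((\<lambda>x. ln (cosh (x $ l) - cosh (x $ k))) has_derivative (\<lambda>h. ?a k l * h $ k + ?a l k * h $ l)) (at \<sigma>)"
      by simp
    \<comment> \<open>The order of the coordinates decides the sign inside the absolute value, and
      it persists in a neighbourhood because the chamber is open.\<close>
    moreover have "\<forall>\<^sub>F x in at \<sigma>. ln (cosh (x $ l) - cosh (x $ k)) = ln \<bar>cosh (x $ k) - cosh (x $ l)\<bar>"
    proof -
      have "\<forall>\<^sub>F x in at \<sigma>. x \<in> sigma_chamber"
        using eventually_at_in_open'[OF open_sigma_chamber assms] .
      then show ?thesis
        by eventually_elim (use that cosh_less_cosh in \<open>force simp: sigma_chamber_iff\<close>)
    qed
    ultimately show ?thesis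
      by (rule has_derivative_transform_eventually) (use lt in auto)
  qed
  have "(entropy_formula has_derivative
      (\<lambda>h. (\<Sum>k\<in>UNIV. cosh (\<sigma> $ k) / sinh (\<sigma> $ k) * h $ k) + (\<Sum>p\<in>?L. ?a (fst p) (snd p) * h $ fst p + ?a (snd p) (fst p) * h $ snd p))) (at \<sigma>)"
    unfolding entropy_formula_def[abs_def] split_beta
    by (intro has_derivative_add has_derivative_sum d1 d2) auto
  moreover have "(\<Sum>k\<in>UNIV. cosh (\<sigma> $ k) / sinh (\<sigma> $ k) * h $ k) + (\<Sum>p\<in>?L. ?a (fst p) (snd p) * h $ fst p + ?a (snd p) (fst p) * h $ snd p)
      = h \<bullet> (2 *\<^sub>R sigma_drift \<sigma>)" for h
  proof -
    \<comment> \<open>Each unordered pair feeds two coordinates; regrouped by the coordinate of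
      \<open>h\<close>, the sum over pairs becomes the inner sum of the drift over
      \<open>l \<noteq> k\<close>.\<close>
    have "(\<Sum>p\<in>?L. ?a (fst p) (snd p) * h $ fst p + ?a (snd p) (fst p) * h $ snd p) = (\<Sum>k\<in>UNIV. \<Sum>l\<in>UNIV - {k}. ?a k l * h $ k)"
      unfolding sum_offdiagonal_linorder by (simp add: split_beta)
    moreover have "h \<bullet> (2 *\<^sub>R sigma_drift \<sigma>) = (\<Sum>k\<in>UNIV. h $ k * (cosh (\<sigma> $ k) / sinh (\<sigma> $ k) + (\<Sum>l\<in>UNIV - {k}. ?a k l)))"
    proof -
      have half: "2 * (1/2 * z) = z" for z :: real by simp
      show ?thesis
        by (simp only: inner_vec_def sigma_drift_def vec_lambda_beta vector_scaleR_component real_scaleR_def inner_real_def half)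
    qed
    ultimately show ?thesis
      by (simp add: distrib_left sum.distrib sum_distrib_left mult.commute)
  qed
  ultimately show ?thesis by (simp add: gderiv_def)
qed

lemma gradient_eqI: "GDERIV f x :> D \<Longrightarrow> gradient f x = D"
  unfolding gradient_def
proof (rule the_equality)
  fix D' assume "GDERIV f x :> D" "GDERIV f x :> D'"
  then have "(\<lambda>h. h \<bullet> D) = (\<lambda>h. h \<bullet> D')"
    unfolding gderiv_def using has_derivative_unique by blast
  then have "\<forall>h. h \<bullet> D = h \<bullet> D'" by metis
  then have "(D' - D) \<bullet> (D' - D) = 0" by (simp add: inner_diff_right)
  then show "D' = D" by simp
qed

text \<open>Entropy and formula are known to differ by a constant on the chamber; since it is open,
  this determines the derivative there.\<close>

lemma gderiv_boltzmann_entropy: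
  fixes \<sigma> :: "real^'n::{finite,linorder}"
  assumes "\<sigma> \<in> sigma_chamber"
  shows "GDERIV boltzmann_entropy \<sigma> :> 2 *\<^sub>R sigma_drift \<sigma>"
proof -
  obtain C where eq: "\<And>x :: real^'n::_. x \<in> sigma_chamber \<Longrightarrow> boltzmann_entropy x = entropy_formula x + ln C"
    using orbit_volume_formula[where 'n='n] by blast
  have "((\<lambda>x. entropy_formula x + ln C) has_derivative (\<lambda>h. h \<bullet> (2 *\<^sub>R sigma_drift \<sigma>))) (at \<sigma>)"
    using gderiv_entropy_formula[OF assms] unfolding gderiv_def by (auto intro!: derivative_eq_intros)
  moreover have "\<forall>\<^sub>F x in at \<sigma>. entropy_formula x + ln C = boltzmann_entropy x"
    using eventually_at_in_open'[OF open_sigma_chamber assms] by eventually_elim (simp add: eq)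
  ultimately show ?thesis unfolding gderiv_def
    by (rule has_derivative_transform_eventually) (simp_all add: eq assms)
qed

section \<open>Equivalence of the two stochastic equations\<close>

lemma integral_equation_cong:
  fixes b b' :: "'a \<Rightarrow> 'b::euclidean_space" and Y :: "real \<Rightarrow> 'a"
  assumes b: "\<And>x. x \<in> D \<Longrightarrow> b x = b' x"
    and Y: "\<forall>t\<ge>0. ereal t < T \<longrightarrow> Y t \<in> D \<and> ((\<lambda>s. b (Y s)) has_integral I t) {0..t}"
  shows "\<forall>t\<ge>0. ereal t < T \<longrightarrow> Y t \<in> D \<and> ((\<lambda>s. b' (Y s)) has_integral I t) {0..t}"
proof (intro allI impI conjI)
  fix t :: real assume t: "0 \<le> t" "ereal t < T"
  then show "Y t \<in> D" using Y by blast
  \<comment> \<open>All times up to \<open>t\<close> lie before \<open>T\<close>, so the path is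
    still in \<open>D\<close>, where the drifts agree, throughout the interval of
    integration.\<close>
  have "b (Y s) = b' (Y s)" if "s \<in> {0..t}" for s
  proof (rule b)
    have "ereal s < T" using that t(2) by (meson atLeastAtMost_iff ereal_less_eq(3) order_le_less_trans)
    then show "Y s \<in> D" using Y that by auto
  qed
  then show "((\<lambda>s. b' (Y s)) has_integral I t) {0..t}"
    using Y t has_integral_cong[of "{0..t}" "\<lambda>s. b (Y s)" "\<lambda>s. b' (Y s)" "I t"] by blast
qed

text \<open>A solution stays in \<open>D\<close> before \<open>\<tau>\<close> by definition, so
  drifts that agree on \<open>D\<close> give the same integral equation along almost every path,
  with the same noise term.\<close>

lemma solves_sde_cong:
  assumes b: "\<And>x. x \<in> D \<Longrightarrow> b x = b' x"
  shows "solves_sde b \<epsilon> D M F W X \<tau> \<longleftrightarrow> solves_sde b' \<epsilon> D M F W X \<tau>"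
proof -
  have "(\<forall>t\<ge>0. ereal t < \<tau> \<omega> \<longrightarrow> X t \<omega> \<in> D \<and> ((\<lambda>s. b (X s \<omega>)) has_integral I t) {0..t}) \<longleftrightarrow>
     (\<forall>t\<ge>0. ereal t < \<tau> \<omega> \<longrightarrow> X t \<omega> \<in> D \<and> ((\<lambda>s. b' (X s \<omega>)) has_integral I t) {0..t})"
    (is "?L \<longleftrightarrow> ?R") for \<omega> I
  proof
    assume L: ?L
    show ?R by (rule integral_equation_cong[where Y="\<lambda>t. X t \<omega>", OF _ L]) (rule b)
  next
    assume R: ?R
    show ?L by (rule integral_equation_cong[where Y="\<lambda>t. X t \<omega>", OF _ R]) (rule b[symmetric])
  qed
  then show ?thesis unfolding solves_sde_def by simp
qed

text \<open>\<open>C\<close> is chosen before \<open>\<sigma>\<close>, so \<open>ln C\<close> is an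
  additive constant fixed by the dimension. Differentiability accompanies the drift identity because
  \<open>gradient\<close> is a definite description, meaningful only where a gradient
  exists.\<close>

theorem theorem2:
  shows
    "(\<exists>C>0. \<forall>\<sigma> \<in> (sigma_chamber :: (real^'n::{finite,linorder}) set).
        0 < orbit_volume (lambda_of \<sigma>) \<and> orbit_volume (lambda_of \<sigma>) < \<infinity> \<and>
        boltzmann_entropy \<sigma> =
          (\<Sum>k\<in>UNIV. ln (sinh (\<sigma> $ k)))
          + (\<Sum>(k, l) \<in> {(k, l). k < l}. ln \<bar>cosh (\<sigma> $ k) - cosh (\<sigma> $ l)\<bar>)
          + ln C) \<and>
     (\<forall>\<sigma> \<in> (sigma_chamber :: (real^'n::{finite,linorder}) set).
        boltzmann_entropy differentiable (at \<sigma>) \<and>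
        sigma_drift \<sigma> = (1/2) *\<^sub>R gradient boltzmann_entropy \<sigma>) \<and>
     (\<forall>(\<beta> :: ereal) (M :: 'w measure) F (W :: real \<Rightarrow> 'w \<Rightarrow> real^'n::{finite,linorder}) X \<tau>.
        0 < \<beta> \<longrightarrow>
        (solves_sde sigma_drift (noise_amplitude \<beta>) sigma_chamber M F W X \<tau> \<longleftrightarrow>
         solves_sde (\<lambda>\<sigma>. (1/2) *\<^sub>R gradient boltzmann_entropy \<sigma>)
           (noise_amplitude \<beta>) sigma_chamber M F W X \<tau>))"
proof (intro conjI ballI allI impI)
  show "\<exists>C>0. \<forall>\<sigma> \<in> (sigma_chamber :: (real^'n::_) set).
        0 < orbit_volume (lambda_of \<sigma>) \<and> orbit_volume (lambda_of \<sigma>) < \<infinity> \<and>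
        boltzmann_entropy \<sigma> =
          (\<Sum>k\<in>UNIV. ln (sinh (\<sigma> $ k)))
          + (\<Sum>(k, l) \<in> {(k, l). k < l}. ln \<bar>cosh (\<sigma> $ k) - cosh (\<sigma> $ l)\<bar>)
          + ln C"
    using orbit_volume_formula[where 'n='n] unfolding entropy_formula_def .
  show "boltzmann_entropy differentiable (at \<sigma>)" if "\<sigma> \<in> sigma_chamber" for \<sigma> :: "real^'n::_"
    using gderiv_boltzmann_entropy[OF that] unfolding gderiv_def differentiable_def by blast
  show drift: "sigma_drift \<sigma> = (1/2) *\<^sub>R gradient boltzmann_entropy \<sigma>" if "\<sigma> \<in> sigma_chamber" for \<sigma> :: "real^'n::_"
    using gradient_eqI[OF gderiv_boltzmann_entropy[OF that]] by simp
  show "solves_sde sigma_drift (noise_amplitude \<beta>) sigma_chamber M F W X \<tau> \<longleftrightarrow>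
      solves_sde (\<lambda>\<sigma>. (1/2) *\<^sub>R gradient boltzmann_entropy \<sigma>) (noise_amplitude \<beta>) sigma_chamber M F W X \<tau>"
    for \<beta> and M :: "'w measure" and F and W :: "real \<Rightarrow> 'w \<Rightarrow> real^'n::_" and X \<tau>
    by (rule solves_sde_cong) (rule drift)
qed

end
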